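(* Let $\Bbbk$ be an algebraically closed field of characteristic zero, $N > 1$ an odd integer, and $q \in \Bbbk$ a primitive $N$-th root of unity. If $H = \overline{U}_q(\mathfrak{sl}_2)$ or $H = \overline{\mathcal{O}}_q(SL_2)$, then the set $\overline{\mathcal{C}}(H)$ of orbits of right coideal subalgebras of $H$ under the action of the group of Hopf algebra automorphisms of $H$ is infinite.
   Context: A right coideal subalgebra of a Hopf algebra $H$ is a (unital) subalgebra $A$ with $\Delta(A) \subset A \otimes H$. $\mathcal{C}(H)$ is the set of right coideal subalgebras of $H$; the group of Hopf algebra automorphisms of $H$ acts on it by $A \mapsto \vartheta(A)$, and $\overline{\mathcal{C}}(H)$ is the set of orbits. $\overline{U}_q(\mathfrak{sl}_2)$ is the algebra generated by $K, E, F$ subject to $K^N = 1$, $KE = q^2 EK$, $KF = q^{-2}FK$, $E^N = F^N = 0$, $EF - FE = (K - K^{-1})/(q - q^{-1})$; it is a Hopf algebra with $\Delta(K) = K \otimes K$, $\Delta(E) = E \otimes K + 1 \otimes E$, $\Delta(F) = F \otimes 1 + K^{-1} \otimes F$. $\overline{\mathcal{O}}_q(SL_2)$ is the algebra generated by $a,b,c,d$ subject to $ba = qab$, $ca = qac$, $bc = cb$, $db = qbd$, $dc = qcd$, $ad - q^{-1}bc = da - qbc = a^N = d^N = 1$, $b^N = c^N = 0$; it is a Hopf algebra with $\Delta(a) = a\otimes a + b \otimes c$, $\Delta(b) = a \otimes b + b \otimes d$, $\Delta(c) = c \otimes a + d \otimes c$, $\Delta(d) = c \otimes b + d \otimes d$.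 It is isomorphic to the dual Hopf algebra of $\overline{U}_q(\mathfrak{sl}_2)$. *)

theory Defs
  imports
    "HOL-Computational_Algebra.Polynomial"
    "HOL-Algebra.QuotRing"
    "HOL-Algebra.Subrings"
    "HOL-Algebra.Generated_Groups"
    "HOL-Algebra.Group_Action"
begin

text \<open>
  The ground field is a type \<open>'k\<close> of class \<^class>\<open>field\<close>.  A (not necessarily commutative)
  algebra over it is a record of type \<open>('k, 'a) module\<close>: the ring operations together with the
  action of the scalars.
\<close>

definition ground_algebra :: "('k::field, 'k) module" where
  "ground_algebra =
     \<lparr>carrier = UNIV, mult = (*), one = 1, zero = 0, add = (+), smult = (*)\<rparr>"

definition opposite_algebra ::
    "('k, 'a, 'x) module_scheme \<Rightarrow> ('k, 'a, 'x) module_scheme" where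
  "opposite_algebra A = A\<lparr>mult := \<lambda>x y. y \<otimes>\<^bsub>A\<^esub> x\<rparr>"

text \<open>
  The scalar action on cosets follows the pattern of \<^const>\<open>rcoset_mult\<close>.
\<close>

definition quotient_algebra ::
    "('k, 'a, 'x) module_scheme \<Rightarrow> 'a set \<Rightarrow> ('k, 'a set) module" where
  "quotient_algebra A I =
     ring.extend (A Quot I) (module.fields (\<lambda>c X. \<Union>x\<in>X. I +>\<^bsub>A\<^esub> (c \<odot>\<^bsub>A\<^esub> x)))"

text \<open>
  The value on a coset of the map induced by \<open>f\<close>; it is meaningful whenever \<open>f\<close> is constant
  on cosets, which for a homomorphism means that it kills the ideal.
\<close>

definition quotient_lift :: "('a \<Rightarrow> 'b) \<Rightarrow> 'a set \<Rightarrow> 'b" where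
  "quotient_lift f X = the_elem (f ` X)"


section \<open>Monoid algebras, free algebras and presentations\<close>

definition monoid_algebra ::
    "('m, 'x) monoid_scheme \<Rightarrow> ('k::field, 'm \<Rightarrow> 'k) module" where
  "monoid_algebra M =
     \<lparr>carrier = {f. finite {m. f m \<noteq> 0} \<and> {m. f m \<noteq> 0} \<subseteq> carrier M},
      mult = (\<lambda>f g m. \<Sum>(x, y) \<in> {(x, y). f x \<noteq> 0 \<and> g y \<noteq> 0 \<and> x \<otimes>\<^bsub>M\<^esub> y = m}. f x * g y),
      one = (\<lambda>m. if m = \<one>\<^bsub>M\<^esub> then 1 else 0),
      zero = (\<lambda>m. 0),
      add = (\<lambda>f g m. f m + g m),
      smult = (\<lambda>c f m. c * f m)\<rparr>"

definition basis_element :: "'m \<Rightarrow> 'm \<Rightarrow> 'k::field" where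
  "basis_element m = (\<lambda>m'. if m' = m then 1 else 0)"

definition linear_extension ::
    "('k::field, 'v, 'x) module_scheme \<Rightarrow> ('m \<Rightarrow> 'v) \<Rightarrow> ('m \<Rightarrow> 'k) \<Rightarrow> 'v" where
  "linear_extension V \<phi> f = (\<Oplus>\<^bsub>V\<^esub> m \<in> {m. f m \<noteq> 0}. f m \<odot>\<^bsub>V\<^esub> \<phi> m)"

definition free_monoid :: "'g list monoid" where
  "free_monoid = \<lparr>carrier = UNIV, mult = (@), one = []\<rparr>"

abbreviation free_algebra :: "('k::field, 'g list \<Rightarrow> 'k) module" where
  "free_algebra \<equiv> monoid_algebra free_monoid"

abbreviation free_generator :: "'g \<Rightarrow> 'g list \<Rightarrow> 'k::field" where
  "free_generator g \<equiv> basis_element [g]"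

definition free_extension ::
    "('k::field, 'a, 'x) module_scheme \<Rightarrow> ('g \<Rightarrow> 'a) \<Rightarrow> ('g list \<Rightarrow> 'k) \<Rightarrow> 'a" where
  "free_extension A \<gamma> =
     linear_extension A (\<lambda>w. foldr (\<lambda>g x. \<gamma> g \<otimes>\<^bsub>A\<^esub> x) w \<one>\<^bsub>A\<^esub>)"

definition presented_algebra ::
    "('g list \<Rightarrow> 'k::field) set \<Rightarrow> ('k, ('g list \<Rightarrow> 'k) set) module" where
  "presented_algebra R = quotient_algebra free_algebra (Idl\<^bsub>free_algebra\<^esub> R)"

definition presented_generator ::
    "('g list \<Rightarrow> 'k::field) set \<Rightarrow> 'g \<Rightarrow> ('g list \<Rightarrow> 'k) set" where
  "presented_generator R g = (Idl\<^bsub>free_algebra\<^esub> R) +>\<^bsub>free_algebra\<^esub> free_generator g"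


section \<open>Tensor products of algebras\<close>

text \<open>
  The free vector space on \<open>carrier A \<times> carrier B\<close> is regarded as the monoid algebra of the
  direct product of the multiplicative monoids.  The linear span of the bilinearity relations
  is already an ideal of it, so that the quotient below is the usual tensor product of vector
  spaces with the multiplication \<open>(x \<otimes> y) (x' \<otimes> y') = x x' \<otimes> y y'\<close>.
\<close>

definition bilinearity_relations ::
    "('k::field, 'a, 'x) module_scheme \<Rightarrow> ('k, 'b, 'y) module_scheme \<Rightarrow> ('a \<times> 'b \<Rightarrow> 'k) set" where
  "bilinearity_relations A B =
     (let F = monoid_algebra (A \<times>\<times> B); e = (\<lambda>x y. basis_element (x, y)) in
       {e (x \<oplus>\<^bsub>A\<^esub> x') y \<ominus>\<^bsub>F\<^esub> (e x y \<oplus>\<^bsub>F\<^esub> e x' y) | x x' y.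
          x \<in> carrier A \<and> x' \<in> carrier A \<and> y \<in> carrier B} \<union>
       {e x (y \<oplus>\<^bsub>B\<^esub> y') \<ominus>\<^bsub>F\<^esub> (e x y \<oplus>\<^bsub>F\<^esub> e x y') | x y y'.
          x \<in> carrier A \<and> y \<in> carrier B \<and> y' \<in> carrier B} \<union>
       {e (c \<odot>\<^bsub>A\<^esub> x) y \<ominus>\<^bsub>F\<^esub> (c \<odot>\<^bsub>F\<^esub> e x y) | c x y. x \<in> carrier A \<and> y \<in> carrier B} \<union>
       {e x (c \<odot>\<^bsub>B\<^esub> y) \<ominus>\<^bsub>F\<^esub> (c \<odot>\<^bsub>F\<^esub> e x y) | c x y. x \<in> carrier A \<and> y \<in> carrier B})"

definition tensor_ideal ::
    "('k::field, 'a, 'x) module_scheme \<Rightarrow> ('k, 'b, 'y) module_scheme \<Rightarrow> ('a \<times> 'b \<Rightarrow> 'k) set" where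
  "tensor_ideal A B = Idl\<^bsub>monoid_algebra (A \<times>\<times> B)\<^esub> (bilinearity_relations A B)"

definition tensor_algebra ::
    "('k::field, 'a, 'x) module_scheme \<Rightarrow> ('k, 'b, 'y) module_scheme \<Rightarrow>
      ('k, ('a \<times> 'b \<Rightarrow> 'k) set) module" where
  "tensor_algebra A B = quotient_algebra (monoid_algebra (A \<times>\<times> B)) (tensor_ideal A B)"

definition pure_tensor ::
    "('k::field, 'a, 'x) module_scheme \<Rightarrow> ('k, 'b, 'y) module_scheme \<Rightarrow>
      'a \<Rightarrow> 'b \<Rightarrow> ('a \<times> 'b \<Rightarrow> 'k) set" where
  "pure_tensor A B x y =
     tensor_ideal A B +>\<^bsub>monoid_algebra (A \<times>\<times> B)\<^esub> basis_element (x, y)"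

definition tensor_map ::
    "('k::field, 'c, 'x) module_scheme \<Rightarrow> ('k, 'd, 'y) module_scheme \<Rightarrow>
      ('a \<Rightarrow> 'c) \<Rightarrow> ('b \<Rightarrow> 'd) \<Rightarrow> ('a \<times> 'b \<Rightarrow> 'k) set \<Rightarrow> ('c \<times> 'd \<Rightarrow> 'k) set" where
  "tensor_map C D f g =
     quotient_lift (linear_extension (tensor_algebra C D) (\<lambda>(x, y). pure_tensor C D (f x) (g y)))"

text \<open>
  For subspaces \<open>X\<close> of \<open>A\<close> and \<open>Y\<close> of \<open>B\<close>, the subspace \<open>X \<otimes> Y\<close> of \<open>A \<otimes> B\<close>.  Pure tensors
  absorb scalars, so its elements are the finite sums of pure tensors.
\<close>

definition tensor_subspace ::
    "('k::field, 'a, 'x) module_scheme \<Rightarrow> ('k, 'b, 'y) module_scheme \<Rightarrow>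
      'a set \<Rightarrow> 'b set \<Rightarrow> ('a \<times> 'b \<Rightarrow> 'k) set set" where
  "tensor_subspace A B X Y =
     generate (add_monoid (tensor_algebra A B)) {pure_tensor A B x y | x y. x \<in> X \<and> y \<in> Y}"


section \<open>Right coideal subalgebras and Hopf algebra automorphisms\<close>

record ('k, 'h) hopf = "('k, 'h) module" +
  comult :: "'h \<Rightarrow> ('h \<times> 'h \<Rightarrow> 'k) set"
  counit :: "'h \<Rightarrow> 'k"
  antipode :: "'h \<Rightarrow> 'h"

definition right_coideal_subalgebras :: "('k::field, 'h) hopf \<Rightarrow> 'h set set" where
  "right_coideal_subalgebras H =
     {A. subring A H \<and> (\<forall>c. \<forall>x\<in>A. c \<odot>\<^bsub>H\<^esub> x \<in> A) \<and>
         comult H ` A \<subseteq> tensor_subspace H H A (carrier H)}"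

definition hopf_automorphisms :: "('k::field, 'h) hopf \<Rightarrow> ('h \<Rightarrow> 'h) set" where
  "hopf_automorphisms H =
     {\<theta> \<in> ring_hom H H \<inter> Bij (carrier H).
       \<forall>x\<in>carrier H.
         (\<forall>c. \<theta> (c \<odot>\<^bsub>H\<^esub> x) = c \<odot>\<^bsub>H\<^esub> \<theta> x) \<and>
         comult H (\<theta> x) = tensor_map H H \<theta> \<theta> (comult H x) \<and>
         counit H (\<theta> x) = counit H x \<and>
         antipode H (\<theta> x) = \<theta> (antipode H x)}"

definition hopf_automorphism_group :: "('k::field, 'h) hopf \<Rightarrow> ('h \<Rightarrow> 'h) monoid" where
  "hopf_automorphism_group H = BijGroup (carrier H) \<lparr>carrier := hopf_automorphisms H\<rparr>"

definition right_coideal_subalgebra_orbits :: "('k::field, 'h) hopf \<Rightarrow> 'h set set set" where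
  "right_coideal_subalgebra_orbits H =
     orbits (hopf_automorphism_group H) (right_coideal_subalgebras H)
       (\<lambda>\<theta>. \<lambda>A \<in> right_coideal_subalgebras H. \<theta> ` A)"


section \<open>Hopf algebras given by generators and relations\<close>

text \<open>
  The structure maps are given on the generators; the comultiplication and the counit extend
  to algebra homomorphisms, the antipode to an algebra antihomomorphism.
\<close>

definition presented_hopf_algebra ::
    "('g list \<Rightarrow> 'k::field) set \<Rightarrow>
     ('g \<Rightarrow> (('g list \<Rightarrow> 'k) set \<times> ('g list \<Rightarrow> 'k) set \<Rightarrow> 'k) set) \<Rightarrow>
     ('g \<Rightarrow> 'k) \<Rightarrow> ('g \<Rightarrow> ('g list \<Rightarrow> 'k) set) \<Rightarrow> ('k, ('g list \<Rightarrow> 'k) set) hopf" where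
  "presented_hopf_algebra R \<delta> \<epsilon> \<sigma> =
     (let A = presented_algebra R in
       module.extend A
         (hopf.fields
           (quotient_lift (free_extension (tensor_algebra A A) \<delta>))
           (quotient_lift (free_extension ground_algebra \<epsilon>))
           (quotient_lift (free_extension (opposite_algebra A) \<sigma>))))"


section \<open>The small quantum group of sl(2)\<close>

datatype U_gen = U_K | U_E | U_F

text \<open>
  As \<open>K^N = 1\<close>, the inverse of \<open>K\<close> is \<open>K^(N-1)\<close>.  Each element \<open>u \<ominus> v\<close> stands for the
  relation \<open>u = v\<close>.
\<close>

context
  fixes A :: "('k::field, 'a) module" (structure)
begin

definition U_relators :: "nat \<Rightarrow> 'k \<Rightarrow> 'a \<Rightarrow> 'a \<Rightarrow> 'a \<Rightarrow> 'a set" where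
  "U_relators N q K E F =
     {K [^] N \<ominus> \<one>,
      (K \<otimes> E) \<ominus> (q^2 \<odot> (E \<otimes> K)),
      (K \<otimes> F) \<ominus> ((1 / q^2) \<odot> (F \<otimes> K)),
      E [^] N,
      F [^] N,
      ((E \<otimes> F) \<ominus> (F \<otimes> E)) \<ominus> ((1 / (q - 1 / q)) \<odot> (K \<ominus> (K [^] (N - 1))))}"

end

definition U_relations :: "nat \<Rightarrow> 'k::field \<Rightarrow> (U_gen list \<Rightarrow> 'k) set" where
  "U_relations N q = U_relators free_algebra N q
     (free_generator U_K) (free_generator U_E) (free_generator U_F)"

text \<open>
  The counit and the antipode are the ones forced by the comultiplication:
  \<open>S K = K\<^sup>-\<^sup>1\<close>, \<open>S E = - E K\<^sup>-\<^sup>1\<close>, \<open>S F = - K F\<close>.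
\<close>

definition U_bar :: "nat \<Rightarrow> 'k::field \<Rightarrow> ('k, (U_gen list \<Rightarrow> 'k) set) hopf" where
  "U_bar N q =
     (let R = U_relations N q;
          A = presented_algebra R;
          T = tensor_algebra A A;
          t = pure_tensor A A;
          K = presented_generator R U_K;
          E = presented_generator R U_E;
          F = presented_generator R U_F;
          K' = K [^]\<^bsub>A\<^esub> (N - 1)
      in presented_hopf_algebra R
        (\<lambda>g. case g of
            U_K \<Rightarrow> t K K
          | U_E \<Rightarrow> t E K \<oplus>\<^bsub>T\<^esub> t \<one>\<^bsub>A\<^esub> E
          | U_F \<Rightarrow> t F \<one>\<^bsub>A\<^esub> \<oplus>\<^bsub>T\<^esub> t K' F)
        (\<lambda>g. case g of U_K \<Rightarrow> 1 | U_E \<Rightarrow> 0 | U_F \<Rightarrow> 0)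
        (\<lambda>g. case g of
            U_K \<Rightarrow> K'
          | U_E \<Rightarrow> \<ominus>\<^bsub>A\<^esub> (E \<otimes>\<^bsub>A\<^esub> K')
          | U_F \<Rightarrow> \<ominus>\<^bsub>A\<^esub> (K \<otimes>\<^bsub>A\<^esub> F)))"


section \<open>The small quantized coordinate ring of SL(2)\<close>

datatype O_gen = O_a | O_b | O_c | O_d

context
  fixes A :: "('k::field, 'a) module" (structure)
begin

definition O_relators :: "nat \<Rightarrow> 'k \<Rightarrow> 'a \<Rightarrow> 'a \<Rightarrow> 'a \<Rightarrow> 'a \<Rightarrow> 'a set" where
  "O_relators N q a b c d =
     {(b \<otimes> a) \<ominus> (q \<odot> (a \<otimes> b)),
      (c \<otimes> a) \<ominus> (q \<odot> (a \<otimes> c)),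
      (b \<otimes> c) \<ominus> (c \<otimes> b),
      (d \<otimes> b) \<ominus> (q \<odot> (b \<otimes> d)),
      (d \<otimes> c) \<ominus> (q \<odot> (c \<otimes> d)),
      ((a \<otimes> d) \<ominus> ((1 / q) \<odot> (b \<otimes> c))) \<ominus> \<one>,
      ((d \<otimes> a) \<ominus> (q \<odot> (b \<otimes> c))) \<ominus> \<one>,
      a [^] N \<ominus> \<one>,
      d [^] N \<ominus> \<one>,
      b [^] N,
      c [^] N}"

end

definition O_relations :: "nat \<Rightarrow> 'k::field \<Rightarrow> (O_gen list \<Rightarrow> 'k) set" where
  "O_relations N q = O_relators free_algebra N q
     (free_generator O_a) (free_generator O_b) (free_generator O_c) (free_generator O_d)"

text \<open>
  Again the counit and the antipode are forced: \<open>S a = d\<close>, \<open>S b = - q b\<close>,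
  \<open>S c = - q\<^sup>-\<^sup>1 c\<close>, \<open>S d = a\<close>.
\<close>

definition O_bar :: "nat \<Rightarrow> 'k::field \<Rightarrow> ('k, (O_gen list \<Rightarrow> 'k) set) hopf" where
  "O_bar N q =
     (let R = O_relations N q;
          A = presented_algebra R;
          T = tensor_algebra A A;
          t = pure_tensor A A;
          a = presented_generator R O_a;
          b = presented_generator R O_b;
          c = presented_generator R O_c;
          d = presented_generator R O_d
      in presented_hopf_algebra R
        (\<lambda>g. case g of
            O_a \<Rightarrow> t a a \<oplus>\<^bsub>T\<^esub> t b c
          | O_b \<Rightarrow> t a b \<oplus>\<^bsub>T\<^esub> t b d
          | O_c \<Rightarrow> t c a \<oplus>\<^bsub>T\<^esub> t d c
          | O_d \<Rightarrow> t c b \<oplus>\<^bsub>T\<^esub> t d d)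
        (\<lambda>g. case g of O_a \<Rightarrow> 1 | O_b \<Rightarrow> 0 | O_c \<Rightarrow> 0 | O_d \<Rightarrow> 1)
        (\<lambda>g. case g of
            O_a \<Rightarrow> d
          | O_b \<Rightarrow> (- q) \<odot>\<^bsub>A\<^esub> b
          | O_c \<Rightarrow> (- (1 / q)) \<odot>\<^bsub>A\<^esub> c
          | O_d \<Rightarrow> a))"

definition primitive_root_of_unity :: "nat \<Rightarrow> 'k::field \<Rightarrow> bool" where
  "primitive_root_of_unity N q \<longleftrightarrow> q ^ N = 1 \<and> (\<forall>m. 0 < m \<and> m < N \<longrightarrow> q ^ m \<noteq> 1)"

end

theory Submission
  imports Defs
begin

text \<open>
  Since \<open>\<Delta> x = x \<otimes> K + 1 \<otimes> (E + t K F)\<close> for \<open>x = x\<^sub>t = E + t K F + K\<close>, this element generates a right coideal subalgebra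
  \<open>A\<^sub>t\<close> of the small quantum group.  A Hopf automorphism \<open>\<theta>\<close> can be controlled without a PBW basis by
  composing it with the two-dimensional representation \<open>\<rho>\<close>: convolution products of coefficients of
  \<open>\<rho>\<close> satisfy the relations of the quantized coordinate ring, and evaluating these on the grouplike
  \<open>\<theta>(K)\<close> and the skew primitives \<open>\<theta>(E)\<close>, \<open>\<theta>(K F)\<close> shows that \<open>\<rho> \<theta>\<close> agrees with \<open>\<rho>\<close> up to rescaling
  \<open>E\<close> by \<open>\<alpha>\<close> and \<open>F\<close> by \<open>\<alpha>\<^sup>-\<^sup>1\<close>.  If \<open>\<theta>(A\<^sub>t) = A\<^sub>s\<close>, then \<open>\<rho>(\<theta>(x\<^sub>t))\<close> commutes with \<open>\<rho>(x\<^sub>s)\<close>, which forces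
  \<open>\<alpha> = 1\<close> and \<open>t = s\<close>.

  The coordinate ring is treated dually.  Its family consists of quantum spheres, each annihilated by
  a combination \<open>K F - (t/q) E - const (K - \<epsilon>)\<close> of skew derivations.  An automorphism \<open>\<theta>\<close> can only
  rescale the functionals \<open>E\<close> and \<open>K F\<close> by inverse factors, because it respects the relations between
  their convolution products and \<open>K\<close>; pulling back the functional which annihilates \<open>\<theta>(A\<^sub>t) = A\<^sub>s\<close> and
  evaluating it on two generators of \<open>A\<^sub>t\<close> again gives \<open>t = s\<close>.
\<close>

section \<open>Algebras over a field\<close>

text \<open>The family has to survive the automorphisms that multiply \<open>E\<close> by \<alpha>
  and \<open>F\<close> by 1/\<alpha>. Up to a scalar these turn \<open>E + t K F\<close> into
  \<open>E + (t/\<alpha>^2) K F\<close>, so this element alone would lose its parameter; the summand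
  \<open>K\<close>, whose image under \<rho> no automorphism changes, pins the scale. The mixed
  summand of the quantum spheres has the same effect. Without a basis, an element can be seen to be
  nonzero only by mapping it to an explicit algebra, and the universal property of the presentation
  supplies a two-dimensional and a three-dimensional representation. The relations of the dual
  algebra leave few possibilities for the composite of such a representation with \<theta>. The
  degenerate ones are excluded by surjectivity: a coefficient that vanishes on the generators would
  vanish on all of \<open>H\<close>, hence on elements where the original representation does not
  vanish. Factors such as q - 1, q^2 - 1 and q^4 - 1 are cancelled throughout; since
  \<open>N\<close> is odd, squaring preserves primitive \<open>N\<close>-th roots of unity, so these
  factors are nonzero.\<close>

locale kalgebra = ring A for A :: "('k::field, 'a, 'x) module_scheme" (structure) +
  assumes smult_closed [simp, intro]: "x \<in> carrier A \<Longrightarrow> c \<odot> x \<in> carrier A"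
    and smult_r_distr: "x \<in> carrier A \<Longrightarrow> y \<in> carrier A \<Longrightarrow> c \<odot> (x \<oplus> y) = c \<odot> x \<oplus> c \<odot> y"
    and smult_l_distr: "x \<in> carrier A \<Longrightarrow> (c + d) \<odot> x = c \<odot> x \<oplus> d \<odot> x"
    and smult_assoc: "x \<in> carrier A \<Longrightarrow> (c * d) \<odot> x = c \<odot> (d \<odot> x)"
    and smult_one [simp]: "x \<in> carrier A \<Longrightarrow> 1 \<odot> x = x"
    and smult_mult_l: "x \<in> carrier A \<Longrightarrow> y \<in> carrier A \<Longrightarrow> (c \<odot> x) \<otimes> y = c \<odot> (x \<otimes> y)"
    and smult_mult_r: "x \<in> carrier A \<Longrightarrow> y \<in> carrier A \<Longrightarrow> x \<otimes> (c \<odot> y) = c \<odot> (x \<otimes> y)"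
begin

lemma smult_zero_l [simp]: assumes "x \<in> carrier A" shows "0 \<odot> x = \<zero>"
proof -
  have "0 \<odot> x \<oplus> 0 \<odot> x = 0 \<odot> x" using smult_l_distr[OF assms, of 0 0] by simp
  then show ?thesis using assms by (metis add.r_cancel_one' smult_closed)
qed

lemma smult_zero_r [simp]: "c \<odot> \<zero> = \<zero>"
proof -
  have "c \<odot> \<zero> \<oplus> c \<odot> \<zero> = c \<odot> \<zero>" using smult_r_distr[of \<zero> \<zero> c] by simp
  then show ?thesis by (metis add.r_cancel_one' smult_closed zero_closed)
qed

lemma smult_minus_l: assumes "x \<in> carrier A" shows "(- c) \<odot> x = \<ominus> (c \<odot> x)"
proof -
  have "(- c) \<odot> x \<oplus> c \<odot> x = \<zero>" using smult_l_distr[OF assms, of "- c" c] assms by simp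
  then show ?thesis using assms by (simp add: minus_equality)
qed

lemma smult_minus_r: assumes "x \<in> carrier A" shows "c \<odot> (\<ominus> x) = \<ominus> (c \<odot> x)"
proof -
  have "c \<odot> (\<ominus> x) \<oplus> c \<odot> x = \<zero>" using smult_r_distr[of "\<ominus> x" x c] assms by (simp add: l_neg)
  then show ?thesis using assms by (simp add: minus_equality)
qed

lemma minus_conv_smult: "x \<in> carrier A \<Longrightarrow> \<ominus> x = (- 1) \<odot> x"
  by (simp add: smult_minus_l)

lemma smult_diff: "x \<in> carrier A \<Longrightarrow> y \<in> carrier A \<Longrightarrow> c \<odot> (x \<ominus> y) = c \<odot> x \<ominus> c \<odot> y"
  by (simp add: a_minus_def smult_r_distr smult_minus_r)

lemma diff_eq_zero_iff: "x \<in> carrier A \<Longrightarrow> y \<in> carrier A \<Longrightarrow> x \<ominus> y = \<zero> \<longleftrightarrow> x = y"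
  by (metis a_minus_def add.inv_closed add.inv_equality local.add.inv_inv r_neg)

lemma add_diff_self: "x \<in> carrier A \<Longrightarrow> y \<in> carrier A \<Longrightarrow> y \<oplus> (x \<ominus> y) = x"
  using a_lcomm[of y x "\<ominus> y"] by (simp add: a_minus_def r_neg)

lemma diff_eqI: "x = y \<oplus> z \<Longrightarrow> y \<in> carrier A \<Longrightarrow> z \<in> carrier A \<Longrightarrow> x \<ominus> y = z"
  by (simp add: a_minus_def a_comm[of y z] a_assoc r_neg)

lemma diff_eq_iff:
  assumes "x \<in> carrier A" "y \<in> carrier A" "z \<in> carrier A"
  shows "x \<ominus> y = z \<longleftrightarrow> x = z \<oplus> y"
  using add_diff_self[OF assms(1,2)] diff_eqI[of x y z] assms by (auto simp: a_comm)

lemma nilpotent_pow: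
  assumes "x \<in> carrier A" "x \<otimes> x = \<zero>" "n > 1" shows "x [^] (n::nat) = \<zero>"
proof -
  obtain m where "n = Suc (Suc m)" using assms(3) that[of "n - 2"] by simp
  then show ?thesis using assms by (simp add: m_assoc)
qed

lemma smult_pow: "x \<in> carrier A \<Longrightarrow> (c \<odot> x) [^] (n::nat) = c ^ n \<odot> (x [^] n)"
proof (induction n)
  case (Suc n)
  then show ?case by (simp add: smult_mult_l smult_mult_r smult_assoc[symmetric] mult.commute)
qed simp

lemma smult_conv_mult: "x \<in> carrier A \<Longrightarrow> c \<odot> x = (c \<odot> \<one>) \<otimes> x"
  by (simp add: smult_mult_l)

text \<open>A scalar acts as multiplication by a multiple of the unit, so ring ideals are subspaces.
  This is what makes the ring-theoretic \<open>Idl\<close> the right ideal for presentations and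
  tensor products.\<close>

lemma ideal_smult_closed: assumes "ideal I A" "x \<in> I" shows "c \<odot> x \<in> I"
proof -
  interpret ideal I A by fact
  show ?thesis using assms(2) smult_conv_mult[of x c] I_l_closed[of x "c \<odot> \<one>"] a_Hcarr by simp
qed

end

section \<open>Algebra homomorphisms and generated subalgebras\<close>

definition alg_hom :: "('k::field, 'a, 'x) module_scheme \<Rightarrow> ('k, 'b, 'y) module_scheme \<Rightarrow> ('a \<Rightarrow> 'b) set" where
  "alg_hom A B = {f \<in> ring_hom A B. \<forall>c. \<forall>x\<in>carrier A. f (c \<odot>\<^bsub>A\<^esub> x) = c \<odot>\<^bsub>B\<^esub> f x}"

locale kalgebra_hom = A: kalgebra A + B: kalgebra B
  for A :: "('k::field, 'a, 'x) module_scheme" and B :: "('k, 'b, 'y) module_scheme" +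
  fixes f assumes alg_hom: "f \<in> alg_hom A B"

lemma kalgebra_homI: "kalgebra A \<Longrightarrow> kalgebra B \<Longrightarrow> f \<in> alg_hom A B \<Longrightarrow> kalgebra_hom A B f"
  by (simp add: kalgebra_hom_def kalgebra_hom_axioms_def)

sublocale kalgebra_hom \<subseteq> ring_hom_ring A B f
  using alg_hom by (unfold_locales) (auto simp: alg_hom_def)

context kalgebra_hom
begin

lemma hom_smult [simp]: "x \<in> carrier A \<Longrightarrow> f (c \<odot>\<^bsub>A\<^esub> x) = c \<odot>\<^bsub>B\<^esub> f x"
  using alg_hom by (auto simp: alg_hom_def)

lemma hom_pow [simp]: "x \<in> carrier A \<Longrightarrow> f (x [^]\<^bsub>A\<^esub> (n::nat)) = f x [^]\<^bsub>B\<^esub> n"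
  by (induction n) auto

lemma hom_minus [simp]: "x \<in> carrier A \<Longrightarrow> y \<in> carrier A \<Longrightarrow> f (x \<ominus>\<^bsub>A\<^esub> y) = f x \<ominus>\<^bsub>B\<^esub> f y"
  by (simp add: a_minus_def)

end

lemma alg_homI:
  assumes "\<And>x. x \<in> carrier A \<Longrightarrow> f x \<in> carrier B"
    and "\<And>x y. x \<in> carrier A \<Longrightarrow> y \<in> carrier A \<Longrightarrow> f (x \<otimes>\<^bsub>A\<^esub> y) = f x \<otimes>\<^bsub>B\<^esub> f y"
    and "\<And>x y. x \<in> carrier A \<Longrightarrow> y \<in> carrier A \<Longrightarrow> f (x \<oplus>\<^bsub>A\<^esub> y) = f x \<oplus>\<^bsub>B\<^esub> f y"
    and "f \<one>\<^bsub>A\<^esub> = \<one>\<^bsub>B\<^esub>"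
    and "\<And>c x. x \<in> carrier A \<Longrightarrow> f (c \<odot>\<^bsub>A\<^esub> x) = c \<odot>\<^bsub>B\<^esub> f x"
  shows "f \<in> alg_hom A B"
  using assms by (auto simp: alg_hom_def intro!: ring_hom_memI)

lemma alg_hom_comp: "f \<in> alg_hom A B \<Longrightarrow> g \<in> alg_hom B C \<Longrightarrow> (\<lambda>x. g (f x)) \<in> alg_hom A C"
  by (rule alg_homI) (auto simp: alg_hom_def ring_hom_def Pi_iff)

text \<open>Additive inverses arise from the scalar -1, so every rule is one that an algebra
  homomorphism and a coproduct estimate can follow directly.\<close>

inductive_set generated_subalgebra :: "('k::field, 'a, 'x) module_scheme \<Rightarrow> 'a set \<Rightarrow> 'a set"
  for A (structure) and S where
    one: "\<one> \<in> generated_subalgebra A S"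
  | incl: "x \<in> S \<Longrightarrow> x \<in> generated_subalgebra A S"
  | add: "x \<in> generated_subalgebra A S \<Longrightarrow> y \<in> generated_subalgebra A S \<Longrightarrow>
      x \<oplus> y \<in> generated_subalgebra A S"
  | mult: "x \<in> generated_subalgebra A S \<Longrightarrow> y \<in> generated_subalgebra A S \<Longrightarrow>
      x \<otimes> y \<in> generated_subalgebra A S"
  | smult: "x \<in> generated_subalgebra A S \<Longrightarrow> c \<odot> x \<in> generated_subalgebra A S"

context kalgebra
begin

lemma generated_subalgebra_subset:
  assumes "S \<subseteq> carrier A" shows "generated_subalgebra A S \<subseteq> carrier A"
proof
  fix x assume "x \<in> generated_subalgebra A S"
  then show "x \<in> carrier A" using assms by induction auto
qed

lemma subring_generated_subalgebra:
  assumes "S \<subseteq> carrier A" shows "subring (generated_subalgebra A S) A"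
proof (rule subringI)
  show sub: "generated_subalgebra A S \<subseteq> carrier A" by (rule generated_subalgebra_subset[OF assms])
  show "\<ominus> h \<in> generated_subalgebra A S" if "h \<in> generated_subalgebra A S" for h
    using that sub by (subst minus_conv_smult) (auto intro: generated_subalgebra.smult)
qed (auto intro: generated_subalgebra.intros)

end

text \<open>Invariants are tested in the target: a property of matrices that is closed under the
  operations holds on the whole image once it holds for the generators. Triangular shape, common
  eigenvectors, commuting with a fixed matrix and the vanishing of skew derivations are all
  propagated in this way.\<close>

lemma (in kalgebra) generated_subalgebra_hom_induct:
  assumes "kalgebra B" "f \<in> alg_hom A B" "S \<subseteq> carrier A" "x \<in> generated_subalgebra A S"
    and incl: "\<And>s. s \<in> S \<Longrightarrow> Q (f s)"
    and one: "Q \<one>\<^bsub>B\<^esub>"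
    and add: "\<And>x y. Q x \<Longrightarrow> Q y \<Longrightarrow> Q (x \<oplus>\<^bsub>B\<^esub> y)"
    and mult: "\<And>x y. Q x \<Longrightarrow> Q y \<Longrightarrow> Q (x \<otimes>\<^bsub>B\<^esub> y)"
    and smult: "\<And>c x. Q x \<Longrightarrow> Q (c \<odot>\<^bsub>B\<^esub> x)"
  shows "Q (f x)"
proof -
  interpret f: kalgebra_hom A B f using assms(1,2) by (intro kalgebra_homI kalgebra_axioms)
  have sub: "generated_subalgebra A S \<subseteq> carrier A" by (rule generated_subalgebra_subset[OF assms(3)])
  show ?thesis using assms(4)
  proof induction
    case (add x y)
    then have "x \<in> carrier A" "y \<in> carrier A" using sub by blast+
    then show ?case using add assms(7) by simp
  next
    case (mult x y)
    then have "x \<in> carrier A" "y \<in> carrier A" using sub by blast+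
    then show ?case using mult assms(8) by simp
  next
    case (smult x c)
    then have "x \<in> carrier A" using sub by blast
    then show ?case using smult assms(9) by simp
  qed (simp_all add: incl one)
qed

lemma alg_hom_eq_on_generated:
  assumes "kalgebra A" "kalgebra B" "f \<in> alg_hom A B" "g \<in> alg_hom A B" "S \<subseteq> carrier A"
    and "\<And>x. x \<in> S \<Longrightarrow> f x = g x" and "x \<in> generated_subalgebra A S"
  shows "f x = g x"
proof -
  interpret f: kalgebra_hom A B f using assms by (intro kalgebra_homI)
  interpret g: kalgebra_hom A B g using assms by (intro kalgebra_homI)
  have sub: "generated_subalgebra A S \<subseteq> carrier A"
    using assms(5) by (rule f.A.generated_subalgebra_subset)
  show ?thesis using assms(7)
  proof induction
    case (add x y)
    then have "x \<in> carrier A" "y \<in> carrier A" using sub by blast+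
    then show ?case using add by simp
  next
    case (mult x y)
    then have "x \<in> carrier A" "y \<in> carrier A" using sub by blast+
    then show ?case using mult by simp
  next
    case (smult x c)
    then have "x \<in> carrier A" using sub by blast
    then show ?case using smult by simp
  qed (simp_all add: assms(6))
qed

section \<open>Monoid algebras\<close>

lemma monoid_algebra_simps [simp]:
  "f \<in> carrier (monoid_algebra M) \<longleftrightarrow> finite {m. f m \<noteq> 0} \<and> {m. f m \<noteq> 0} \<subseteq> carrier M"
  "\<one>\<^bsub>monoid_algebra M\<^esub> = basis_element \<one>\<^bsub>M\<^esub>"
  "\<zero>\<^bsub>monoid_algebra M\<^esub> = (\<lambda>m. 0)"
  "f \<oplus>\<^bsub>monoid_algebra M\<^esub> g = (\<lambda>m. f m + g m)"
  "c \<odot>\<^bsub>monoid_algebra M\<^esub> f = (\<lambda>m. c * f m)"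
  by (auto simp: monoid_algebra_def basis_element_def fun_eq_iff)

text \<open>Replacing the exact supports by arbitrary finite supersets lets products with different
  supports be compared over a common index set.\<close>

lemma monoid_algebra_mult:
  assumes "finite S" "finite S'" "{m. f m \<noteq> 0} \<subseteq> S" "{m. g m \<noteq> 0} \<subseteq> S'"
  shows "(f \<otimes>\<^bsub>monoid_algebra M\<^esub> g) m =
    (\<Sum>x\<in>S. \<Sum>y\<in>S'. if x \<otimes>\<^bsub>M\<^esub> y = m then f x * g y else (0::'k::field))"
proof -
  have "(f \<otimes>\<^bsub>monoid_algebra M\<^esub> g) m =
      (\<Sum>(x, y) \<in> {(x, y). f x \<noteq> 0 \<and> g y \<noteq> 0 \<and> x \<otimes>\<^bsub>M\<^esub> y = m}. f x * g y)"
    by (simp add: monoid_algebra_def)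
  also have "\<dots> = (\<Sum>(x, y) \<in> S \<times> S'. if x \<otimes>\<^bsub>M\<^esub> y = m then f x * g y else 0)"
    using assms by (intro sum.mono_neutral_cong_left) (auto split: if_splits)
  finally show ?thesis by (simp add: sum.cartesian_product)
qed

lemma finite_support_add:
  "finite {m. f m \<noteq> 0} \<Longrightarrow> finite {m. g m \<noteq> 0} \<Longrightarrow> finite {m. f m + g m \<noteq> (0::'k::field)}"
  by (rule finite_subset[of _ "{m. f m \<noteq> 0} \<union> {m. g m \<noteq> 0}"]) auto

lemma finite_support_smult:
  "finite {m. f m \<noteq> 0} \<Longrightarrow> finite {m. c * f m \<noteq> (0::'k::field)}"
  by (rule finite_subset[of _ "{m. f m \<noteq> 0}"]) auto

lemma basis_element_support [simp]: "{m'. basis_element m m' \<noteq> (0::'k::field)} = {m}"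
  by (auto simp: basis_element_def)

lemma monoid_algebra_mult_basis:
  "basis_element x \<otimes>\<^bsub>monoid_algebra M\<^esub> basis_element y = (basis_element (x \<otimes>\<^bsub>M\<^esub> y) :: _ \<Rightarrow> 'k::field)"
proof
  fix m
  show "(basis_element x \<otimes>\<^bsub>monoid_algebra M\<^esub> basis_element y) m = (basis_element (x \<otimes>\<^bsub>M\<^esub> y) :: _ \<Rightarrow> 'k) m"
    by (subst monoid_algebra_mult[of "{x}" "{y}"]) (auto simp: basis_element_def)
qed

lemma monoid_algebra_add_closed:
  assumes "f \<in> carrier (monoid_algebra M)" "g \<in> carrier (monoid_algebra M)"
  shows "(\<lambda>m. f m + g m) \<in> carrier (monoid_algebra M :: ('k::field, 'm \<Rightarrow> 'k) module)"
proof -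
  have "{m. f m + g m \<noteq> 0} \<subseteq> {m. f m \<noteq> 0} \<union> {m. g m \<noteq> 0}" by auto
  then show ?thesis using assms by (auto intro: finite_support_add)
qed

lemma monoid_algebra_smult_closed:
  assumes "f \<in> carrier (monoid_algebra M)"
  shows "(\<lambda>m. c * f m) \<in> carrier (monoid_algebra M :: ('k::field, 'm \<Rightarrow> 'k) module)"
  using assms by (auto intro: finite_support_smult)

lemma monoid_algebra_induct [consumes 1, case_names zero add]:
  fixes f :: "'m \<Rightarrow> 'k::field"
  assumes "f \<in> carrier (monoid_algebra M)"
    and "P (\<lambda>m. 0)"
    and "\<And>f m c. f \<in> carrier (monoid_algebra M) \<Longrightarrow> m \<in> carrier M \<Longrightarrow> P f \<Longrightarrow>
      P (\<lambda>m'. f m' + c * basis_element m m')"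
  shows "P f"
proof -
  have "finite S \<Longrightarrow> S \<subseteq> carrier M \<Longrightarrow> {m. f m \<noteq> 0} \<subseteq> S \<Longrightarrow> P f" for S f
  proof (induction S arbitrary: f rule: finite_induct)
    case empty
    then have "f = (\<lambda>m. 0)" by auto
    then show ?case using assms(2) by simp
  next
    case (insert m S)
    let ?g = "f(m := 0)"
    have fin: "finite {m'. ?g m' \<noteq> 0}"
      by (rule finite_subset[of _ "insert m S"]) (use insert in auto)
    have "P ?g" using insert by (intro insert.IH) auto
    then have "P (\<lambda>m'. ?g m' + f m * basis_element m m')"
      using insert.prems fin \<open>P ?g\<close> by (intro assms(3)) (simp_all only: monoid_algebra_simps, auto)
    also have "(\<lambda>m'. ?g m' + f m * basis_element m m') = f"
      by (auto simp: basis_element_def fun_eq_iff)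
    finally show ?case .
  qed
  then show ?thesis using assms(1) by auto
qed

context Group.monoid
begin

lemma monoid_algebra_mult_closed:
  assumes "f \<in> carrier (monoid_algebra G)" "g \<in> carrier (monoid_algebra G)"
  shows "f \<otimes>\<^bsub>monoid_algebra G\<^esub> g \<in> carrier (monoid_algebra G :: ('k::field, 'a \<Rightarrow> 'k) module)"
proof -
  let ?S = "{m. f m \<noteq> 0}" and ?S' = "{m. g m \<noteq> 0}"
  have eq: "(f \<otimes>\<^bsub>monoid_algebra G\<^esub> g) m =
      (\<Sum>x\<in>?S. \<Sum>y\<in>?S'. if x \<otimes> y = m then f x * g y else 0)" for m
    using assms by (intro monoid_algebra_mult) auto
  have "{m. (f \<otimes>\<^bsub>monoid_algebra G\<^esub> g) m \<noteq> 0} \<subseteq> (\<lambda>(x, y). x \<otimes> y) ` (?S \<times> ?S')"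
  proof
    fix m assume "m \<in> {m. (f \<otimes>\<^bsub>monoid_algebra G\<^esub> g) m \<noteq> 0}"
    then have "(\<Sum>x\<in>?S. \<Sum>y\<in>?S'. if x \<otimes> y = m then f x * g y else 0) \<noteq> 0" using eq by simp
    then obtain x where "x \<in> ?S" "(\<Sum>y\<in>?S'. if x \<otimes> y = m then f x * g y else 0) \<noteq> 0"
      by (rule sum.not_neutral_contains_not_neutral)
    moreover from this(2) obtain y where "y \<in> ?S'" "(if x \<otimes> y = m then f x * g y else 0) \<noteq> 0"
      by (rule sum.not_neutral_contains_not_neutral)
    ultimately    show "m \<in> (\<lambda>(x, y). x \<otimes> y) ` (?S \<times> ?S')" by (auto split: if_splits)
  qed
  moreover have "(\<lambda>(x, y). x \<otimes> y) ` (?S \<times> ?S') \<subseteq> carrier G" using assms by auto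
  moreover have "finite ((\<lambda>(x, y). x \<otimes> y) ` (?S \<times> ?S'))" using assms by auto
  ultimately show ?thesis by (auto intro: finite_subset)
qed

text \<open>The scalar \<open>c\<close> makes this one statement serve for additivity
  (\<open>c = 1\<close>), for homogeneity (\<open>f = 0\<close>) and for the step of
  \<open>monoid_algebra_induct\<close>.\<close>

lemma monoid_algebra_l_distr:
  fixes f g h :: "'a \<Rightarrow> 'k::field"
  assumes "f \<in> carrier (monoid_algebra G)" "g \<in> carrier (monoid_algebra G)" "h \<in> carrier (monoid_algebra G)"
  shows "(\<lambda>m. f m + c * g m) \<otimes>\<^bsub>monoid_algebra G\<^esub> h =
    (\<lambda>m. (f \<otimes>\<^bsub>monoid_algebra G\<^esub> h) m + c * (g \<otimes>\<^bsub>monoid_algebra G\<^esub> h) m)"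
proof
  fix m
  let ?S = "{m. f m \<noteq> 0} \<union> {m. g m \<noteq> 0}" and ?S' = "{m. h m \<noteq> 0}"
  have "(k \<otimes>\<^bsub>monoid_algebra G\<^esub> h) m = (\<Sum>x\<in>?S. \<Sum>y\<in>?S'. if x \<otimes> y = m then k x * h y else 0)"
    if "{m. k m \<noteq> 0} \<subseteq> ?S" for k
    using assms that by (intro monoid_algebra_mult) auto
  note * = this[of f] this[of g] this[of "\<lambda>m. f m + c * g m"]
  show "((\<lambda>m. f m + c * g m) \<otimes>\<^bsub>monoid_algebra G\<^esub> h) m =
    (f \<otimes>\<^bsub>monoid_algebra G\<^esub> h) m + c * (g \<otimes>\<^bsub>monoid_algebra G\<^esub> h) m"
    by (subst *, fastforce)+
       (auto simp: sum_distrib_left sum.distrib[symmetric] algebra_simps intro!: sum.cong)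
qed

lemma monoid_algebra_r_distr:
  fixes f g h :: "'a \<Rightarrow> 'k::field"
  assumes "f \<in> carrier (monoid_algebra G)" "g \<in> carrier (monoid_algebra G)" "h \<in> carrier (monoid_algebra G)"
  shows "h \<otimes>\<^bsub>monoid_algebra G\<^esub> (\<lambda>m. f m + c * g m) =
    (\<lambda>m. (h \<otimes>\<^bsub>monoid_algebra G\<^esub> f) m + c * (h \<otimes>\<^bsub>monoid_algebra G\<^esub> g) m)"
proof
  fix m
  let ?S = "{m. f m \<noteq> 0} \<union> {m. g m \<noteq> 0}" and ?S' = "{m. h m \<noteq> 0}"
  have "(h \<otimes>\<^bsub>monoid_algebra G\<^esub> k) m = (\<Sum>x\<in>?S'. \<Sum>y\<in>?S. if x \<otimes> y = m then h x * k y else 0)"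
    if "{m. k m \<noteq> 0} \<subseteq> ?S" for k
    using assms that by (intro monoid_algebra_mult) auto
  note * = this[of f] this[of g] this[of "\<lambda>m. f m + c * g m"]
  show "(h \<otimes>\<^bsub>monoid_algebra G\<^esub> (\<lambda>m. f m + c * g m)) m =
    (h \<otimes>\<^bsub>monoid_algebra G\<^esub> f) m + c * (h \<otimes>\<^bsub>monoid_algebra G\<^esub> g) m"
    by (subst *, fastforce)+
       (auto simp: sum_distrib_left sum.distrib[symmetric] algebra_simps intro!: sum.cong)
qed

lemma monoid_algebra_null [simp]:
  "(\<lambda>m. 0) \<otimes>\<^bsub>monoid_algebra G\<^esub> f = (\<lambda>m. 0 :: 'k::field)"
  "f \<otimes>\<^bsub>monoid_algebra G\<^esub> (\<lambda>m. 0) = (\<lambda>m. 0 :: 'k::field)"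
  by (auto simp: monoid_algebra_def)

lemma basis_element_closed: "m \<in> carrier G \<Longrightarrow> basis_element m \<in> carrier (monoid_algebra G)"
  by simp

text \<open>By trilinearity it is enough to treat basis elements, where the claim is associativity
  in the monoid; the factors are decomposed one at a time, beginning with the last.\<close>

lemma monoid_algebra_assoc:
  fixes f g h :: "'a \<Rightarrow> 'k::field"
  assumes "f \<in> carrier (monoid_algebra G)" "g \<in> carrier (monoid_algebra G)" "h \<in> carrier (monoid_algebra G)"
  shows "f \<otimes>\<^bsub>monoid_algebra G\<^esub> g \<otimes>\<^bsub>monoid_algebra G\<^esub> h = f \<otimes>\<^bsub>monoid_algebra G\<^esub> (g \<otimes>\<^bsub>monoid_algebra G\<^esub> h)"
proof -
  note [simp del] = monoid_algebra_simps(1)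
  note closed = monoid_algebra_mult_closed basis_element_closed
  have 1: "basis_element x \<otimes>\<^bsub>monoid_algebra G\<^esub> basis_element y \<otimes>\<^bsub>monoid_algebra G\<^esub> h =
      basis_element x \<otimes>\<^bsub>monoid_algebra G\<^esub> (basis_element y \<otimes>\<^bsub>monoid_algebra G\<^esub> h)"
    if "x \<in> carrier G" "y \<in> carrier G" for x y
    using assms(3)
    by (induction rule: monoid_algebra_induct)
       (use that in \<open>simp_all add: monoid_algebra_r_distr closed monoid_algebra_mult_basis m_assoc\<close>)
  have 2: "basis_element x \<otimes>\<^bsub>monoid_algebra G\<^esub> g \<otimes>\<^bsub>monoid_algebra G\<^esub> h =
      basis_element x \<otimes>\<^bsub>monoid_algebra G\<^esub> (g \<otimes>\<^bsub>monoid_algebra G\<^esub> h)"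
    if "x \<in> carrier G" for x
    using assms(2)
    by (induction rule: monoid_algebra_induct)
       (use that assms(3) in \<open>simp_all add: monoid_algebra_r_distr monoid_algebra_l_distr closed 1\<close>)
  show ?thesis
    using assms(1)
    by (induction rule: monoid_algebra_induct)
       (use assms(2,3) in \<open>simp_all add: monoid_algebra_l_distr closed 2\<close>)
qed

lemma monoid_algebra_one:
  fixes f :: "'a \<Rightarrow> 'k::field"
  assumes "f \<in> carrier (monoid_algebra G)"
  shows "basis_element \<one> \<otimes>\<^bsub>monoid_algebra G\<^esub> f = f" "f \<otimes>\<^bsub>monoid_algebra G\<^esub> basis_element \<one> = f"
  using assms
  by (induction rule: monoid_algebra_induct)
     (simp_all del: monoid_algebra_simps(1)
        add: monoid_algebra_l_distr monoid_algebra_r_distr basis_element_closed monoid_algebra_mult_basis)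

lemma kalgebra_monoid_algebra: "kalgebra (monoid_algebra G :: ('k::field, 'a \<Rightarrow> 'k) module)"
proof -
  let ?F = "monoid_algebra G :: ('k, 'a \<Rightarrow> 'k) module"
  note [simp del] = monoid_algebra_simps(1)
  note closed = monoid_algebra_mult_closed basis_element_closed monoid_algebra_add_closed
    monoid_algebra_smult_closed
  note l = monoid_algebra_l_distr[where c = 1, simplified] monoid_algebra_r_distr[where c = 1, simplified]
  have zero: "(\<lambda>m. 0) \<in> carrier ?F" by (simp add: monoid_algebra_simps(1))
  have sl: "(\<lambda>m. c * f m) \<otimes>\<^bsub>?F\<^esub> g = (\<lambda>m. c * (f \<otimes>\<^bsub>?F\<^esub> g) m)"
    and sr: "f \<otimes>\<^bsub>?F\<^esub> (\<lambda>m. c * g m) = (\<lambda>m. c * (f \<otimes>\<^bsub>?F\<^esub> g) m)"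
    if "f \<in> carrier ?F" "g \<in> carrier ?F" for c f g
    using monoid_algebra_l_distr[OF zero that, of c] monoid_algebra_r_distr[OF zero that(2,1), of c] by simp_all
  have "abelian_group ?F"
  proof (rule abelian_groupI)
    fix x assume "x \<in> carrier ?F"
    then show "\<exists>y\<in>carrier ?F. y \<oplus>\<^bsub>?F\<^esub> x = \<zero>\<^bsub>?F\<^esub>"
      using monoid_algebra_smult_closed[of x G "- 1"] by (intro bexI[of _ "\<lambda>m. - x m"]) auto
  qed (simp_all add: closed zero add_ac)
  moreover have "Group.monoid ?F"
    by (rule monoidI) (simp_all add: closed monoid_algebra_assoc monoid_algebra_one)
  ultimately have "ring ?F" by (rule ringI) (simp_all add: l)
  then interpret ring ?F .
  show ?thesis
    by unfold_locales (simp_all add: closed distrib_left distrib_right mult.assoc sl sr)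
qed

end

section \<open>Linear extension of maps on a monoid\<close>

context kalgebra
begin

lemma smult_finsum:
  assumes "finite S" "\<phi> \<in> S \<rightarrow> carrier A"
  shows "c \<odot> (\<Oplus>m\<in>S. \<phi> m) = (\<Oplus>m\<in>S. c \<odot> \<phi> m)"
  using assms by (induction rule: finite_induct) (auto simp: Pi_iff finsum_insert smult_r_distr finsum_closed)

lemma linear_extension_eq:
  assumes "finite S" "{m. f m \<noteq> 0} \<subseteq> S" "\<And>m. m \<in> S \<Longrightarrow> \<phi> m \<in> carrier A"
  shows "linear_extension A \<phi> f = (\<Oplus>m\<in>S. f m \<odot> \<phi> m)"
  unfolding linear_extension_def
  using assms by (intro add.finprod_mono_neutral_cong_left) auto

lemma linear_extension_add:
  assumes f: "f \<in> carrier (monoid_algebra M)" and g: "g \<in> carrier (monoid_algebra M)"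
    and \<phi>: "\<And>m. m \<in> carrier M \<Longrightarrow> \<phi> m \<in> carrier A"
  shows "linear_extension A \<phi> (\<lambda>m. f m + c * g m) = linear_extension A \<phi> f \<oplus> c \<odot> linear_extension A \<phi> g"
proof -
  let ?S = "{m. f m \<noteq> 0} \<union> {m. g m \<noteq> 0}"
  have fin: "finite ?S" and sub: "?S \<subseteq> carrier M" using f g by auto
  then have cl: "\<phi> m \<in> carrier A" if "m \<in> ?S" for m using that \<phi> by blast
  have eq: "linear_extension A \<phi> h = (\<Oplus>m\<in>?S. h m \<odot> \<phi> m)" if "{m. h m \<noteq> 0} \<subseteq> ?S" for h
    using that cl fin by (intro linear_extension_eq) auto
  have "linear_extension A \<phi> (\<lambda>m. f m + c * g m) = (\<Oplus>m\<in>?S. (f m + c * g m) \<odot> \<phi> m)"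
    by (rule eq) auto
  also have "\<dots> = (\<Oplus>m\<in>?S. f m \<odot> \<phi> m \<oplus> c \<odot> (g m \<odot> \<phi> m))"
    using cl by (intro add.finprod_cong') (auto simp: smult_l_distr smult_assoc)
  also have "\<dots> = (\<Oplus>m\<in>?S. f m \<odot> \<phi> m) \<oplus> (\<Oplus>m\<in>?S. c \<odot> (g m \<odot> \<phi> m))"
    using cl by (intro finsum_addf) auto
  also have "(\<Oplus>m\<in>?S. c \<odot> (g m \<odot> \<phi> m)) = c \<odot> (\<Oplus>m\<in>?S. g m \<odot> \<phi> m)"
    using cl fin by (intro smult_finsum[symmetric]) auto
  finally show ?thesis by (subst (1 2) eq) auto
qed

lemma linear_extension_closed:
  assumes "f \<in> carrier (monoid_algebra M)" "\<And>m. m \<in> carrier M \<Longrightarrow> \<phi> m \<in> carrier A"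
  shows "linear_extension A \<phi> f \<in> carrier A"
  unfolding linear_extension_def using assms by (intro finsum_closed) auto

lemma linear_extension_zero [simp]: "linear_extension A \<phi> (\<lambda>m. 0) = \<zero>"
  by (simp add: linear_extension_def)

lemma linear_extension_basis [simp]:
  assumes "\<phi> m \<in> carrier A"
  shows "linear_extension A \<phi> (basis_element m) = \<phi> m"
  using assms by (subst linear_extension_eq[of "{m}"]) (auto simp: basis_element_def)

lemma linear_extension_alg_hom:
  assumes M: "Group.monoid M" and cl: "\<And>m. m \<in> carrier M \<Longrightarrow> \<phi> m \<in> carrier A"
    and one: "\<phi> \<one>\<^bsub>M\<^esub> = \<one>"
    and mult: "\<And>x y. x \<in> carrier M \<Longrightarrow> y \<in> carrier M \<Longrightarrow> \<phi> (x \<otimes>\<^bsub>M\<^esub> y) = \<phi> x \<otimes> \<phi> y"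
  shows "linear_extension A \<phi> \<in> alg_hom (monoid_algebra M) A"
proof -
  interpret M: Group.monoid M by fact
  let ?F = "monoid_algebra M :: ('k, _ \<Rightarrow> 'k) module" and ?L = "linear_extension A \<phi>"
  note [simp del] = monoid_algebra_simps(1)
  note closed = M.monoid_algebra_mult_closed M.basis_element_closed linear_extension_closed cl
  have zero: "(\<lambda>m. 0) \<in> carrier ?F" by (simp add: monoid_algebra_simps(1))
  have 1: "?L (basis_element x \<otimes>\<^bsub>?F\<^esub> g) = \<phi> x \<otimes> ?L g" if "x \<in> carrier M" "g \<in> carrier ?F" for x g
    using that(2)
  proof (induction rule: monoid_algebra_induct)
    case (add f m c)
    have "?L (basis_element x \<otimes>\<^bsub>?F\<^esub> (\<lambda>m'. f m' + c * basis_element m m')) =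
        ?L (\<lambda>m'. (basis_element x \<otimes>\<^bsub>?F\<^esub> f) m' + c * basis_element (x \<otimes>\<^bsub>M\<^esub> m) m')"
      using that(1) add by (subst M.monoid_algebra_r_distr) (auto simp: closed monoid_algebra_mult_basis)
    also have "\<dots> = \<phi> x \<otimes> ?L f \<oplus> c \<odot> (\<phi> x \<otimes> \<phi> m)"
      using that(1) add by (subst linear_extension_add[where M = M])
         (auto simp: closed mult)
    also have "\<dots> = \<phi> x \<otimes> ?L (\<lambda>m'. f m' + c * basis_element m m')"
      using that(1) add by (subst linear_extension_add[where M = M])
         (auto simp: closed r_distr smult_mult_r)
    finally show ?case .
  qed (use that cl in auto)
  have 2: "?L (f \<otimes>\<^bsub>?F\<^esub> g) = ?L f \<otimes> ?L g" if "f \<in> carrier ?F" "g \<in> carrier ?F" for f g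
    using that(1)
  proof (induction rule: monoid_algebra_induct)
    case (add f m c)
    have "?L ((\<lambda>m'. f m' + c * basis_element m m') \<otimes>\<^bsub>?F\<^esub> g) =
        ?L (\<lambda>m'. (f \<otimes>\<^bsub>?F\<^esub> g) m' + c * (basis_element m \<otimes>\<^bsub>?F\<^esub> g) m')"
      using that(2) add by (subst M.monoid_algebra_l_distr) (auto simp: closed)
    also have "\<dots> = ?L f \<otimes> ?L g \<oplus> c \<odot> (\<phi> m \<otimes> ?L g)"
      using that(2) add by (subst linear_extension_add[where M = M]) (auto simp: closed 1)
    also have "\<dots> = ?L (\<lambda>m'. f m' + c * basis_element m m') \<otimes> ?L g"
      using that(2) add by (subst linear_extension_add[where M = M])
         (auto simp: closed l_distr smult_mult_l)
    finally show ?case .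
  qed (use that linear_extension_closed[of g M \<phi>] cl in auto)
  show ?thesis
  proof (rule alg_homI)
    fix f g assume "f \<in> carrier ?F" "g \<in> carrier ?F"
    then show "?L (f \<oplus>\<^bsub>?F\<^esub> g) = ?L f \<oplus> ?L g"
      using linear_extension_add[of f M g \<phi> 1] cl by (simp add: closed)
  next
    fix f c assume "f \<in> carrier ?F"
    then show "?L (c \<odot>\<^bsub>?F\<^esub> f) = c \<odot> ?L f"
      using linear_extension_add[OF zero, of f \<phi> c] cl by (simp add: closed)
  qed (auto simp: 2 closed cl one)
qed

end

section \<open>Quotients\<close>

text \<open>Transport of the axioms along a surjection; \<open>Q\<close> need not be known to be a ring.\<close>

lemma (in kalgebra) kalgebra_image:
  fixes Q :: "('k, 'b, 'y) module_scheme"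
  assumes carrier: "carrier Q = f ` carrier A"
    and mult: "\<And>x y. x \<in> carrier A \<Longrightarrow> y \<in> carrier A \<Longrightarrow> f x \<otimes>\<^bsub>Q\<^esub> f y = f (x \<otimes> y)"
    and add: "\<And>x y. x \<in> carrier A \<Longrightarrow> y \<in> carrier A \<Longrightarrow> f x \<oplus>\<^bsub>Q\<^esub> f y = f (x \<oplus> y)"
    and one: "\<one>\<^bsub>Q\<^esub> = f \<one>" and zero: "\<zero>\<^bsub>Q\<^esub> = f \<zero>"
    and smult: "\<And>c x. x \<in> carrier A \<Longrightarrow> c \<odot>\<^bsub>Q\<^esub> f x = f (c \<odot> x)"
  shows "kalgebra Q"
proof -
  have "abelian_group Q"
  proof (rule abelian_groupI)
    fix x assume "x \<in> carrier Q"
    then obtain y where "y \<in> carrier A" "x = f y" using carrier by auto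
    then show "\<exists>y\<in>carrier Q. y \<oplus>\<^bsub>Q\<^esub> x = \<zero>\<^bsub>Q\<^esub>"
      using add[of "\<ominus> y" y] by (intro bexI[of _ "f (\<ominus> y)"]) (auto simp: carrier zero l_neg)
  qed (auto simp: carrier add zero a_ac)
  moreover have "Group.monoid Q"
    by (rule monoidI) (auto simp: carrier mult one m_assoc)
  ultimately have "ring Q"
    by (rule ringI) (auto simp: carrier add mult l_distr r_distr)
  then interpret Q: ring Q .
  show ?thesis
    by unfold_locales
       (auto simp: carrier add mult smult smult_l_distr smult_r_distr smult_mult_l smult_mult_r smult_assoc)
qed

lemma quotient_algebra_simps:
  "carrier (quotient_algebra A I) = a_rcosets\<^bsub>A\<^esub> I"
  "X \<otimes>\<^bsub>quotient_algebra A I\<^esub> Y = rcoset_mult A I X Y"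
  "X \<oplus>\<^bsub>quotient_algebra A I\<^esub> Y = X <+>\<^bsub>A\<^esub> Y"
  "\<one>\<^bsub>quotient_algebra A I\<^esub> = I +>\<^bsub>A\<^esub> \<one>\<^bsub>A\<^esub>"
  "\<zero>\<^bsub>quotient_algebra A I\<^esub> = I"
  "c \<odot>\<^bsub>quotient_algebra A I\<^esub> X = (\<Union>x\<in>X. I +>\<^bsub>A\<^esub> (c \<odot>\<^bsub>A\<^esub> x))"
  by (simp_all add: quotient_algebra_def ring.extend_def module.fields_def FactRing_def)

locale kalgebra_ideal = kalgebra A + ideal I A for A (structure) and I
begin

abbreviation Q where "Q \<equiv> quotient_algebra A I"

lemma coset_eq: "x \<in> I +> y \<Longrightarrow> y \<in> carrier A \<Longrightarrow> I +> x = I +> y"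
  using a_repr_independence' by blast

text \<open>All members of the union in the definition coincide: changing the representative changes
  \<open>c \<odot> x\<close> by an element of the ideal, because ideals absorb scalars.\<close>

lemma quotient_smult:
  assumes "x \<in> carrier A" shows "c \<odot>\<^bsub>Q\<^esub> (I +> x) = I +> (c \<odot> x)"
proof -
  have "I +> (c \<odot> y) = I +> (c \<odot> x)" if "y \<in> I +> x" for y
  proof (rule coset_eq)
    from that obtain i where i: "i \<in> I" "y = i \<oplus> x" by (auto simp: a_r_coset_def')
    then have "c \<odot> y = c \<odot> i \<oplus> c \<odot> x" using assms a_Hcarr by (simp add: smult_r_distr)
    moreover have "c \<odot> i \<in> I" using i ideal_smult_closed ideal_axioms by blast
    ultimately show "c \<odot> y \<in> I +> (c \<odot> x)" by (auto simp: a_r_coset_def')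
  qed (use assms in simp)
  moreover have "x \<in> I +> x" using assms by (rule a_rcos_self)
  ultimately show ?thesis unfolding quotient_algebra_simps(6) by blast
qed

lemma quotient_carrier: "carrier Q = (\<lambda>x. I +> x) ` carrier A"
  by (auto simp: quotient_algebra_simps A_RCOSETS_def')

lemma kalgebra_quotient: "kalgebra Q"
  by (rule kalgebra_image[where f = "\<lambda>x. I +> x"])
     (auto simp: quotient_carrier quotient_smult quotient_algebra_simps(2-5) rcoset_mult_add a_rcos_sum a_rcos_const)

lemma coset_alg_hom: "(\<lambda>x. I +> x) \<in> alg_hom A Q"
  by (rule alg_homI)
     (auto simp: quotient_carrier quotient_smult quotient_algebra_simps(2-5) rcoset_mult_add a_rcos_sum)

lemma coset_eq_zero: "x \<in> I \<Longrightarrow> I +> x = \<zero>\<^bsub>Q\<^esub>"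
  by (simp add: quotient_algebra_simps a_rcos_const)

lemma quotient_lift_coset:
  assumes B: "kalgebra B" and f: "f \<in> alg_hom A B" and I: "f ` I \<subseteq> {\<zero>\<^bsub>B\<^esub>}" and x: "x \<in> carrier A"
  shows "quotient_lift f (I +> x) = f x"
proof -
  interpret f: kalgebra_hom A B f
    by (rule kalgebra_homI[OF kalgebra_axioms B f])
  have "f y = f x" if "y \<in> I +> x" for y
    using that x I a_Hcarr by (auto simp: a_r_coset_def' image_subset_iff)
  moreover have "x \<in> I +> x" using x by (rule a_rcos_self)
  ultimately have "f ` (I +> x) = {f x}" by (intro equalityI subsetI) (blast, metis imageI singletonD)
  then show ?thesis by (simp add: quotient_lift_def)
qed

lemma quotient_lift_alg_hom:
  assumes B: "kalgebra B" and f: "f \<in> alg_hom A B" and I: "f ` I \<subseteq> {\<zero>\<^bsub>B\<^esub>}"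
  shows "quotient_lift f \<in> alg_hom Q B"
proof -
  interpret f: kalgebra_hom A B f
    by (rule kalgebra_homI[OF kalgebra_axioms B f])
  note lift = quotient_lift_coset[OF B f I]
  interpret \<pi>: kalgebra_hom A Q "\<lambda>x. I +> x"
    by (rule kalgebra_homI[OF kalgebra_axioms kalgebra_quotient coset_alg_hom])
  show ?thesis
  proof (rule alg_homI)
    fix X Y assume "X \<in> carrier Q" "Y \<in> carrier Q"
    then obtain x y where "x \<in> carrier A" "y \<in> carrier A" "X = I +> x" "Y = I +> y"
      by (auto simp: quotient_carrier)
    then show "quotient_lift f (X \<otimes>\<^bsub>Q\<^esub> Y) = quotient_lift f X \<otimes>\<^bsub>B\<^esub> quotient_lift f Y"
      "quotient_lift f (X \<oplus>\<^bsub>Q\<^esub> Y) = quotient_lift f X \<oplus>\<^bsub>B\<^esub> quotient_lift f Y"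
      by (simp_all add: lift flip: \<pi>.hom_mult \<pi>.hom_add)
  next
    show "quotient_lift f \<one>\<^bsub>Q\<^esub> = \<one>\<^bsub>B\<^esub>" by (simp add: lift flip: \<pi>.hom_one)
  next
    fix X c assume "X \<in> carrier Q"
    then obtain x where "x \<in> carrier A" "X = I +> x"
      by (auto simp: quotient_carrier)
    then show "quotient_lift f X \<in> carrier B" "quotient_lift f (c \<odot>\<^bsub>Q\<^esub> X) = c \<odot>\<^bsub>B\<^esub> quotient_lift f X"
      by (simp_all add: lift flip: \<pi>.hom_smult)
  qed
qed

end

section \<open>Presented algebras\<close>

text \<open>The kernel is an ideal, so it contains the ideal generated by \<open>R\<close> as soon
  as it contains \<open>R\<close>. Maps out of presentations and out of tensor products are both
  obtained from this.\<close>

lemma kalgebra_ideal_kernel: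
  assumes "kalgebra A" "kalgebra B" "f \<in> alg_hom A B" "R \<subseteq> carrier A" "f ` R \<subseteq> {\<zero>\<^bsub>B\<^esub>}"
  shows "f ` (Idl\<^bsub>A\<^esub> R) \<subseteq> {\<zero>\<^bsub>B\<^esub>}"
proof -
  interpret f: kalgebra_hom A B f
    by (rule kalgebra_homI[OF assms(1-3)])
  have "R \<subseteq> a_kernel A B f" using assms(4,5) unfolding a_kernel_def' by blast
  then have "Idl\<^bsub>A\<^esub> R \<subseteq> a_kernel A B f" by (intro f.A.genideal_minimal f.kernel_is_ideal)
  then show ?thesis unfolding a_kernel_def' by blast
qed

lemma free_monoid_simps [simp]:
  "carrier free_monoid = UNIV" "v \<otimes>\<^bsub>free_monoid\<^esub> w = v @ w" "\<one>\<^bsub>free_monoid\<^esub> = []"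
  by (simp_all add: free_monoid_def)

lemma monoid_free_monoid: "Group.monoid free_monoid"
  by (rule monoidI) auto

lemma kalgebra_free_algebra: "kalgebra free_algebra"
  using monoid_free_monoid by (rule monoid.kalgebra_monoid_algebra)

lemma free_generator_closed [simp]: "free_generator g \<in> carrier free_algebra"
  by simp

lemma (in kalgebra) free_extension_alg_hom:
  assumes "\<And>g. \<gamma> g \<in> carrier A"
  shows "free_extension A \<gamma> \<in> alg_hom free_algebra A"
proof -
  define \<phi> where "\<phi> w = foldr (\<lambda>g x. \<gamma> g \<otimes> x) w \<one>" for w
  have cl: "\<phi> w \<in> carrier A" for w by (induction w) (auto simp: \<phi>_def assms)
  have "\<phi> (v @ w) = \<phi> v \<otimes> \<phi> w" for v w
    using cl by (induction v) (auto simp: \<phi>_def assms m_assoc)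
  then have "linear_extension A \<phi> \<in> alg_hom free_algebra A"
    by (intro linear_extension_alg_hom monoid_free_monoid) (auto simp: cl, simp add: \<phi>_def)
  then show ?thesis by (simp add: free_extension_def \<phi>_def[abs_def])
qed

lemma (in kalgebra) free_extension_generator:
  assumes "\<And>g. \<gamma> g \<in> carrier A"
  shows "free_extension A \<gamma> (free_generator g) = \<gamma> g"
  using assms by (simp add: free_extension_def)

lemma free_algebra_generated:
  "carrier (free_algebra :: ('k::field, 'g list \<Rightarrow> 'k) module) \<subseteq>
    generated_subalgebra free_algebra (range free_generator)"
proof
  let ?F = "free_algebra :: ('k, 'g list \<Rightarrow> 'k) module"
  let ?G = "generated_subalgebra ?F (range free_generator)"
  have w: "basis_element w \<in> ?G" for w
  proof (induction w)
    case Nil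
    then show ?case using generated_subalgebra.one[of ?F] by simp
  next
    case (Cons g w)
    have "free_generator g \<otimes>\<^bsub>?F\<^esub> basis_element w \<in> ?G"
      by (intro generated_subalgebra.mult Cons generated_subalgebra.incl) auto
    then show ?case by (simp add: monoid_algebra_mult_basis)
  qed
  fix f assume "f \<in> carrier ?F"
  then show "f \<in> ?G"
  proof (induction rule: monoid_algebra_induct)
    case zero
    show ?case using generated_subalgebra.smult[OF w, of 0] by simp
  next
    case (add f m c)
    show ?case using generated_subalgebra.add[OF add(3) generated_subalgebra.smult[OF w, of c m]] by simp
  qed
qed

locale presentation =
  fixes R :: "('g list \<Rightarrow> 'k::field) set"
  assumes relators: "R \<subseteq> carrier free_algebra"
begin

abbreviation P where "P \<equiv> presented_algebra R"

sublocale F: kalgebra free_algebra by (rule kalgebra_free_algebra)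

sublocale I: kalgebra_ideal free_algebra "Idl\<^bsub>free_algebra\<^esub> R"
  by (intro kalgebra_ideal.intro F.kalgebra_axioms F.genideal_ideal relators)

lemma kalgebra_presented: "kalgebra P"
  unfolding presented_algebra_def by (rule I.kalgebra_quotient)

lemma projection_alg_hom: "(\<lambda>x. Idl\<^bsub>free_algebra\<^esub> R +>\<^bsub>free_algebra\<^esub> x) \<in> alg_hom free_algebra P"
  unfolding presented_algebra_def by (rule I.coset_alg_hom)

lemma projection_relator: "r \<in> R \<Longrightarrow> Idl\<^bsub>free_algebra\<^esub> R +>\<^bsub>free_algebra\<^esub> r = \<zero>\<^bsub>P\<^esub>"
  unfolding presented_algebra_def using F.genideal_self[OF relators] by (intro I.coset_eq_zero) auto

lemma presented_generator_closed: "presented_generator R g \<in> carrier P"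
  unfolding presented_algebra_def presented_generator_def I.quotient_carrier by (rule imageI) simp

context
  fixes B :: "('k, 'b, 'y) module_scheme" and \<gamma>
  assumes B: "kalgebra B" and \<gamma>: "\<And>g. \<gamma> g \<in> carrier B"
    and zero: "free_extension B \<gamma> ` R \<subseteq> {\<zero>\<^bsub>B\<^esub>}"
begin

lemma presented_lift_alg_hom: "quotient_lift (free_extension B \<gamma>) \<in> alg_hom P B"
  unfolding presented_algebra_def
  by (intro I.quotient_lift_alg_hom B kalgebra.free_extension_alg_hom \<gamma>
      kalgebra_ideal_kernel[OF F.kalgebra_axioms] relators zero)

lemma presented_lift_generator:
  "quotient_lift (free_extension B \<gamma>) (presented_generator R g) = \<gamma> g"
  unfolding presented_generator_def
  by (subst I.quotient_lift_coset[OF B])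
     (intro B kalgebra.free_extension_alg_hom \<gamma> kalgebra.free_extension_generator
      kalgebra_ideal_kernel[OF F.kalgebra_axioms] relators zero free_generator_closed)+

end

lemma presented_algebra_generated:
  "carrier P = generated_subalgebra P (range (presented_generator R))"
proof
  let ?\<pi> = "\<lambda>x. Idl\<^bsub>free_algebra\<^esub> R +>\<^bsub>free_algebra\<^esub> x"
  interpret P: kalgebra P by (rule kalgebra_presented)
  interpret \<pi>: kalgebra_hom free_algebra P ?\<pi>
    by (rule kalgebra_homI[OF F.kalgebra_axioms kalgebra_presented projection_alg_hom])
  have closed: "generated_subalgebra free_algebra (range free_generator) \<subseteq> carrier free_algebra"
    by (intro F.generated_subalgebra_subset image_subsetI free_generator_closed)
  have "?\<pi> f \<in> generated_subalgebra P (range (presented_generator R))"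
    if "f \<in> generated_subalgebra free_algebra (range free_generator)" for f
    using that
  proof induction
    case one
    show ?case unfolding \<pi>.hom_one by (rule generated_subalgebra.one)
  next
    case (incl x)
    then show ?case by (auto simp: presented_generator_def intro!: generated_subalgebra.incl)
  next
    case (add x y)
    then have "x \<in> carrier free_algebra" "y \<in> carrier free_algebra"
      using closed by blast+
    then show ?case using add by (simp only: \<pi>.hom_add generated_subalgebra.add)
  next
    case (mult x y)
    then have "x \<in> carrier free_algebra" "y \<in> carrier free_algebra"
      using closed by blast+
    then show ?case using mult by (simp only: \<pi>.hom_mult generated_subalgebra.mult)
  next
    case (smult x c)
    then have "x \<in> carrier free_algebra"
      using closed by blast
    then show ?case using smult by (simp only: \<pi>.hom_smult generated_subalgebra.smult)
  qed
  then show "carrier P \<subseteq> generated_subalgebra P (range (presented_generator R))"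
    using free_algebra_generated unfolding presented_algebra_def I.quotient_carrier by auto
  show "generated_subalgebra P (range (presented_generator R)) \<subseteq> carrier P"
    using presented_generator_closed by (intro P.generated_subalgebra_subset) auto
qed

end

section \<open>Tensor products\<close>

locale tensor_product = A: kalgebra A + B: kalgebra B
  for A :: "('k::field, 'a, 'x) module_scheme" and B :: "('k, 'b, 'y) module_scheme"
begin

abbreviation F where "F \<equiv> monoid_algebra (A \<times>\<times> B) :: ('k, 'a \<times> 'b \<Rightarrow> 'k) module"
abbreviation T where "T \<equiv> tensor_algebra A B"
abbreviation pure (infixl \<open>\<otimes>\<^sub>t\<close> 72) where "x \<otimes>\<^sub>t y \<equiv> pure_tensor A B x y"

lemma monoid_DirProd: "Group.monoid (A \<times>\<times> B)"
  by (intro DirProd_monoid A.monoid_axioms B.monoid_axioms)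

sublocale F: kalgebra F
  using monoid_DirProd by (rule monoid.kalgebra_monoid_algebra)

lemma basis_closed: "x \<in> carrier A \<Longrightarrow> y \<in> carrier B \<Longrightarrow> basis_element (x, y) \<in> carrier F"
  by simp

lemma bilinearity_relations_cases:
  assumes "r \<in> bilinearity_relations A B"
  obtains x x' y where "x \<in> carrier A" "x' \<in> carrier A" "y \<in> carrier B"
      "r = basis_element (x \<oplus>\<^bsub>A\<^esub> x', y) \<ominus>\<^bsub>F\<^esub> (basis_element (x, y) \<oplus>\<^bsub>F\<^esub> basis_element (x', y))"
  | x y y' where "x \<in> carrier A" "y \<in> carrier B" "y' \<in> carrier B"
      "r = basis_element (x, y \<oplus>\<^bsub>B\<^esub> y') \<ominus>\<^bsub>F\<^esub> (basis_element (x, y) \<oplus>\<^bsub>F\<^esub> basis_element (x, y'))"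
  | c x y where "x \<in> carrier A" "y \<in> carrier B"
      "r = basis_element (c \<odot>\<^bsub>A\<^esub> x, y) \<ominus>\<^bsub>F\<^esub> (c \<odot>\<^bsub>F\<^esub> basis_element (x, y))"
  | c x y where "x \<in> carrier A" "y \<in> carrier B"
      "r = basis_element (x, c \<odot>\<^bsub>B\<^esub> y) \<ominus>\<^bsub>F\<^esub> (c \<odot>\<^bsub>F\<^esub> basis_element (x, y))"
  using assms unfolding bilinearity_relations_def Let_def
  by (elim UnE CollectE exE conjE)
     ((rule that(1); assumption), (rule that(2); assumption), (rule that(3); assumption), (rule that(4); assumption))

lemma bilinearity_relations_subset: "bilinearity_relations A B \<subseteq> carrier F"
proof
  fix r assume "r \<in> bilinearity_relations A B"
  then show "r \<in> carrier F"
    by (cases rule: bilinearity_relations_cases)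
       (simp_all only: F.minus_closed F.add.m_closed F.smult_closed basis_closed
          A.add.m_closed B.add.m_closed A.smult_closed B.smult_closed)
qed

sublocale I: kalgebra_ideal F "tensor_ideal A B"
  unfolding tensor_ideal_def
  by (intro kalgebra_ideal.intro F.kalgebra_axioms F.genideal_ideal bilinearity_relations_subset)

lemma kalgebra_tensor: "kalgebra T"
  unfolding tensor_algebra_def by (rule I.kalgebra_quotient)

sublocale T: kalgebra T by (rule kalgebra_tensor)

sublocale \<pi>: kalgebra_hom F T "\<lambda>x. tensor_ideal A B +>\<^bsub>F\<^esub> x"
  unfolding tensor_algebra_def
  by (rule kalgebra_homI[OF F.kalgebra_axioms I.kalgebra_quotient I.coset_alg_hom])

lemma pure_tensor_eq: "pure_tensor A B x y = tensor_ideal A B +>\<^bsub>F\<^esub> basis_element (x, y)"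
  by (simp add: pure_tensor_def)

lemma projection_relation:
  assumes "u \<ominus>\<^bsub>F\<^esub> v \<in> bilinearity_relations A B" "u \<in> carrier F" "v \<in> carrier F"
  shows "tensor_ideal A B +>\<^bsub>F\<^esub> u = tensor_ideal A B +>\<^bsub>F\<^esub> v"
proof -
  have "u \<ominus>\<^bsub>F\<^esub> v \<in> tensor_ideal A B"
    using assms(1) F.genideal_self[OF bilinearity_relations_subset] by (auto simp: tensor_ideal_def)
  then have "tensor_ideal A B +>\<^bsub>F\<^esub> (u \<ominus>\<^bsub>F\<^esub> v) = \<zero>\<^bsub>T\<^esub>"
    unfolding tensor_algebra_def by (rule I.coset_eq_zero)
  then show ?thesis
    unfolding \<pi>.hom_minus[OF assms(2,3)]
    using \<pi>.hom_closed assms(2,3) by (simp only: T.diff_eq_zero_iff)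
qed

lemma pure_closed [simp, intro]:
  assumes x: "x \<in> carrier A" and y: "y \<in> carrier B"
  shows "x \<otimes>\<^sub>t y \<in> carrier T"
  unfolding pure_tensor_eq by (intro \<pi>.hom_closed basis_closed x y)

lemma pure_add_l:
  assumes x: "x \<in> carrier A" and x': "x' \<in> carrier A" and y: "y \<in> carrier B"
  shows "(x \<oplus>\<^bsub>A\<^esub> x') \<otimes>\<^sub>t y = x \<otimes>\<^sub>t y \<oplus>\<^bsub>T\<^esub> x' \<otimes>\<^sub>t y"
  unfolding pure_tensor_eq
  apply (subst \<pi>.hom_add[symmetric], (intro basis_closed x x' y)+)
  apply (rule projection_relation)
    apply (unfold bilinearity_relations_def Let_def, use x x' y in blast)
   apply (intro F.add.m_closed basis_closed A.add.m_closed x x' y)+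
  done

lemma pure_add_r:
  assumes x: "x \<in> carrier A" and y: "y \<in> carrier B" and y': "y' \<in> carrier B"
  shows "x \<otimes>\<^sub>t (y \<oplus>\<^bsub>B\<^esub> y') = x \<otimes>\<^sub>t y \<oplus>\<^bsub>T\<^esub> x \<otimes>\<^sub>t y'"
  unfolding pure_tensor_eq
  apply (subst \<pi>.hom_add[symmetric], (intro basis_closed x y y')+)
  apply (rule projection_relation)
    apply (unfold bilinearity_relations_def Let_def, use x y y' in blast)
   apply (intro F.add.m_closed basis_closed B.add.m_closed x y y')+
  done

lemma pure_smult_l:
  assumes x: "x \<in> carrier A" and y: "y \<in> carrier B"
  shows "(c \<odot>\<^bsub>A\<^esub> x) \<otimes>\<^sub>t y = c \<odot>\<^bsub>T\<^esub> (x \<otimes>\<^sub>t y)"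
  unfolding pure_tensor_eq
  apply (subst \<pi>.hom_smult[symmetric], (intro basis_closed x y)+)
  apply (rule projection_relation)
    apply (unfold bilinearity_relations_def Let_def, use x y in blast)
   apply (intro F.smult_closed basis_closed A.smult_closed x y)+
  done

lemma pure_smult_r:
  assumes x: "x \<in> carrier A" and y: "y \<in> carrier B"
  shows "x \<otimes>\<^sub>t (c \<odot>\<^bsub>B\<^esub> y) = c \<odot>\<^bsub>T\<^esub> (x \<otimes>\<^sub>t y)"
  unfolding pure_tensor_eq
  apply (subst \<pi>.hom_smult[symmetric], (intro basis_closed x y)+)
  apply (rule projection_relation)
    apply (unfold bilinearity_relations_def Let_def, use x y in blast)
   apply (intro F.smult_closed basis_closed B.smult_closed x y)+
  done

lemma pure_mult:
  assumes x: "x \<in> carrier A" and x': "x' \<in> carrier A" and y: "y \<in> carrier B" and y': "y' \<in> carrier B"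
  shows "x \<otimes>\<^sub>t y \<otimes>\<^bsub>T\<^esub> x' \<otimes>\<^sub>t y' = (x \<otimes>\<^bsub>A\<^esub> x') \<otimes>\<^sub>t (y \<otimes>\<^bsub>B\<^esub> y')"
  unfolding pure_tensor_eq
  by (subst \<pi>.hom_mult[symmetric], (intro basis_closed x x' y y')+)
     (simp add: monoid_algebra_mult_basis)

lemma pure_one: "\<one>\<^bsub>A\<^esub> \<otimes>\<^sub>t \<one>\<^bsub>B\<^esub> = \<one>\<^bsub>T\<^esub>"
  unfolding pure_tensor_eq \<pi>.hom_one[symmetric] by simp

lemma pure_zero_l [simp]: "y \<in> carrier B \<Longrightarrow> \<zero>\<^bsub>A\<^esub> \<otimes>\<^sub>t y = \<zero>\<^bsub>T\<^esub>"
  using pure_smult_l[of "\<zero>\<^bsub>A\<^esub>" y 0] by simp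

lemma pure_zero_r [simp]: "x \<in> carrier A \<Longrightarrow> x \<otimes>\<^sub>t \<zero>\<^bsub>B\<^esub> = \<zero>\<^bsub>T\<^esub>"
  using pure_smult_r[of x "\<zero>\<^bsub>B\<^esub>" 0] by simp

lemma pure_pow:
  "x \<in> carrier A \<Longrightarrow> y \<in> carrier B \<Longrightarrow>
    (x \<otimes>\<^sub>t y) [^]\<^bsub>T\<^esub> (n::nat) = (x [^]\<^bsub>A\<^esub> n) \<otimes>\<^sub>t (y [^]\<^bsub>B\<^esub> n)"
  by (induction n) (simp_all add: pure_one pure_mult)

text \<open>A scalar can be moved into the first factor, so sums of pure tensors exhaust the tensor
  product and no scalar case is needed.\<close>

lemma tensor_induct [consumes 1, case_names zero add]:
  assumes "z \<in> carrier T" and "P \<zero>\<^bsub>T\<^esub>"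
    and "\<And>z x y. z \<in> carrier T \<Longrightarrow> x \<in> carrier A \<Longrightarrow> y \<in> carrier B \<Longrightarrow> P z \<Longrightarrow> P (z \<oplus>\<^bsub>T\<^esub> x \<otimes>\<^sub>t y)"
  shows "P z"
proof -
  have "P (tensor_ideal A B +>\<^bsub>F\<^esub> f)" if "f \<in> carrier F" for f
    using that
  proof (induction rule: monoid_algebra_induct)
    case zero
    show ?case using assms(2) \<pi>.hom_zero by simp
  next
    case (add f m c)
    obtain x y where m: "m = (x, y)" "x \<in> carrier A" "y \<in> carrier B" using add(2) by auto
    have b: "basis_element m \<in> carrier F" unfolding m(1) by (rule basis_closed[OF m(2,3)])
    have "P ((tensor_ideal A B +>\<^bsub>F\<^esub> f) \<oplus>\<^bsub>T\<^esub> (c \<odot>\<^bsub>A\<^esub> x) \<otimes>\<^sub>t y)"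
      by (intro assms(3) \<pi>.hom_closed add m A.smult_closed)
    also have "(c \<odot>\<^bsub>A\<^esub> x) \<otimes>\<^sub>t y = tensor_ideal A B +>\<^bsub>F\<^esub> (c \<odot>\<^bsub>F\<^esub> basis_element m)"
      using pure_smult_l[OF m(2,3), of c] \<pi>.hom_smult[OF b, of c]
      by (simp only: pure_tensor_eq[of x y] m(1))
    also have "(tensor_ideal A B +>\<^bsub>F\<^esub> f) \<oplus>\<^bsub>T\<^esub> (tensor_ideal A B +>\<^bsub>F\<^esub> (c \<odot>\<^bsub>F\<^esub> basis_element m)) =
        tensor_ideal A B +>\<^bsub>F\<^esub> (f \<oplus>\<^bsub>F\<^esub> c \<odot>\<^bsub>F\<^esub> basis_element m)"
      by (rule \<pi>.hom_add[symmetric]) (intro add b F.smult_closed)+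
    finally show ?case by simp
  qed
  then show ?thesis using assms(1) unfolding tensor_algebra_def I.quotient_carrier by auto
qed

text \<open>A bilinear map that is also multiplicative extends to an algebra homomorphism because it
  kills the bilinearity relations. The map is written exactly as in \<open>tensor_map\<close> and
  \<open>tensor_rep\<close>, so that both are instances.\<close>

lemma tensor_universal:
  fixes C :: "('k, 'c, 'z) module_scheme"
  assumes C: "kalgebra C"
    and cl: "\<And>x y. x \<in> carrier A \<Longrightarrow> y \<in> carrier B \<Longrightarrow> g x y \<in> carrier C"
    and add_l: "\<And>x x' y. x \<in> carrier A \<Longrightarrow> x' \<in> carrier A \<Longrightarrow> y \<in> carrier B \<Longrightarrow>
      g (x \<oplus>\<^bsub>A\<^esub> x') y = g x y \<oplus>\<^bsub>C\<^esub> g x' y"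
    and add_r: "\<And>x y y'. x \<in> carrier A \<Longrightarrow> y \<in> carrier B \<Longrightarrow> y' \<in> carrier B \<Longrightarrow>
      g x (y \<oplus>\<^bsub>B\<^esub> y') = g x y \<oplus>\<^bsub>C\<^esub> g x y'"
    and smult_l: "\<And>c x y. x \<in> carrier A \<Longrightarrow> y \<in> carrier B \<Longrightarrow> g (c \<odot>\<^bsub>A\<^esub> x) y = c \<odot>\<^bsub>C\<^esub> g x y"
    and smult_r: "\<And>c x y. x \<in> carrier A \<Longrightarrow> y \<in> carrier B \<Longrightarrow> g x (c \<odot>\<^bsub>B\<^esub> y) = c \<odot>\<^bsub>C\<^esub> g x y"
    and mult: "\<And>x x' y y'. x \<in> carrier A \<Longrightarrow> x' \<in> carrier A \<Longrightarrow> y \<in> carrier B \<Longrightarrow> y' \<in> carrier B \<Longrightarrow>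
      g (x \<otimes>\<^bsub>A\<^esub> x') (y \<otimes>\<^bsub>B\<^esub> y') = g x y \<otimes>\<^bsub>C\<^esub> g x' y'"
    and one: "g \<one>\<^bsub>A\<^esub> \<one>\<^bsub>B\<^esub> = \<one>\<^bsub>C\<^esub>"
  defines "\<Phi> \<equiv> quotient_lift (linear_extension C (\<lambda>(x, y). g x y))"
  shows "\<Phi> \<in> alg_hom T C"
    and "\<And>x y. x \<in> carrier A \<Longrightarrow> y \<in> carrier B \<Longrightarrow> \<Phi> (x \<otimes>\<^sub>t y) = g x y"
proof -
  interpret C: kalgebra C by fact
  let ?L = "linear_extension C (\<lambda>(x, y). g x y)"
  have L: "?L \<in> alg_hom F C"
    by (rule C.linear_extension_alg_hom[OF monoid_DirProd]) (auto simp: cl one mult)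
  interpret L: kalgebra_hom F C ?L
    by (rule kalgebra_homI[OF F.kalgebra_axioms C L])
  have basis: "?L (basis_element (x, y)) = g x y" if "x \<in> carrier A" "y \<in> carrier B" for x y
    using that cl by (subst C.linear_extension_basis) auto
  have "?L ` bilinearity_relations A B \<subseteq> {\<zero>\<^bsub>C\<^esub>}"
  proof (rule image_subsetI)
    fix r assume "r \<in> bilinearity_relations A B"
    then show "?L r \<in> {\<zero>\<^bsub>C\<^esub>}"
    proof (cases rule: bilinearity_relations_cases)
      case (1 x x' y)
      then show ?thesis
        by (simp only: L.hom_minus L.hom_add F.add.m_closed basis_closed basis A.add.m_closed add_l
            singleton_iff C.diff_eq_zero_iff cl C.add.m_closed)
    next
      case (2 x y y')
      then show ?thesis
        by (simp only: L.hom_minus L.hom_add F.add.m_closed basis_closed basis B.add.m_closed add_r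
            singleton_iff C.diff_eq_zero_iff cl C.add.m_closed)
    next
      case (3 x y c)
      then show ?thesis
        by (simp only: L.hom_minus L.hom_smult F.smult_closed basis_closed basis A.smult_closed smult_l
            singleton_iff C.diff_eq_zero_iff cl C.smult_closed)
    next
      case (4 x y c)
      then show ?thesis
        by (simp only: L.hom_minus L.hom_smult F.smult_closed basis_closed basis B.smult_closed smult_r
            singleton_iff C.diff_eq_zero_iff cl C.smult_closed)
    qed
  qed
  then have zero: "?L ` tensor_ideal A B \<subseteq> {\<zero>\<^bsub>C\<^esub>}"
    unfolding tensor_ideal_def
    by (intro kalgebra_ideal_kernel[OF F.kalgebra_axioms C L] bilinearity_relations_subset)
  show "\<Phi> \<in> alg_hom T C"
    unfolding \<Phi>_def tensor_algebra_def by (rule I.quotient_lift_alg_hom[OF C L zero])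
  show "\<Phi> (x \<otimes>\<^sub>t y) = g x y" if "x \<in> carrier A" "y \<in> carrier B" for x y
    unfolding \<Phi>_def pure_tensor_eq
    by (subst I.quotient_lift_coset[OF C L zero basis_closed]) (use that in \<open>auto simp: basis\<close>)
qed

lemma tensor_hom_eq:
  assumes "kalgebra C" "f \<in> alg_hom T C" "g \<in> alg_hom T C"
    and "\<And>x y. x \<in> carrier A \<Longrightarrow> y \<in> carrier B \<Longrightarrow> f (x \<otimes>\<^sub>t y) = g (x \<otimes>\<^sub>t y)"
    and "z \<in> carrier T"
  shows "f z = g z"
proof -
  interpret f: kalgebra_hom T C f
    using assms by (intro kalgebra_homI T.kalgebra_axioms)
  interpret g: kalgebra_hom T C g
    using assms by (intro kalgebra_homI T.kalgebra_axioms)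
  show ?thesis using assms(5)
    by (induction rule: tensor_induct) (simp_all add: assms(4))
qed

context
  fixes X Y assumes X: "X \<subseteq> carrier A" and Y: "Y \<subseteq> carrier B"
begin

lemma tensor_generators_subset: "{x \<otimes>\<^sub>t y | x y. x \<in> X \<and> y \<in> Y} \<subseteq> carrier T"
  using X Y by auto

lemma subgroup_tensor_subspace: "subgroup (tensor_subspace A B X Y) (add_monoid T)"
  unfolding tensor_subspace_def
  using T.add.generate_is_subgroup tensor_generators_subset by simp

lemma tensor_subspace_subset: "tensor_subspace A B X Y \<subseteq> carrier T"
  using subgroup.subset[OF subgroup_tensor_subspace] by simp

lemma tensor_subspace_add:
  "s \<in> tensor_subspace A B X Y \<Longrightarrow> t \<in> tensor_subspace A B X Y \<Longrightarrow> s \<oplus>\<^bsub>T\<^esub> t \<in> tensor_subspace A B X Y"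
  using subgroup.m_closed[OF subgroup_tensor_subspace] by simp

lemma tensor_subspace_pure: "x \<in> X \<Longrightarrow> y \<in> Y \<Longrightarrow> x \<otimes>\<^sub>t y \<in> tensor_subspace A B X Y"
  unfolding tensor_subspace_def by (rule generate.incl) auto

text \<open>The subspace is generated as an additive group by pure tensors, so any additive
  endomorphism that sends these generators into it preserves it. Scalar multiplication is one such
  map; closure under products follows by applying the lemma once to left and once to right
  multiplication.\<close>

lemma tensor_subspace_image:
  assumes \<phi>: "\<And>s t. s \<in> carrier T \<Longrightarrow> t \<in> carrier T \<Longrightarrow> \<phi> (s \<oplus>\<^bsub>T\<^esub> t) = \<phi> s \<oplus>\<^bsub>T\<^esub> \<phi> t"
    and cl: "\<And>s. s \<in> carrier T \<Longrightarrow> \<phi> s \<in> carrier T"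
    and pure: "\<And>x y. x \<in> X \<Longrightarrow> y \<in> Y \<Longrightarrow> \<phi> (x \<otimes>\<^sub>t y) \<in> tensor_subspace A B X Y"
    and s: "s \<in> tensor_subspace A B X Y"
  shows "\<phi> s \<in> tensor_subspace A B X Y"
proof -
  have zero: "\<phi> \<zero>\<^bsub>T\<^esub> = \<zero>\<^bsub>T\<^esub>"
    using \<phi>[of "\<zero>\<^bsub>T\<^esub>" "\<zero>\<^bsub>T\<^esub>"] cl[of "\<zero>\<^bsub>T\<^esub>"] T.add.l_cancel_one'[of "\<phi> \<zero>\<^bsub>T\<^esub>" "\<phi> \<zero>\<^bsub>T\<^esub>"] by simp
  have minus: "\<phi> (\<ominus>\<^bsub>T\<^esub> t) = \<ominus>\<^bsub>T\<^esub> \<phi> t" if "t \<in> carrier T" for t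
    using \<phi>[of "\<ominus>\<^bsub>T\<^esub> t" t] that zero cl by (simp add: T.l_neg T.minus_equality)
  have sub: "generate (add_monoid T) {x \<otimes>\<^sub>t y | x y. x \<in> X \<and> y \<in> Y} \<subseteq> carrier T"
    using tensor_subspace_subset by (simp add: tensor_subspace_def)
  show ?thesis using s unfolding tensor_subspace_def
  proof (induction rule: generate.induct)
    case one
    show ?case using zero generate.one[of "add_monoid T"] by simp
  next
    case (incl h)
    then show ?case using pure unfolding tensor_subspace_def by auto
  next
    case (inv h)
    then have "h \<in> carrier T" using tensor_generators_subset by auto
    moreover have "\<phi> h \<in> tensor_subspace A B X Y" using inv pure by auto
    ultimately show ?case
      using minus[of h] subgroup.m_inv_closed[OF subgroup_tensor_subspace, of "\<phi> h"]
      unfolding tensor_subspace_def a_inv_def by simp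
  next
    case (eng h1 h2)
    then have "h1 \<in> carrier T" "h2 \<in> carrier T" using sub by blast+
    then show ?case using \<phi>[of h1 h2] generate.eng[OF eng(3,4)] by simp
  qed
qed

lemma tensor_subspace_smult:
  assumes "\<And>c x. x \<in> X \<Longrightarrow> c \<odot>\<^bsub>A\<^esub> x \<in> X" "s \<in> tensor_subspace A B X Y"
  shows "c \<odot>\<^bsub>T\<^esub> s \<in> tensor_subspace A B X Y"
proof (rule tensor_subspace_image[OF _ _ _ assms(2)])
  fix x y assume "x \<in> X" "y \<in> Y"
  then have "(c \<odot>\<^bsub>A\<^esub> x) \<otimes>\<^sub>t y \<in> tensor_subspace A B X Y" using assms by (intro tensor_subspace_pure)
  moreover have "x \<in> carrier A" "y \<in> carrier B" using X Y \<open>x \<in> X\<close> \<open>y \<in> Y\<close> by auto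
  ultimately show "c \<odot>\<^bsub>T\<^esub> (x \<otimes>\<^sub>t y) \<in> tensor_subspace A B X Y" by (simp add: pure_smult_l)
qed (simp_all add: T.smult_r_distr)

lemma tensor_subspace_mult:
  assumes X': "\<And>x x'. x \<in> X \<Longrightarrow> x' \<in> X \<Longrightarrow> x \<otimes>\<^bsub>A\<^esub> x' \<in> X"
    and Y': "\<And>y y'. y \<in> Y \<Longrightarrow> y' \<in> Y \<Longrightarrow> y \<otimes>\<^bsub>B\<^esub> y' \<in> Y"
    and s: "s \<in> tensor_subspace A B X Y" and t: "t \<in> tensor_subspace A B X Y"
  shows "s \<otimes>\<^bsub>T\<^esub> t \<in> tensor_subspace A B X Y"
proof (rule tensor_subspace_image[OF _ _ _ t])
  have s': "s \<in> carrier T" using s tensor_subspace_subset by auto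
  then show "s \<otimes>\<^bsub>T\<^esub> (u \<oplus>\<^bsub>T\<^esub> v) = s \<otimes>\<^bsub>T\<^esub> u \<oplus>\<^bsub>T\<^esub> s \<otimes>\<^bsub>T\<^esub> v"
    if "u \<in> carrier T" "v \<in> carrier T" for u v
    using that by (simp add: T.r_distr)
  show "s \<otimes>\<^bsub>T\<^esub> u \<in> carrier T" if "u \<in> carrier T" for u using that s' by simp
  fix x y assume xy: "x \<in> X" "y \<in> Y"
  then have cl: "x \<in> carrier A" "y \<in> carrier B" using X Y by auto
  show "s \<otimes>\<^bsub>T\<^esub> x \<otimes>\<^sub>t y \<in> tensor_subspace A B X Y"
  proof (rule tensor_subspace_image[OF _ _ _ s])
    fix x' y' assume xy': "x' \<in> X" "y' \<in> Y"
    then have "x' \<in> carrier A" "y' \<in> carrier B" using X Y by auto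
    then show "x' \<otimes>\<^sub>t y' \<otimes>\<^bsub>T\<^esub> x \<otimes>\<^sub>t y \<in> tensor_subspace A B X Y"
      using xy xy' cl by (simp add: pure_mult tensor_subspace_pure X' Y')
  qed (use cl in \<open>simp_all add: T.l_distr\<close>)
qed

end

end

section \<open>Powers of sums of \<open>q\<close>-commuting elements\<close>

text \<open>Gaussian binomial coefficients by the q-Pascal rule. The usual quotient of q-factorials
  would divide by zero at a root of unity, which is exactly where the values are wanted.\<close>

fun gauss_binomial :: "'k::field \<Rightarrow> nat \<Rightarrow> nat \<Rightarrow> 'k" where
  "gauss_binomial w n 0 = 1"
| "gauss_binomial w 0 (Suc k) = 0"
| "gauss_binomial w (Suc n) (Suc k) = w ^ Suc k * gauss_binomial w n (Suc k) + gauss_binomial w n k"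

lemma gauss_binomial_eq_0: "n < k \<Longrightarrow> gauss_binomial w n k = 0"
  by (induction w n k rule: gauss_binomial.induct) auto

lemma gauss_binomial_self: "gauss_binomial w n n = 1"
  by (induction n) (auto simp: gauss_binomial_eq_0)

text \<open>The q-analogue of k * binom(n, k) = n * binom(n - 1, k - 1), multiplied out by w - 1 so
  that it holds for every \<open>w\<close>.\<close>

lemma gauss_binomial_absorb:
  "(w ^ Suc k - 1) * gauss_binomial w (Suc n) (Suc k) = (w ^ Suc n - 1) * gauss_binomial w n k"
proof (induction n arbitrary: k)
  case 0
  then show ?case by (cases k) auto
next
  case (Suc n)
  show ?case
  proof (cases k)
    case 0
    then show ?thesis using Suc[of 0] by (simp add: algebra_simps)
  next
    case [simp]: (Suc j)
    let ?G = "gauss_binomial w"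
    have "(w ^ Suc k - 1) * ?G (Suc (Suc n)) (Suc k) =
        w ^ Suc k * ((w ^ Suc k - 1) * ?G (Suc n) (Suc k)) +
        (w * ((w ^ Suc j - 1) * ?G (Suc n) (Suc j)) + (w - 1) * ?G (Suc n) (Suc j))"
      by (simp add: algebra_simps del: gauss_binomial.simps(3)) (simp add: algebra_simps)
    also have "\<dots> = w ^ Suc k * ((w ^ Suc n - 1) * ?G n k) +
        (w * ((w ^ Suc n - 1) * ?G n j) + (w - 1) * ?G (Suc n) (Suc j))"
      unfolding Suc.IH ..
    also have "\<dots> = w * (w ^ Suc n - 1) * ?G (Suc n) (Suc j) + (w - 1) * ?G (Suc n) (Suc j)"
      by (simp add: algebra_simps)
    also have "\<dots> = (w ^ Suc (Suc n) - 1) * ?G (Suc n) k" by (simp add: algebra_simps)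
    finally show ?thesis .
  qed
qed

text \<open>In the absorption identity the right-hand side has the factor w^N - 1 = 0, while w^k - 1
  on the left is nonzero by primitivity.\<close>

lemma gauss_binomial_root_of_unity:
  assumes "primitive_root_of_unity N w" "0 < k" "k < N"
  shows "gauss_binomial w N k = 0"
proof -
  obtain n j where "N = Suc n" "k = Suc j" using assms by (metis Suc_pred less_trans)
  then show ?thesis using assms gauss_binomial_absorb[of w j n] by (auto simp: primitive_root_of_unity_def)
qed

context kalgebra
begin

context
  fixes u v w
  assumes u: "u \<in> carrier A" and v: "v \<in> carrier A" and uv: "u \<otimes> v = w \<odot> (v \<otimes> u)"
begin

lemma q_commute_pow: "u \<otimes> v [^] (k::nat) = w ^ k \<odot> (v [^] k \<otimes> u)"
proof (induction k)
  case (Suc k)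
  have "u \<otimes> v [^] Suc k = (u \<otimes> v [^] k) \<otimes> v" using u v by (simp add: m_assoc)
  also have "\<dots> = w ^ k \<odot> (v [^] k \<otimes> (u \<otimes> v))" using u v Suc by (simp add: m_assoc smult_mult_l)
  also have "\<dots> = w ^ Suc k \<odot> (v [^] Suc k \<otimes> u)"
    using u v by (simp add: uv smult_mult_r smult_assoc[symmetric] m_assoc mult.commute)
  finally show ?case .
qed (use u v in simp)

text \<open>Proportionality is enough here: it transfers the nilpotency of \<open>u\<close> or of
  \<open>v\<close> to the product, as the antipode of the quantum group requires.\<close>

lemma q_commute_mult_pow: "\<exists>c. (v \<otimes> u) [^] (n::nat) = c \<odot> (v [^] n \<otimes> u [^] n)"
proof (induction n)
  case 0
  show ?case by (intro exI[of _ 1]) simp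
next
  case (Suc n)
  then obtain c where c: "(v \<otimes> u) [^] n = c \<odot> (v [^] n \<otimes> u [^] n)" ..
  have "(v \<otimes> u) [^] Suc n = (v \<otimes> u) \<otimes> (v \<otimes> u) [^] n" using u v by (subst nat_pow_Suc2) auto
  also have "\<dots> = c \<odot> (v \<otimes> (u \<otimes> v [^] n) \<otimes> u [^] n)"
    using u v by (simp add: c smult_mult_r m_assoc)
  also have "\<dots> = (c * w ^ n) \<odot> ((v \<otimes> v [^] n) \<otimes> (u \<otimes> u [^] n))"
    using u v by (simp add: q_commute_pow smult_mult_r smult_mult_l smult_assoc m_assoc)
  also have "v \<otimes> v [^] n = v [^] Suc n" using v by (metis nat_pow_Suc2)
  also have "u \<otimes> u [^] n = u [^] Suc n" using u by (metis nat_pow_Suc2)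
  finally show ?case by blast
qed

text \<open>Moving the new factor \<open>u\<close> past v^k costs w^k, which is the weight in the
  q-Pascal rule; the new factor \<open>v\<close> merely shifts the index.\<close>

lemma q_binomial:
  "(u \<oplus> v) [^] (n::nat) = (\<Oplus>k\<in>{..n}. gauss_binomial w n k \<odot> (v [^] k \<otimes> u [^] (n - k)))"
proof (induction n)
  case 0
  show ?case by simp
next
  case (Suc n)
  let ?G = "gauss_binomial w"
  let ?t = "\<lambda>k. v [^] k \<otimes> u [^] (n - k)"
  let ?g = "\<lambda>k. (w ^ k * ?G n k) \<odot> (v [^] k \<otimes> u [^] (Suc n - k))"
  let ?h = "\<lambda>k. ?G n k \<odot> (v [^] Suc k \<otimes> u [^] (n - k))"
  have cl: "v [^] k \<in> carrier A" "u [^] k \<in> carrier A" for k :: nat using u v by auto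
  have "(\<Oplus>k\<in>{..n}. u \<otimes> (?G n k \<odot> ?t k)) = (\<Oplus>k\<in>{..n}. ?g k)"
  proof (rule add.finprod_cong')
    fix k assume "k \<in> {..n}"
    then have "Suc n - k = Suc (n - k)" by auto
    then show "u \<otimes> (?G n k \<odot> ?t k) = ?g k"
      using u v cl nat_pow_Suc2[OF u, of "n - k"]
      by (simp add: smult_mult_r m_assoc[symmetric] q_commute_pow smult_mult_l smult_assoc[symmetric]
          mult.commute del: nat_pow_Suc)
  qed (use cl u v in auto)
  also have "\<dots> = (\<Oplus>k\<in>{..Suc n}. ?g k)"
    using cl u v by (subst finsum_Suc) (auto simp: gauss_binomial_eq_0)
  also have "\<dots> = (\<Oplus>k\<in>{..n}. ?g (Suc k)) \<oplus> u [^] Suc n"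
    using cl u v by (subst add.finprod_Suc2) (auto simp del: nat_pow_Suc)
  finally have 1: "u \<otimes> (\<Oplus>k\<in>{..n}. ?G n k \<odot> ?t k) = (\<Oplus>k\<in>{..n}. ?g (Suc k)) \<oplus> u [^] Suc n"
    using cl u v by (subst finsum_rdistr) auto
  have "(\<Oplus>k\<in>{..n}. v \<otimes> (?G n k \<odot> ?t k)) = (\<Oplus>k\<in>{..n}. ?h k)"
  proof (rule add.finprod_cong')
    fix k
    show "v \<otimes> (?G n k \<odot> ?t k) = ?h k"
      using v cl nat_pow_Suc2[OF v, of k]
      by (simp add: smult_mult_r m_assoc[symmetric] del: nat_pow_Suc)
  qed (use cl u v in auto)
  then have 2: "v \<otimes> (\<Oplus>k\<in>{..n}. ?G n k \<odot> ?t k) = (\<Oplus>k\<in>{..n}. ?h k)"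
    using cl u v by (subst finsum_rdistr) auto
  have "(u \<oplus> v) [^] Suc n = (u \<oplus> v) \<otimes> (u \<oplus> v) [^] n"
    using u v by (subst nat_pow_Suc2) auto
  also have "\<dots> = u \<otimes> (\<Oplus>k\<in>{..n}. ?G n k \<odot> ?t k) \<oplus> v \<otimes> (\<Oplus>k\<in>{..n}. ?G n k \<odot> ?t k)"
    unfolding Suc using u v cl by (intro l_distr finsum_closed) auto
  also have "\<dots> = ((\<Oplus>k\<in>{..n}. ?g (Suc k)) \<oplus> (\<Oplus>k\<in>{..n}. ?h k)) \<oplus> u [^] Suc n"
    unfolding 1 2 using u v cl
    by (simp add: a_ac finsum_closed Pi_iff del: nat_pow_Suc)
  also have "(\<Oplus>k\<in>{..n}. ?g (Suc k)) \<oplus> (\<Oplus>k\<in>{..n}. ?h k) = (\<Oplus>k\<in>{..n}. ?g (Suc k) \<oplus> ?h k)"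
    using cl u v by (intro finsum_addf[symmetric]) (auto simp del: nat_pow_Suc)
  also have "\<dots> = (\<Oplus>k\<in>{..n}. ?G (Suc n) (Suc k) \<odot> (v [^] Suc k \<otimes> u [^] (Suc n - Suc k)))"
    using cl u v by (intro add.finprod_cong') (auto simp: smult_l_distr simp del: nat_pow_Suc)
  also have "\<dots> \<oplus> u [^] Suc n = (\<Oplus>k\<in>{..Suc n}. ?G (Suc n) k \<odot> (v [^] k \<otimes> u [^] (Suc n - k)))"
    using cl u v by (subst add.finprod_Suc2) (auto simp del: nat_pow_Suc gauss_binomial.simps(3))
  finally show ?case .
qed

lemma q_binomial_root_of_unity:
  assumes N: "primitive_root_of_unity N w" "N > 0"
  shows "(u \<oplus> v) [^] N = u [^] N \<oplus> v [^] N"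
proof -
  let ?f = "\<lambda>k. gauss_binomial w N k \<odot> (v [^] k \<otimes> u [^] (N - k))"
  have cl: "v [^] k \<in> carrier A" "u [^] k \<in> carrier A" for k :: nat using u v by auto
  have "(\<Oplus>k\<in>{0, N}. ?f k) = (\<Oplus>k\<in>{..N}. ?f k)"
    using cl gauss_binomial_root_of_unity[OF N(1)]
    by (intro add.finprod_mono_neutral_cong_left) auto
  also have "\<dots> = (u \<oplus> v) [^] N" by (rule q_binomial[symmetric])
  finally show ?thesis using N(2) cl by (simp add: gauss_binomial_self)
qed

end

end

section \<open>Opposite, ground and matrix algebras\<close>

lemma opposite_algebra_simps [simp]:
  "carrier (opposite_algebra A) = carrier A"
  "x \<otimes>\<^bsub>opposite_algebra A\<^esub> y = y \<otimes>\<^bsub>A\<^esub> x"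
  "\<one>\<^bsub>opposite_algebra A\<^esub> = \<one>\<^bsub>A\<^esub>"
  "\<zero>\<^bsub>opposite_algebra A\<^esub> = \<zero>\<^bsub>A\<^esub>"
  "x \<oplus>\<^bsub>opposite_algebra A\<^esub> y = x \<oplus>\<^bsub>A\<^esub> y"
  "c \<odot>\<^bsub>opposite_algebra A\<^esub> x = c \<odot>\<^bsub>A\<^esub> x"
  by (simp_all add: opposite_algebra_def)

lemma (in kalgebra) kalgebra_opposite: "kalgebra (opposite_algebra A)"
proof -
  have "abelian_group (opposite_algebra A)"
    by (rule abelian_groupI) (auto simp: a_ac intro!: bexI[of _ "\<ominus> _"] l_neg)
  moreover have "Group.monoid (opposite_algebra A)"
    by (rule monoidI) (auto simp: m_assoc)
  ultimately have "ring (opposite_algebra A)"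
    by (rule ringI) (auto simp: l_distr r_distr)
  then interpret op: ring "opposite_algebra A" .
  show ?thesis
    by unfold_locales (auto simp: smult_l_distr smult_r_distr smult_assoc smult_mult_l smult_mult_r)
qed

lemma (in kalgebra) opposite_pow:
  "x \<in> carrier A \<Longrightarrow> x [^]\<^bsub>opposite_algebra A\<^esub> (n::nat) = x [^] n"
proof (induction n)
  case (Suc n)
  interpret op: kalgebra "opposite_algebra A" by (rule kalgebra_opposite)
  show ?case using Suc by (simp add: nat_pow_comm[of x 1, simplified] nat_pow_Suc2 del: nat_pow_Suc)
qed simp

lemma (in kalgebra) opposite_minus:
  assumes "x \<in> carrier A" "y \<in> carrier A"
  shows "x \<ominus>\<^bsub>opposite_algebra A\<^esub> y = x \<ominus> y"
proof -
  interpret op: kalgebra "opposite_algebra A" by (rule kalgebra_opposite)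
  show ?thesis using assms op.minus_conv_smult[of y] by (simp add: a_minus_def minus_conv_smult)
qed

lemma ground_algebra_simps [simp]:
  "carrier ground_algebra = UNIV" "x \<otimes>\<^bsub>ground_algebra\<^esub> y = x * y" "\<one>\<^bsub>ground_algebra\<^esub> = 1"
  "\<zero>\<^bsub>ground_algebra\<^esub> = 0" "x \<oplus>\<^bsub>ground_algebra\<^esub> y = x + y" "c \<odot>\<^bsub>ground_algebra\<^esub> x = c * x"
  by (simp_all add: ground_algebra_def)

lemma kalgebra_ground: "kalgebra (ground_algebra :: ('k::field, 'k) module)"
proof -
  have "abelian_group (ground_algebra :: ('k, 'k) module)"
    by (rule abelian_groupI) (auto simp: algebra_simps intro: exI[of _ "- _"])
  moreover have "Group.monoid (ground_algebra :: ('k, 'k) module)"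
    by (rule monoidI) auto
  ultimately have "ring (ground_algebra :: ('k, 'k) module)"
    by (rule ringI) (auto simp: algebra_simps)
  then interpret ring "ground_algebra :: ('k, 'k) module" .
  show ?thesis by unfold_locales (auto simp: algebra_simps)
qed

text \<open>Indices range over an arbitrary finite type, so that Kronecker products are again
  matrices, indexed by a product type.\<close>

definition matrix_algebra :: "('k::field, 'i::finite \<Rightarrow> 'i \<Rightarrow> 'k) module" where
  "matrix_algebra =
     \<lparr>carrier = UNIV, mult = (\<lambda>M N i j. \<Sum>k\<in>UNIV. M i k * N k j), one = (\<lambda>i j. if i = j then 1 else 0),
      zero = (\<lambda>i j. 0), add = (\<lambda>M N i j. M i j + N i j), smult = (\<lambda>c M i j. c * M i j)\<rparr>"

lemma matrix_algebra_simps [simp]: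
  "carrier matrix_algebra = UNIV"
  "M \<otimes>\<^bsub>matrix_algebra\<^esub> N = (\<lambda>i j. \<Sum>k\<in>UNIV. M i k * N k j)"
  "\<one>\<^bsub>matrix_algebra\<^esub> = (\<lambda>i j. if i = j then 1 else 0)"
  "\<zero>\<^bsub>matrix_algebra\<^esub> = (\<lambda>i j. 0)"
  "M \<oplus>\<^bsub>matrix_algebra\<^esub> N = (\<lambda>i j. M i j + N i j)"
  "c \<odot>\<^bsub>matrix_algebra\<^esub> M = (\<lambda>i j. c * M i j)"
  by (simp_all add: matrix_algebra_def)

lemma kalgebra_matrix: "kalgebra (matrix_algebra :: ('k::field, 'i::finite \<Rightarrow> 'i \<Rightarrow> 'k) module)"
proof -
  let ?M = "matrix_algebra :: ('k, 'i \<Rightarrow> 'i \<Rightarrow> 'k) module"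
  have "abelian_group ?M"
  proof (rule abelian_groupI)
    fix M :: "'i \<Rightarrow> 'i \<Rightarrow> 'k"
    show "\<exists>N\<in>carrier ?M. N \<oplus>\<^bsub>?M\<^esub> M = \<zero>\<^bsub>?M\<^esub>"
      by (intro bexI[of _ "\<lambda>i j. - M i j"]) auto
  qed (auto simp: add_ac)
  moreover have "Group.monoid ?M"
  proof (rule monoidI)
    fix L M N :: "'i \<Rightarrow> 'i \<Rightarrow> 'k"
    have "(\<Sum>k\<in>UNIV. (\<Sum>l\<in>UNIV. L i l * M l k) * N k j) =
        (\<Sum>l\<in>UNIV. L i l * (\<Sum>k\<in>UNIV. M l k * N k j))" for i j
      unfolding sum_distrib_left sum_distrib_right by (subst sum.swap) (simp add: mult.assoc)
    then show "L \<otimes>\<^bsub>?M\<^esub> M \<otimes>\<^bsub>?M\<^esub> N = L \<otimes>\<^bsub>?M\<^esub> (M \<otimes>\<^bsub>?M\<^esub> N)" by simp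
  qed (auto simp: if_distrib if_distribR sum.delta sum.delta' cong: if_cong)
  ultimately have "ring ?M"
    by (rule ringI) (auto simp: sum.distrib algebra_simps)
  then interpret ring ?M .
  show ?thesis
    by unfold_locales (auto simp: algebra_simps sum_distrib_left)
qed

lemma matrix_minus [simp]: "M \<ominus>\<^bsub>matrix_algebra\<^esub> N = (\<lambda>i j. M i j - N i j)"
proof -
  interpret kalgebra matrix_algebra by (rule kalgebra_matrix)
  show ?thesis by (simp add: a_minus_def minus_conv_smult)
qed

definition kronecker :: "('i \<Rightarrow> 'i \<Rightarrow> 'k::field) \<Rightarrow> ('j \<Rightarrow> 'j \<Rightarrow> 'k) \<Rightarrow> 'i \<times> 'j \<Rightarrow> 'i \<times> 'j \<Rightarrow> 'k" where
  "kronecker M N = (\<lambda>(i, i') (j, j'). M i j * N i' j')"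

lemma kronecker_mult:
  "kronecker (\<lambda>i j. \<Sum>k\<in>UNIV. M i k * M' k j) (\<lambda>i j. \<Sum>k\<in>UNIV. N i k * N' k j) =
    (\<lambda>i j. \<Sum>k\<in>UNIV. kronecker M N i k * kronecker M' N' k j)"
  by (auto simp: fun_eq_iff kronecker_def sum_product sum.cartesian_product mult_ac split_beta
      simp flip: UNIV_Times_UNIV)

section \<open>Coproducts\<close>

locale hopf_structure = kalgebra H for H :: "('k::field, 'h) hopf" (structure) +
  assumes comult_alg_hom: "comult H \<in> alg_hom H (tensor_algebra H H)"
    and antipode_closed: "x \<in> carrier H \<Longrightarrow> antipode H x \<in> carrier H"
begin

sublocale tensor_product H H
  by (simp add: tensor_product_def kalgebra_axioms)

abbreviation HH where "HH \<equiv> tensor_algebra H H"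
abbreviation pure_H (infixl \<open>\<otimes>\<^sub>h\<close> 72) where "x \<otimes>\<^sub>h y \<equiv> pure_tensor H H x y"

sublocale \<Delta>: kalgebra_hom H "tensor_algebra H H" "comult H"
  by (intro kalgebra_homI kalgebra_axioms kalgebra_tensor comult_alg_hom)

text \<open>The coproduct is an algebra homomorphism and \<open>A \<otimes> H\<close> is a
  subalgebra of the tensor square, so the coideal condition only has to be checked on
  generators.\<close>

lemma generated_right_coideal_subalgebra:
  assumes S: "S \<subseteq> carrier H"
    and \<Delta>: "\<And>s. s \<in> S \<Longrightarrow>
      comult H s \<in> tensor_subspace H H (generated_subalgebra H S) (carrier H)"
  shows "generated_subalgebra H S \<in> right_coideal_subalgebras H"
proof -
  let ?A = "generated_subalgebra H S"
  let ?T = "tensor_subspace H H ?A (carrier H)"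
  have sub: "?A \<subseteq> carrier H" by (rule generated_subalgebra_subset[OF S])
  note rules = tensor_subspace_add[OF sub subset_refl] tensor_subspace_mult[OF sub subset_refl]
    tensor_subspace_smult[OF sub subset_refl] tensor_subspace_pure[OF sub subset_refl]
  have "comult H x \<in> ?T" if "x \<in> ?A" for x
    using that
  proof induction
    case one
    show ?case using rules(4)[of \<one> \<one>] by (simp add: generated_subalgebra.one pure_one)
  next
    case (add x y)
    then have "x \<in> carrier H" "y \<in> carrier H" using sub by blast+
    then show ?case using add by (simp add: rules)
  next
    case (mult x y)
    then have "x \<in> carrier H" "y \<in> carrier H" using sub by blast+
    then show ?case using mult by (simp add: rules generated_subalgebra.mult)
  next
    case (smult x c)
    then have "x \<in> carrier H" using sub by blast
    then show ?case using smult by (simp add: rules generated_subalgebra.smult)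
  qed (rule \<Delta>)
  then show ?thesis
    unfolding right_coideal_subalgebras_def
    using subring_generated_subalgebra[OF S] by (auto intro: generated_subalgebra.smult)
qed

context
  fixes \<theta> assumes \<theta>: "\<theta> \<in> alg_hom H H"
begin

interpretation \<theta>: kalgebra_hom H H \<theta>
  by (intro kalgebra_homI kalgebra_axioms \<theta>)

lemma tensor_map_hom: "tensor_map H H \<theta> \<theta> \<in> alg_hom HH HH"
  unfolding tensor_map_def
  by (rule tensor_universal(1)[OF kalgebra_tensor])
     (simp_all add: pure_add_l pure_add_r pure_smult_l pure_smult_r pure_mult pure_one)

lemma tensor_map_pure:
  "x \<in> carrier H \<Longrightarrow> y \<in> carrier H \<Longrightarrow> tensor_map H H \<theta> \<theta> (x \<otimes>\<^sub>h y) = \<theta> x \<otimes>\<^sub>h \<theta> y"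
  unfolding tensor_map_def
  by (rule tensor_universal(2)[OF kalgebra_tensor])
     (simp_all add: pure_add_l pure_add_r pure_smult_l pure_smult_r pure_mult pure_one)

end

lemma hopf_automorphism_alg_hom: "\<theta> \<in> hopf_automorphisms H \<Longrightarrow> \<theta> \<in> alg_hom H H"
  by (simp add: hopf_automorphisms_def alg_hom_def)

lemma hopf_automorphism_surj: "\<theta> \<in> hopf_automorphisms H \<Longrightarrow> \<theta> ` carrier H = carrier H"
  by (simp add: hopf_automorphisms_def Bij_def bij_betw_def)

text \<open>The restriction is forced by \<open>Bij\<close>, whose members are extensional
  functions. The map induced on the tensor square is compared with the identity on pure
  tensors.\<close>

lemma identity_hopf_automorphism: "(\<lambda>x\<in>carrier H. x) \<in> hopf_automorphisms H"
proof -
  let ?\<theta> = "\<lambda>x\<in>carrier H. x"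
  have hom: "?\<theta> \<in> alg_hom H H" by (rule alg_homI) auto
  have id: "(\<lambda>z. z) \<in> alg_hom HH HH" by (rule alg_homI) auto
  have "tensor_map H H ?\<theta> ?\<theta> z = z" if "z \<in> carrier HH" for z
    by (rule tensor_hom_eq[OF kalgebra_tensor tensor_map_hom[OF hom] id _ that])
       (simp add: tensor_map_pure[OF hom])
  moreover have "?\<theta> \<in> Bij (carrier H)"
    by (auto simp: Bij_def bij_betw_def inj_on_def)
  ultimately show ?thesis
    using hom by (simp add: hopf_automorphisms_def alg_hom_def antipode_closed)
qed

text \<open>Each \<open>A s\<close> lies in its own orbit through the identity. If the orbits of
  \<open>A t\<close> and \<open>A s\<close> agree, some automorphism therefore carries
  \<open>A t\<close> onto \<open>A s\<close>, and the last assumption makes the parametrization of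
  orbits injective.\<close>

lemma infinite_orbits:
  fixes A :: "'t \<Rightarrow> 'h set"
  assumes "infinite (UNIV :: 't set)"
    and A: "\<And>t. A t \<in> right_coideal_subalgebras H"
    and inj: "\<And>\<theta> s t. \<theta> \<in> hopf_automorphisms H \<Longrightarrow> \<theta> ` A t = A s \<Longrightarrow> t = s"
  shows "infinite (right_coideal_subalgebra_orbits H)"
proof -
  let ?act = "\<lambda>\<theta>. \<lambda>X \<in> right_coideal_subalgebras H. \<theta> ` X"
  let ?orb = "\<lambda>t. orbit (hopf_automorphism_group H) ?act (A t)"
  have "inj ?orb"
  proof (rule injI)
    fix t s assume eq: "?orb t = ?orb s"
    have orb: "?orb r = {\<theta> ` A r | \<theta>. \<theta> \<in> hopf_automorphisms H}" for r
      using A by (simp add: orbit_def hopf_automorphism_group_def)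
    have "A s \<subseteq> carrier H"
      using A[of s] subringE(1) unfolding right_coideal_subalgebras_def by blast
    then have "(\<lambda>x\<in>carrier H. x) ` A s = A s" by (force simp: subset_iff image_iff)
    then have "A s \<in> ?orb s"
      unfolding orb using identity_hopf_automorphism by (intro CollectI exI conjI) (rule sym)
    then have "A s \<in> ?orb t" using eq by simp
    then obtain \<theta> where "\<theta> \<in> hopf_automorphisms H" "\<theta> ` A t = A s"
      unfolding orb by (elim CollectE exE conjE) simp
    then show "t = s" by (rule inj)
  qed
  then have "infinite (range ?orb)" using assms(1) by (simp add: finite_image_iff)
  moreover have "range ?orb \<subseteq> right_coideal_subalgebra_orbits H"
    using A by (auto simp: right_coideal_subalgebra_orbits_def orbits_def)
  ultimately show ?thesis using finite_subset by blast
qed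

end

section \<open>Convolution products of matrix coefficients\<close>

definition tensor_rep ::
    "('k::field, 'h, 'x) module_scheme \<Rightarrow> ('h \<Rightarrow> 'i \<Rightarrow> 'i \<Rightarrow> 'k) \<Rightarrow> ('h \<Rightarrow> 'j \<Rightarrow> 'j \<Rightarrow> 'k) \<Rightarrow>
      ('h \<times> 'h \<Rightarrow> 'k) set \<Rightarrow> 'i::finite \<times> 'j::finite \<Rightarrow> 'i \<times> 'j \<Rightarrow> 'k" where
  "tensor_rep H \<pi> \<pi>' = quotient_lift (linear_extension matrix_algebra (\<lambda>(x, y). kronecker (\<pi> x) (\<pi>' y)))"

context hopf_structure
begin

context
  fixes \<pi> :: "'h \<Rightarrow> 'i::finite \<Rightarrow> 'i \<Rightarrow> 'k" and \<pi>' :: "'h \<Rightarrow> 'j::finite \<Rightarrow> 'j \<Rightarrow> 'k"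
  assumes \<pi>: "\<pi> \<in> alg_hom H matrix_algebra" and \<pi>': "\<pi>' \<in> alg_hom H matrix_algebra"
begin

interpretation \<pi>: kalgebra_hom H matrix_algebra \<pi>
  by (intro kalgebra_homI kalgebra_axioms kalgebra_matrix \<pi>)

interpretation \<pi>': kalgebra_hom H matrix_algebra \<pi>'
  by (intro kalgebra_homI kalgebra_axioms kalgebra_matrix \<pi>')

lemma tensor_rep_hom: "tensor_rep H \<pi> \<pi>' \<in> alg_hom HH matrix_algebra"
  unfolding tensor_rep_def
  by (rule tensor_universal(1)[OF kalgebra_matrix])
     (simp_all add: kronecker_mult, auto simp: kronecker_def fun_eq_iff algebra_simps)

lemma tensor_rep_pure [simp]:
  "x \<in> carrier H \<Longrightarrow> y \<in> carrier H \<Longrightarrow> tensor_rep H \<pi> \<pi>' (x \<otimes>\<^sub>h y) = kronecker (\<pi> x) (\<pi>' y)"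
  unfolding tensor_rep_def
  by (rule tensor_universal(2)[OF kalgebra_matrix])
     (simp_all add: kronecker_mult, auto simp: kronecker_def fun_eq_iff algebra_simps)

lemma tensor_rep_add [simp]:
  assumes "s \<in> carrier HH" "t \<in> carrier HH"
  shows "tensor_rep H \<pi> \<pi>' (s \<oplus>\<^bsub>HH\<^esub> t) = (\<lambda>i j. tensor_rep H \<pi> \<pi>' s i j + tensor_rep H \<pi> \<pi>' t i j)"
proof -
  interpret kalgebra_hom HH matrix_algebra "tensor_rep H \<pi> \<pi>'"
    by (intro kalgebra_homI kalgebra_tensor kalgebra_matrix tensor_rep_hom)
  show ?thesis using assms by simp
qed

text \<open>This is the tensor product of two representations. Its matrix entries are the
  convolution products of the entries of \<open>\<pi>\<close> with those of \<open>\<pi>'\<close>,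
  so relations in the dual algebra become linear conditions on these matrices.\<close>

lemma convolution_hom: "(\<lambda>x. tensor_rep H \<pi> \<pi>' (comult H x)) \<in> alg_hom H matrix_algebra"
  using comult_alg_hom tensor_rep_hom by (rule alg_hom_comp)

end

text \<open>Because \<theta> respects the coproduct, precomposition with \<theta> respects
  convolution. Hence every relation between convolution products of coefficients of \<pi> is
  inherited by the coefficients of \<pi> composed with \<theta>; both descriptions of automorphisms
  below rest on this.\<close>

lemma convolution_automorphism:
  assumes \<theta>: "\<theta> \<in> hopf_automorphisms H" and x: "x \<in> carrier H"
    and \<pi>: "\<pi> \<in> alg_hom H matrix_algebra" and \<pi>': "\<pi>' \<in> alg_hom H matrix_algebra"
  shows "tensor_rep H \<pi> \<pi>' (comult H (\<theta> x)) = tensor_rep H (\<lambda>x. \<pi> (\<theta> x)) (\<lambda>x. \<pi>' (\<theta> x)) (comult H x)"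
proof -
  have hom: "\<theta> \<in> alg_hom H H" by (rule hopf_automorphism_alg_hom[OF \<theta>])
  interpret \<theta>: kalgebra_hom H H \<theta> by (intro kalgebra_homI kalgebra_axioms hom)
  have eq: "tensor_rep H \<pi> \<pi>' (tensor_map H H \<theta> \<theta> z) = tensor_rep H (\<lambda>x. \<pi> (\<theta> x)) (\<lambda>x. \<pi>' (\<theta> x)) z"
    if "z \<in> carrier HH" for z
  proof (rule tensor_hom_eq[OF kalgebra_matrix _ _ _ that])
    show "(\<lambda>z. tensor_rep H \<pi> \<pi>' (tensor_map H H \<theta> \<theta> z)) \<in> alg_hom HH matrix_algebra"
      by (rule alg_hom_comp[OF tensor_map_hom[OF hom] tensor_rep_hom[OF \<pi> \<pi>']])
    show "tensor_rep H (\<lambda>x. \<pi> (\<theta> x)) (\<lambda>x. \<pi>' (\<theta> x)) \<in> alg_hom HH matrix_algebra"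
      by (rule tensor_rep_hom[OF alg_hom_comp[OF hom \<pi>] alg_hom_comp[OF hom \<pi>']])
    show "tensor_rep H \<pi> \<pi>' (tensor_map H H \<theta> \<theta> (x \<otimes>\<^sub>h y)) =
        tensor_rep H (\<lambda>x. \<pi> (\<theta> x)) (\<lambda>x. \<pi>' (\<theta> x)) (x \<otimes>\<^sub>h y)"
      if "x \<in> carrier H" "y \<in> carrier H" for x y
      using that
      by (simp add: tensor_map_pure[OF hom] tensor_rep_pure[OF \<pi> \<pi>']
          tensor_rep_pure[OF alg_hom_comp[OF hom \<pi>] alg_hom_comp[OF hom \<pi>']])
  qed
  have "comult H (\<theta> x) = tensor_map H H \<theta> \<theta> (comult H x)"
    using \<theta> x by (simp add: hopf_automorphisms_def)
  then show ?thesis using x eq by simp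
qed

end

section \<open>Hopf algebras given by generators and relations\<close>

lemma presented_hopf_algebra_simps [simp]:
  "carrier (presented_hopf_algebra R \<delta> \<epsilon> \<sigma>) = carrier (presented_algebra R)"
  "mult (presented_hopf_algebra R \<delta> \<epsilon> \<sigma>) = mult (presented_algebra R)"
  "one (presented_hopf_algebra R \<delta> \<epsilon> \<sigma>) = one (presented_algebra R)"
  "zero (presented_hopf_algebra R \<delta> \<epsilon> \<sigma>) = zero (presented_algebra R)"
  "add (presented_hopf_algebra R \<delta> \<epsilon> \<sigma>) = add (presented_algebra R)"
  "smult (presented_hopf_algebra R \<delta> \<epsilon> \<sigma>) = smult (presented_algebra R)"
  "comult (presented_hopf_algebra R \<delta> \<epsilon> \<sigma>) =
    quotient_lift (free_extension (tensor_algebra (presented_algebra R) (presented_algebra R)) \<delta>)"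
  "counit (presented_hopf_algebra R \<delta> \<epsilon> \<sigma>) = quotient_lift (free_extension ground_algebra \<epsilon>)"
  "antipode (presented_hopf_algebra R \<delta> \<epsilon> \<sigma>) =
    quotient_lift (free_extension (opposite_algebra (presented_algebra R)) \<sigma>)"
  by (simp_all add: presented_hopf_algebra_def module.extend_def hopf.fields_def Let_def)

lemma alg_hom_presented_hopf [simp]:
  "alg_hom (presented_hopf_algebra R \<delta> \<epsilon> \<sigma>) B = alg_hom (presented_algebra R) B"
  by (simp add: alg_hom_def ring_hom_def)

text \<open>The Hopf algebra extends the record of the presented algebra and so has another type;
  rules like this one carry over results proved for the underlying algebra.\<close>

lemma generated_presented_hopf [simp]:
  "generated_subalgebra (presented_hopf_algebra R \<delta> \<epsilon> \<sigma>) S = generated_subalgebra (presented_algebra R) S"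
    (is "generated_subalgebra ?H S = generated_subalgebra ?P S")
proof (intro equalityI subsetI)
  fix x
  show "x \<in> generated_subalgebra ?P S" if "x \<in> generated_subalgebra ?H S"
    using that by induction (simp_all add: generated_subalgebra.intros)
  note intros = generated_subalgebra.intros[where A = ?H, simplified]
  show "x \<in> generated_subalgebra ?H S" if "x \<in> generated_subalgebra ?P S"
    using that by induction (simp_all add: intros)
qed

lemma tensor_presented_hopf [simp]:
  "tensor_algebra (presented_hopf_algebra R \<delta> \<epsilon> \<sigma>) (presented_hopf_algebra R \<delta> \<epsilon> \<sigma>) =
    tensor_algebra (presented_algebra R) (presented_algebra R)"
  "pure_tensor (presented_hopf_algebra R \<delta> \<epsilon> \<sigma>) (presented_hopf_algebra R \<delta> \<epsilon> \<sigma>) =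
    pure_tensor (presented_algebra R) (presented_algebra R)"
  by (simp_all add: tensor_algebra_def tensor_ideal_def bilinearity_relations_def pure_tensor_def[abs_def]
      DirProd_def)

text \<open>The assumptions on \<delta> and \<sigma> are what the universal property asks for: the
  images of the generators satisfy the relations in the tensor square and in the opposite algebra,
  respectively.\<close>

locale hopf_presentation = presentation R
  for R :: "('g list \<Rightarrow> 'k::field) set" +
  fixes \<delta> :: "'g \<Rightarrow> (('g list \<Rightarrow> 'k) set \<times> ('g list \<Rightarrow> 'k) set \<Rightarrow> 'k) set"
    and \<epsilon> :: "'g \<Rightarrow> 'k" and \<sigma> :: "'g \<Rightarrow> ('g list \<Rightarrow> 'k) set"
  assumes \<delta>_closed: "\<And>g. \<delta> g \<in> carrier (tensor_algebra P P)"
    and \<delta>_relators: "free_extension (tensor_algebra P P) \<delta> ` R \<subseteq> {\<zero>\<^bsub>tensor_algebra P P\<^esub>}"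
    and \<sigma>_closed: "\<And>g. \<sigma> g \<in> carrier P"
    and \<sigma>_relators: "free_extension (opposite_algebra P) \<sigma> ` R \<subseteq> {\<zero>\<^bsub>P\<^esub>}"
begin

abbreviation H where "H \<equiv> presented_hopf_algebra R \<delta> \<epsilon> \<sigma>"

lemma kalgebra_H: "kalgebra H"
  by (rule kalgebra.kalgebra_image[OF kalgebra_presented, where f = "\<lambda>x. x"]) simp_all

sublocale P: kalgebra P by (rule kalgebra_presented)
sublocale PP: tensor_product P P by (simp add: tensor_product_def kalgebra_presented)

sublocale Hopf: hopf_structure H
proof (intro hopf_structure.intro kalgebra_H hopf_structure_axioms.intro)
  show "comult H \<in> alg_hom H (tensor_algebra H H)"
    using presented_lift_alg_hom[OF PP.kalgebra_tensor \<delta>_closed \<delta>_relators] by simp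
  fix x assume "x \<in> carrier H"
  then show "antipode H x \<in> carrier H"
    using presented_lift_alg_hom[OF P.kalgebra_opposite, of \<sigma>] \<sigma>_closed \<sigma>_relators
    by (auto simp: alg_hom_def ring_hom_def)
qed

lemma comult_generator: "comult H (presented_generator R g) = \<delta> g"
  using presented_lift_generator[OF PP.kalgebra_tensor \<delta>_closed \<delta>_relators] by simp

end

section \<open>Primitive roots of unity of odd order\<close>

lemma primitive_root_nonzero:
  fixes q :: "'k::field" assumes "primitive_root_of_unity N q" "N > 0" shows "q \<noteq> 0"
  using assms by (auto simp: primitive_root_of_unity_def power_0_left)

text \<open>If q^(2m) = 1 with 0 < m < N, then 2m is below \<open>N\<close>, or equal to
  \<open>N\<close>, or lies strictly between \<open>N\<close> and 2N. The first and the last case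
  contradict primitivity (after subtracting \<open>N\<close> in the last), and the middle one
  contradicts oddness.\<close>

lemma primitive_root_square:
  fixes q :: "'k::field" assumes q: "primitive_root_of_unity N q" and N: "N > 0" "odd N"
  shows "primitive_root_of_unity N (q ^ 2)"
proof -
  have "q ^ (2 * m) \<noteq> 1" if "0 < m" "m < N" for m
  proof
    assume 1: "q ^ (2 * m) = 1"
    show False
    proof (cases "2 * m < N")
      case True
      then show False using q that 1 by (auto simp: primitive_root_of_unity_def)
    next
      case False
      moreover have "2 * m \<noteq> N" using N by auto
      ultimately obtain r where r: "2 * m = N + r" "0 < r" using le_Suc_ex[of N "2 * m"] by auto
      then have "q ^ r = 1" using 1 q by (simp add: power_add primitive_root_of_unity_def)
      moreover have "r < N" using r that by auto
      ultimately show False using q r by (auto simp: primitive_root_of_unity_def)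
    qed
  qed
  moreover have "(q ^ 2) ^ N = 1"
    using q by (simp add: primitive_root_of_unity_def flip: power_mult) (simp add: mult.commute power_mult)
  ultimately show ?thesis by (auto simp: primitive_root_of_unity_def simp flip: power_mult)
qed

lemma primitive_root_inverse:
  fixes q :: "'k::field" assumes "primitive_root_of_unity N q"
  shows "primitive_root_of_unity N (1 / q)"
  using assms by (auto simp: primitive_root_of_unity_def power_one_over)

lemma primitive_root_power_neq:
  fixes q :: "'k::field" assumes "primitive_root_of_unity N q" "N > 1" "odd N"
  shows "q \<noteq> 1" "q ^ 2 \<noteq> 1" "q ^ 4 \<noteq> 1" "q \<noteq> - 1"
proof -
  have N: "N > 0" using assms(2) by simp
  note r = primitive_root_square[OF assms(1) N assms(3)]
    primitive_root_square[OF primitive_root_square[OF assms(1) N assms(3)] N assms(3)]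
  have "w \<noteq> 1" if "primitive_root_of_unity N w" for w :: 'k
    using that assms(2) by (auto simp: primitive_root_of_unity_def dest: spec[of _ 1])
  from this[OF assms(1)] this[OF r(1)] this[OF r(2)]
  show "q \<noteq> 1" "q ^ 2 \<noteq> 1" "q ^ 4 \<noteq> 1" "q \<noteq> - 1"
    by (auto simp flip: power_mult)
qed

section \<open>The small quantum group\<close>

text \<open>The relators rewritten as equations, over an arbitrary record scheme: the same predicate
  is used for the presented algebra, its opposite, its tensor square, the Hopf algebra and the
  matrix algebra.\<close>

definition U_relations_hold ::
    "('k::field, 'a, 'x) module_scheme \<Rightarrow> nat \<Rightarrow> 'k \<Rightarrow> 'a \<Rightarrow> 'a \<Rightarrow> 'a \<Rightarrow> bool" where
  "U_relations_hold A N q K E F \<longleftrightarrow>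
     K [^]\<^bsub>A\<^esub> N = \<one>\<^bsub>A\<^esub> \<and>
     K \<otimes>\<^bsub>A\<^esub> E = q^2 \<odot>\<^bsub>A\<^esub> (E \<otimes>\<^bsub>A\<^esub> K) \<and>
     K \<otimes>\<^bsub>A\<^esub> F = (1 / q^2) \<odot>\<^bsub>A\<^esub> (F \<otimes>\<^bsub>A\<^esub> K) \<and>
     E [^]\<^bsub>A\<^esub> N = \<zero>\<^bsub>A\<^esub> \<and>
     F [^]\<^bsub>A\<^esub> N = \<zero>\<^bsub>A\<^esub> \<and>
     (E \<otimes>\<^bsub>A\<^esub> F) \<ominus>\<^bsub>A\<^esub> (F \<otimes>\<^bsub>A\<^esub> E) =
       (1 / (q - 1 / q)) \<odot>\<^bsub>A\<^esub> (K \<ominus>\<^bsub>A\<^esub> (K [^]\<^bsub>A\<^esub> (N - 1)))"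

lemma U_relators_iff:
  fixes B :: "('k::field, 'b) module"
  assumes "kalgebra B" "K \<in> carrier B" "E \<in> carrier B" "F \<in> carrier B"
  shows "U_relators B N q K E F \<subseteq> {\<zero>\<^bsub>B\<^esub>} \<longleftrightarrow> U_relations_hold B N q K E F"
proof -
  interpret B: kalgebra B by fact
  show ?thesis
    unfolding U_relators_def U_relations_hold_def
    using assms(2-4) by (simp add: B.diff_eq_zero_iff)
qed

lemma U_relators_closed:
  fixes A :: "('k::field, 'a) module"
  assumes "kalgebra A" "K \<in> carrier A" "E \<in> carrier A" "F \<in> carrier A"
  shows "U_relators A N q K E F \<subseteq> carrier A"
proof -
  interpret kalgebra A by fact
  show ?thesis
    unfolding U_relators_def using assms(2-4) by (auto simp del: monoid_algebra_simps)
qed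

lemma U_relators_image:
  fixes A :: "('k::field, 'a) module" and B :: "('k, 'b) module"
  assumes "kalgebra A" "kalgebra B" "f \<in> alg_hom A B" "K \<in> carrier A" "E \<in> carrier A" "F \<in> carrier A"
  shows "f ` U_relators A N q K E F = U_relators B N q (f K) (f E) (f F)"
proof -
  interpret f: kalgebra_hom A B f using assms by (intro kalgebra_homI)
  show ?thesis
    unfolding U_relators_def using assms(4-6) by simp
qed

locale U_presentation =
  fixes N :: nat and q :: "'k::field"
begin

sublocale presentation "U_relations N q"
  by unfold_locales (simp only: U_relations_def U_relators_closed kalgebra_free_algebra free_generator_closed)

abbreviation "gen \<equiv> presented_generator (U_relations N q)"

lemma free_extension_relations:
  fixes B :: "('k, 'b) module"
  assumes B: "kalgebra B" and \<gamma>: "\<And>g. \<gamma> g \<in> carrier B"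
  shows "free_extension B \<gamma> ` U_relations N q \<subseteq> {\<zero>\<^bsub>B\<^esub>} \<longleftrightarrow>
    U_relations_hold B N q (\<gamma> U_K) (\<gamma> U_E) (\<gamma> U_F)"
  unfolding U_relations_def
  by (simp only: U_relators_image[OF kalgebra_free_algebra B kalgebra.free_extension_alg_hom[OF B \<gamma>]]
      free_generator_closed kalgebra.free_extension_generator[OF B \<gamma>] U_relators_iff[OF B] \<gamma>)

lemma relations_hold: "U_relations_hold P N q (gen U_K) (gen U_E) (gen U_F)"
proof -
  have "(\<lambda>x. Idl\<^bsub>free_algebra\<^esub> (U_relations N q) +>\<^bsub>free_algebra\<^esub> x) ` U_relations N q \<subseteq> {\<zero>\<^bsub>P\<^esub>}"
    using projection_relator by blast
  then have "U_relators P N q (gen U_K) (gen U_E) (gen U_F) \<subseteq> {\<zero>\<^bsub>P\<^esub>}"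
    unfolding presented_generator_def
    by (subst (asm) (2) U_relations_def)
       (simp only: U_relators_image[OF kalgebra_free_algebra kalgebra_presented projection_alg_hom]
          free_generator_closed)
  then show ?thesis
    by (simp only: U_relators_iff[OF kalgebra_presented] presented_generator_closed)
qed

end

text \<open>The compatibility of coproduct and antipode with the relations is a computation that
  uses nothing about the algebra beyond the relations, so it is carried out for any three elements
  satisfying them.\<close>

locale U_triple = kalgebra A for A :: "('k::field, 'a, 'x) module_scheme" (structure) +
  fixes N :: nat and q :: 'k and K E F
  assumes N: "N > 1" "odd N" and q: "primitive_root_of_unity N q"
    and K [simp, intro]: "K \<in> carrier A" and E [simp, intro]: "E \<in> carrier A" and F [simp, intro]: "F \<in> carrier A"
    and relations: "U_relations_hold A N q K E F"
begin

definition K' where "K' = K [^] (N - 1)"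

lemma K' [simp, intro]: "K' \<in> carrier A" by (simp add: K'_def)

lemma q_nonzero [simp]: "q \<noteq> 0" using primitive_root_nonzero[OF q] N by simp

lemma K_pow: "K [^] N = \<one>" and E_pow: "E [^] N = \<zero>" and F_pow: "F [^] N = \<zero>"
  and KE: "K \<otimes> E = q^2 \<odot> (E \<otimes> K)" and KF: "K \<otimes> F = (1 / q^2) \<odot> (F \<otimes> K)"
  and EF: "E \<otimes> F \<ominus> F \<otimes> E = (1 / (q - 1 / q)) \<odot> (K \<ominus> K')"
  using relations by (simp_all add: U_relations_hold_def K'_def)

lemma KK' [simp]: "K \<otimes> K' = \<one>"
proof -
  have "N = Suc (N - 1)" using N by simp
  then show ?thesis using K_pow nat_pow_Suc2[OF K, of "N - 1"] by (simp add: K'_def del: nat_pow_Suc)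
qed

lemma K'K [simp]: "K' \<otimes> K = \<one>"
proof -
  have "N = Suc (N - 1)" using N by simp
  then show ?thesis using K_pow nat_pow_Suc[of K "N - 1"] by (simp add: K'_def del: nat_pow_Suc)
qed

lemma KK'_left [simp]: "x \<in> carrier A \<Longrightarrow> K \<otimes> (K' \<otimes> x) = x" "x \<in> carrier A \<Longrightarrow> K' \<otimes> (K \<otimes> x) = x"
  by (simp_all flip: m_assoc)

lemma EK': "E \<otimes> K' = q^2 \<odot> (K' \<otimes> E)"
proof -
  have "E \<otimes> K' = K' \<otimes> (K \<otimes> E) \<otimes> K'" by simp
  also have "\<dots> = q^2 \<odot> (K' \<otimes> (E \<otimes> (K \<otimes> K')))"
    by (simp add: KE smult_mult_l smult_mult_r m_assoc del: KK' KK'_left)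
  finally show ?thesis by simp
qed

lemma FK': "F \<otimes> K' = (1 / q^2) \<odot> (K' \<otimes> F)"
proof -
  have "F \<otimes> K' = K' \<otimes> (K \<otimes> F) \<otimes> K'" by simp
  also have "\<dots> = (1 / q^2) \<odot> (K' \<otimes> (F \<otimes> (K \<otimes> K')))"
    by (simp add: KF smult_mult_l smult_mult_r m_assoc del: KK' KK'_left)
  finally show ?thesis by simp
qed

lemma smult_inverse: "x \<in> carrier A \<Longrightarrow> y = c \<odot> x \<Longrightarrow> c \<noteq> 0 \<Longrightarrow> x = (1 / c) \<odot> y"
  by (simp flip: smult_assoc)

lemma K'E: "K' \<otimes> E = (1 / q^2) \<odot> (E \<otimes> K')"
  using smult_inverse[OF _ EK'] by simp

lemma FK: "F \<otimes> K = q^2 \<odot> (K \<otimes> F)"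
  using smult_inverse[OF _ KF] by simp

lemma EF': "E \<otimes> F = F \<otimes> E \<oplus> ((1 / (q - 1 / q)) \<odot> K \<oplus> (- (1 / (q - 1 / q))) \<odot> K')"
proof -
  have "E \<otimes> F = F \<otimes> E \<oplus> (E \<otimes> F \<ominus> F \<otimes> E)"
    by (simp add: add_diff_self)
  also have "E \<otimes> F \<ominus> F \<otimes> E = (1 / (q - 1 / q)) \<odot> K \<oplus> (- (1 / (q - 1 / q))) \<odot> K'"
    unfolding EF by (simp add: a_minus_def smult_r_distr smult_minus_l smult_minus_r)
  finally show ?thesis .
qed

lemma primitive_roots: "primitive_root_of_unity N (q^2)" "primitive_root_of_unity N (1 / q^2)"
  using primitive_root_square[OF q] primitive_root_inverse N by auto

lemma antipode_relations:
  "U_relations_hold (opposite_algebra A) N q K' (\<ominus> (E \<otimes> K')) (\<ominus> (K \<otimes> F))"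
proof -
  interpret op: kalgebra "opposite_algebra A" by (rule kalgebra_opposite)
  let ?c = "1 / (q - 1 / q)"
  have inv: "\<ominus>\<^bsub>opposite_algebra A\<^esub> x = \<ominus> x" if "x \<in> carrier A" for x
    using op.minus_conv_smult[of x] that by (simp add: minus_conv_smult)
  have K'pow: "K' [^] n = K [^] ((N - 1) * n)" for n :: nat by (simp add: K'_def nat_pow_pow)
  have "K' [^] N = \<one>" using K_pow by (simp add: K'pow mult.commute flip: nat_pow_pow)
  moreover have "K' [^] (N - 1) = K"
  proof -
    obtain m where m: "N = Suc (Suc m)" using N that[of "N - 2"] by simp
    \<comment> \<open>With N = m + 2 this says that (N - 1)^2 is 1 modulo \<open>N\<close>, so that
      the inverse of the inverse of \<open>K\<close> is \<open>K\<close> again, also when inverses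
      are written as powers.\<close>
    have *: "(N - 1) * (N - 1) = Suc (N * m)" by (simp add: m)
    have "K' [^] (N - 1) = (K [^] N) [^] m \<otimes> K" unfolding K'pow * by (simp add: nat_pow_pow)
    then show ?thesis by (simp add: K_pow)
  qed
  moreover have "E \<otimes> K' \<otimes> K' = q^2 \<odot> (K' \<otimes> (E \<otimes> K'))"
    by (simp add: EK' smult_mult_l m_assoc)
  moreover have "K \<otimes> F \<otimes> K' = (1 / q^2) \<odot> (K' \<otimes> (K \<otimes> F))"
    by (simp add: m_assoc FK' smult_mult_r)
  moreover have "(E \<otimes> K') [^] N = \<zero>"
    using q_commute_mult_pow[OF K' E K'E, of N] by (auto simp: E_pow)
  moreover have "(K \<otimes> F) [^] N = \<zero>"
    using q_commute_mult_pow[OF F K FK, of N] by (auto simp: F_pow)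
  \<comment> \<open>The factors 1/q^2 and q^2 from moving \<open>K\<close> past \<open>F\<close> and
    past \<open>E\<close> cancel.\<close>
  moreover have "K \<otimes> F \<otimes> (E \<otimes> K') = F \<otimes> E"
  proof -
    have "K \<otimes> F \<otimes> (E \<otimes> K') = (1 / q^2) \<odot> (F \<otimes> ((K \<otimes> E) \<otimes> K'))"
      by (simp add: KF smult_mult_l m_assoc)
    also have "\<dots> = F \<otimes> (E \<otimes> (K \<otimes> K'))"
      by (simp add: KE smult_mult_l smult_mult_r m_assoc flip: smult_assoc)
    finally show ?thesis by simp
  qed
  moreover have "E \<otimes> K' \<otimes> (K \<otimes> F) = E \<otimes> F" by (simp add: m_assoc)
  moreover have "F \<otimes> E \<ominus> E \<otimes> F = (1 / (q - 1 / q)) \<odot> (K' \<ominus> K)"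
  proof (rule diff_eqI)
    \<comment> \<open>Two zero terms are inserted so that \<open>E \<otimes> F\<close>, expanded by
      \<open>EF'\<close>, can be recognized.\<close>
    have "F \<otimes> E = F \<otimes> E \<oplus> (?c \<odot> K \<oplus> \<ominus> (?c \<odot> K)) \<oplus> (?c \<odot> K' \<oplus> \<ominus> (?c \<odot> K'))" by (simp add: r_neg)
    also have "\<dots> = E \<otimes> F \<oplus> ?c \<odot> (K' \<ominus> K)"
      by (simp add: EF' smult_diff smult_minus_l a_ac) (simp add: a_minus_def a_ac)
    finally show "F \<otimes> E = E \<otimes> F \<oplus> ?c \<odot> (K' \<ominus> K)" .
  qed auto
  ultimately show ?thesis
    unfolding U_relations_hold_def
    by (simp add: opposite_pow opposite_minus inv minus_conv_smult smult_pow smult_mult_l smult_mult_r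
        mult.commute flip: smult_assoc)
qed

text \<open>For the nilpotency relations the two summands of the coproduct commute up to a primitive
  \<open>N\<close>-th root of unity, so the q-binomial formula leaves only their \<open>N\<close>-th
  powers. In the commutator of \<open>E\<close> and \<open>F\<close> the mixed terms agree.\<close>

lemma comult_relations:
  defines "T \<equiv> tensor_algebra A A" and "t \<equiv> pure_tensor A A"
  shows "U_relations_hold T N q (t K K) (t E K \<oplus>\<^bsub>T\<^esub> t \<one> E) (t F \<one> \<oplus>\<^bsub>T\<^esub> t K' F)"
proof -
  interpret tensor_product A A by (simp add: tensor_product_def kalgebra_axioms)
  let ?c = "1 / (q - 1 / q)"
  note [simp] = T_def t_def
  note tensor = pure_mult pure_add_l pure_add_r pure_smult_l pure_smult_r pure_pow T.l_distr T.r_distr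
    T.smult_r_distr
  have "(t K K) [^]\<^bsub>T\<^esub> N = \<one>\<^bsub>T\<^esub>"
    by (simp add: pure_pow K_pow pure_one)
  moreover have "t K K \<otimes>\<^bsub>T\<^esub> (t E K \<oplus>\<^bsub>T\<^esub> t \<one> E) = q^2 \<odot>\<^bsub>T\<^esub> ((t E K \<oplus>\<^bsub>T\<^esub> t \<one> E) \<otimes>\<^bsub>T\<^esub> t K K)"
    by (simp add: tensor KE)
  moreover have "t K K \<otimes>\<^bsub>T\<^esub> (t F \<one> \<oplus>\<^bsub>T\<^esub> t K' F) = (1 / q^2) \<odot>\<^bsub>T\<^esub> ((t F \<one> \<oplus>\<^bsub>T\<^esub> t K' F) \<otimes>\<^bsub>T\<^esub> t K K)"
    by (simp add: tensor KF)
  moreover have "(t E K \<oplus>\<^bsub>T\<^esub> t \<one> E) [^]\<^bsub>T\<^esub> N = \<zero>\<^bsub>T\<^esub>"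
  proof -
    have "t E K \<otimes>\<^bsub>T\<^esub> t \<one> E = q^2 \<odot>\<^bsub>T\<^esub> (t \<one> E \<otimes>\<^bsub>T\<^esub> t E K)" by (simp add: tensor KE)
    then have "(t E K \<oplus>\<^bsub>T\<^esub> t \<one> E) [^]\<^bsub>T\<^esub> N = t E K [^]\<^bsub>T\<^esub> N \<oplus>\<^bsub>T\<^esub> t \<one> E [^]\<^bsub>T\<^esub> N"
      using N primitive_roots by (intro T.q_binomial_root_of_unity[where w = "q^2", folded T_def]) auto
    then show ?thesis by (simp add: pure_pow K_pow E_pow)
  qed
  moreover have "(t F \<one> \<oplus>\<^bsub>T\<^esub> t K' F) [^]\<^bsub>T\<^esub> N = \<zero>\<^bsub>T\<^esub>"
  proof -
    have "t F \<one> \<otimes>\<^bsub>T\<^esub> t K' F = (1 / q^2) \<odot>\<^bsub>T\<^esub> (t K' F \<otimes>\<^bsub>T\<^esub> t F \<one>)" by (simp add: tensor FK')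
    then have "(t F \<one> \<oplus>\<^bsub>T\<^esub> t K' F) [^]\<^bsub>T\<^esub> N = t F \<one> [^]\<^bsub>T\<^esub> N \<oplus>\<^bsub>T\<^esub> t K' F [^]\<^bsub>T\<^esub> N"
      using N primitive_roots by (intro T.q_binomial_root_of_unity[where w = "1 / q^2", folded T_def]) auto
    then show ?thesis by (simp add: pure_pow F_pow)
  qed
  moreover have "(t E K \<oplus>\<^bsub>T\<^esub> t \<one> E) \<otimes>\<^bsub>T\<^esub> (t F \<one> \<oplus>\<^bsub>T\<^esub> t K' F) \<ominus>\<^bsub>T\<^esub>
      (t F \<one> \<oplus>\<^bsub>T\<^esub> t K' F) \<otimes>\<^bsub>T\<^esub> (t E K \<oplus>\<^bsub>T\<^esub> t \<one> E) =
      ?c \<odot>\<^bsub>T\<^esub> (t K K \<ominus>\<^bsub>T\<^esub> t K K [^]\<^bsub>T\<^esub> (N - 1))"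
  proof -
    have X: "(t E K \<oplus>\<^bsub>T\<^esub> t \<one> E) \<otimes>\<^bsub>T\<^esub> (t F \<one> \<oplus>\<^bsub>T\<^esub> t K' F) =
        (t (E \<otimes> F) K \<oplus>\<^bsub>T\<^esub> t F E) \<oplus>\<^bsub>T\<^esub> (t (E \<otimes> K') (K \<otimes> F) \<oplus>\<^bsub>T\<^esub> t K' (E \<otimes> F))"
      by (simp add: tensor)
    have Y: "(t F \<one> \<oplus>\<^bsub>T\<^esub> t K' F) \<otimes>\<^bsub>T\<^esub> (t E K \<oplus>\<^bsub>T\<^esub> t \<one> E) =
        (t (F \<otimes> E) K \<oplus>\<^bsub>T\<^esub> t F E) \<oplus>\<^bsub>T\<^esub> (t (K' \<otimes> E) (F \<otimes> K) \<oplus>\<^bsub>T\<^esub> t K' (F \<otimes> E))"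
      by (simp add: tensor T.a_ac)
    have mid: "t (E \<otimes> K') (K \<otimes> F) = t (K' \<otimes> E) (F \<otimes> K)"
      by (simp add: EK' KF tensor flip: T.smult_assoc)
    have Z: "t K K [^]\<^bsub>T\<^esub> (N - 1) = t K' K'" by (simp add: pure_pow K'_def)
    have l: "t (E \<otimes> F) K = t (F \<otimes> E) K \<oplus>\<^bsub>T\<^esub> (?c \<odot>\<^bsub>T\<^esub> t K K \<oplus>\<^bsub>T\<^esub> (- ?c) \<odot>\<^bsub>T\<^esub> t K' K)"
      and r: "t K' (E \<otimes> F) = t K' (F \<otimes> E) \<oplus>\<^bsub>T\<^esub> (?c \<odot>\<^bsub>T\<^esub> t K' K \<oplus>\<^bsub>T\<^esub> (- ?c) \<odot>\<^bsub>T\<^esub> t K' K')"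
      by (simp_all only: EF' t_def T_def pure_add_l pure_add_r pure_smult_l pure_smult_r
          K E F K' m_closed smult_closed add.m_closed)
    have W: "?c \<odot>\<^bsub>T\<^esub> (t K K \<ominus>\<^bsub>T\<^esub> t K' K') = ?c \<odot>\<^bsub>T\<^esub> t K K \<oplus>\<^bsub>T\<^esub> (- ?c) \<odot>\<^bsub>T\<^esub> t K' K'"
      by (simp add: a_minus_def T.smult_r_distr T.smult_minus_l T.smult_minus_r)
    \<comment> \<open>Here \<open>z\<close> stands for the tensor of \<open>K'\<close> and
      \<open>K\<close>: it enters from \<open>[E, F] \<otimes> K\<close> and from
      \<open>K' \<otimes> [E, F]\<close> with opposite signs.\<close>
    have cancel: "(p1 \<oplus>\<^bsub>T\<^esub> (x \<oplus>\<^bsub>T\<^esub> (- ?c) \<odot>\<^bsub>T\<^esub> z) \<oplus>\<^bsub>T\<^esub> p2) \<oplus>\<^bsub>T\<^esub> (p3 \<oplus>\<^bsub>T\<^esub> (p4 \<oplus>\<^bsub>T\<^esub> (?c \<odot>\<^bsub>T\<^esub> z \<oplus>\<^bsub>T\<^esub> y))) =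
        ((p1 \<oplus>\<^bsub>T\<^esub> p2) \<oplus>\<^bsub>T\<^esub> (p3 \<oplus>\<^bsub>T\<^esub> p4)) \<oplus>\<^bsub>T\<^esub> (x \<oplus>\<^bsub>T\<^esub> y)"
      if "p1 \<in> carrier T" "p2 \<in> carrier T" "p3 \<in> carrier T" "p4 \<in> carrier T"
        "x \<in> carrier T" "y \<in> carrier T" "z \<in> carrier T" for p1 p2 p3 p4 x y z
    proof -
      have "(p1 \<oplus>\<^bsub>T\<^esub> (x \<oplus>\<^bsub>T\<^esub> (- ?c) \<odot>\<^bsub>T\<^esub> z) \<oplus>\<^bsub>T\<^esub> p2) \<oplus>\<^bsub>T\<^esub> (p3 \<oplus>\<^bsub>T\<^esub> (p4 \<oplus>\<^bsub>T\<^esub> (?c \<odot>\<^bsub>T\<^esub> z \<oplus>\<^bsub>T\<^esub> y))) =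
          (((p1 \<oplus>\<^bsub>T\<^esub> p2) \<oplus>\<^bsub>T\<^esub> (p3 \<oplus>\<^bsub>T\<^esub> p4)) \<oplus>\<^bsub>T\<^esub> (x \<oplus>\<^bsub>T\<^esub> y)) \<oplus>\<^bsub>T\<^esub> ((- ?c) \<odot>\<^bsub>T\<^esub> z \<oplus>\<^bsub>T\<^esub> ?c \<odot>\<^bsub>T\<^esub> z)"
        using that by (simp add: T.a_ac)
      also have "(- ?c) \<odot>\<^bsub>T\<^esub> z \<oplus>\<^bsub>T\<^esub> ?c \<odot>\<^bsub>T\<^esub> z = \<zero>\<^bsub>T\<^esub>"
        using that T.smult_l_distr[of z "- ?c" ?c] by simp
      finally show ?thesis using that by simp
    qed
    show ?thesis
      unfolding X Y Z W mid l r
      by (rule T.diff_eqI[folded T_def], rule cancel) simp_all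
  qed
  ultimately show ?thesis
    unfolding U_relations_hold_def by blast
qed

end

section \<open>The two-dimensional representation of the small quantum group\<close>

lemma common_eigenvector_mult:
  fixes M N :: "'i::finite \<Rightarrow> 'i \<Rightarrow> 'k::field"
  assumes "\<exists>\<mu>. \<forall>i. (\<Sum>j\<in>UNIV. M i j * v j) = \<mu> * v i" "\<exists>\<mu>. \<forall>i. (\<Sum>j\<in>UNIV. N i j * v j) = \<mu> * v i"
  shows "\<exists>\<mu>. \<forall>i. (\<Sum>j\<in>UNIV. (\<Sum>k\<in>UNIV. M i k * N k j) * v j) = \<mu> * v i"
proof -
  obtain m n where m: "(\<Sum>j\<in>UNIV. M i j * v j) = m * v i" and n: "(\<Sum>j\<in>UNIV. N i j * v j) = n * v i" for i
    using assms by blast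
  have "(\<Sum>j\<in>UNIV. (\<Sum>k\<in>UNIV. M i k * N k j) * v j) = (n * m) * v i" for i
  proof -
    have "(\<Sum>j\<in>UNIV. (\<Sum>k\<in>UNIV. M i k * N k j) * v j) = (\<Sum>k\<in>UNIV. M i k * (\<Sum>j\<in>UNIV. N k j * v j))"
      unfolding sum_distrib_left sum_distrib_right by (subst sum.swap) (simp add: mult.assoc)
    also have "\<dots> = n * (\<Sum>k\<in>UNIV. M i k * v k)" by (simp only: n) (simp add: sum_distrib_left mult_ac)
    finally show ?thesis by (simp only: m mult.assoc)
  qed
  then show ?thesis by blast
qed

text \<open>The index \<open>False\<close> is the highest weight vector, of weight q, and
  \<open>True\<close> the lowest, of weight 1/q; thus \<open>E\<close> occupies the upper right
  corner.\<close>

definition U_rep_K :: "'k::field \<Rightarrow> bool \<Rightarrow> bool \<Rightarrow> 'k" where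
  "U_rep_K q i j = (if i = j then if i then 1 / q else q else 0)"

definition U_rep_E :: "bool \<Rightarrow> bool \<Rightarrow> 'k::field" where
  "U_rep_E i j = (if \<not> i \<and> j then 1 else 0)"

definition U_rep_F :: "bool \<Rightarrow> bool \<Rightarrow> 'k::field" where
  "U_rep_F i j = (if i \<and> \<not> j then 1 else 0)"

lemma U_rep_K_pow: "U_rep_K q [^]\<^bsub>matrix_algebra\<^esub> n = U_rep_K (q ^ n)"
proof -
  interpret kalgebra matrix_algebra by (rule kalgebra_matrix)
  show ?thesis
    by (induction n) (auto simp: U_rep_K_def fun_eq_iff UNIV_bool power_one_over)
qed

lemma U_rep_relations:
  fixes q :: "'k::field"
  assumes q: "primitive_root_of_unity N q" and N: "N > 1" "odd N"
  shows "U_relations_hold matrix_algebra N q (U_rep_K q) U_rep_E U_rep_F"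
proof -
  interpret kalgebra "matrix_algebra :: ('k, bool \<Rightarrow> bool \<Rightarrow> 'k) module" by (rule kalgebra_matrix)
  have q0: "q \<noteq> 0" using primitive_root_nonzero[OF q] N by simp
  have q2: "q * q \<noteq> 1" using primitive_root_power_neq[OF q N] by (simp add: power2_eq_square)
  have "q * q ^ (N - 1) = q ^ N" using N by (simp flip: power_Suc)
  then have qN: "q ^ (N - 1) = 1 / q" and qN1: "q ^ N = 1"
    using q q0 by (simp_all add: primitive_root_of_unity_def field_simps)
  have "U_rep_E [^]\<^bsub>matrix_algebra\<^esub> N = (\<lambda>i j. 0 :: 'k)" "U_rep_F [^]\<^bsub>matrix_algebra\<^esub> N = (\<lambda>i j. 0 :: 'k)"
    using N by (simp_all add: nilpotent_pow[simplified] U_rep_E_def U_rep_F_def UNIV_bool)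
  then show ?thesis
    unfolding U_relations_hold_def U_rep_K_pow qN qN1
    using q0 q2
    by (auto simp: U_rep_K_def U_rep_E_def U_rep_F_def fun_eq_iff UNIV_bool field_simps power2_eq_square)
qed

locale U_hopf = hopf_structure H + U_triple H N q K E F
  for H :: "('k::field, 'h) hopf" (structure) and N q K E F +
  fixes \<rho> :: "'h \<Rightarrow> bool \<Rightarrow> bool \<Rightarrow> 'k"
  assumes generated: "carrier H = generated_subalgebra H {K, E, F}"
    and comult_K: "comult H K = pure_tensor H H K K"
    and comult_E: "comult H E = pure_tensor H H E K \<oplus>\<^bsub>tensor_algebra H H\<^esub> pure_tensor H H \<one> E"
    and comult_F: "comult H F = pure_tensor H H F \<one> \<oplus>\<^bsub>tensor_algebra H H\<^esub> pure_tensor H H K' F"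
    and \<rho>: "\<rho> \<in> alg_hom H matrix_algebra" "\<rho> K = U_rep_K q" "\<rho> E = U_rep_E" "\<rho> F = U_rep_F"
begin

text \<open>Multiplication by \<open>K\<close> gives \<open>F\<close> the same skew primitive type
  as \<open>E\<close>. One argument then treats both, and their linear combinations stay skew
  primitive.\<close>

lemma comult_KF: "comult H (K \<otimes> F) = (K \<otimes> F) \<otimes>\<^sub>h K \<oplus>\<^bsub>HH\<^esub> \<one> \<otimes>\<^sub>h (K \<otimes> F)"
  by (simp add: comult_K comult_F T.r_distr pure_mult)

text \<open>
  The coefficients \<open>a\<close>, \<open>b\<close>, \<open>c\<close>, \<open>d\<close> of \<open>\<rho>\<close> satisfy the relations of the quantized coordinate
  ring for the convolution product; some of them say that this vector is an eigenvector.
\<close>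

definition quantum_det_vector :: "bool \<times> bool \<Rightarrow> 'k" where
  "quantum_det_vector i = (if i = (False, True) then q else if i = (True, False) then - 1 else 0)"

text \<open>The tensor square of \<rho> contains a copy of the trivial representation spanned by
  this vector: \<open>K\<close> fixes it, \<open>E\<close> and \<open>F\<close> kill it. Having it
  as an eigenvector is preserved by all algebra operations.\<close>

lemma convolution_eigenvector:
  assumes "y \<in> carrier H"
  shows "\<exists>\<mu>. \<forall>i. (\<Sum>j\<in>UNIV. tensor_rep H \<rho> \<rho> (comult H y) i j * quantum_det_vector j) = \<mu> * quantum_det_vector i"
proof -
  interpret \<rho>: kalgebra_hom H matrix_algebra \<rho>
    by (intro kalgebra_homI kalgebra_axioms kalgebra_matrix \<rho>(1))
  have \<rho>1: "\<rho> \<one> = (\<lambda>i j. if i = j then 1 else 0)" using \<rho>.hom_one by simp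
  have \<rho>K': "\<rho> K' = U_rep_K (q ^ (N - 1))" by (simp add: K'_def \<rho>(2) U_rep_K_pow)
  have "q * q ^ (N - 1) = q ^ N" using N by (simp flip: power_Suc)
  then have qN: "q ^ (N - Suc 0) = 1 / q" using q by (simp add: primitive_root_of_unity_def field_simps)
  let ?Q = "\<lambda>M. \<exists>\<mu>. \<forall>i. (\<Sum>j\<in>UNIV. M i j * quantum_det_vector j) = \<mu> * quantum_det_vector i"
  note simps = tensor_rep_pure[OF \<rho>(1,1)] tensor_rep_add[OF \<rho>(1,1)] \<rho> \<rho>1 \<rho>K' qN
    U_rep_K_def U_rep_E_def U_rep_F_def kronecker_def quantum_det_vector_def UNIV_bool
    split_paired_All all_bool_eq
  have K: "?Q (tensor_rep H \<rho> \<rho> (comult H K))"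
    by (rule exI[of _ 1]) (simp add: comult_K simps flip: UNIV_Times_UNIV)
  have E: "?Q (tensor_rep H \<rho> \<rho> (comult H E))"
    by (rule exI[of _ 0]) (simp add: comult_E simps flip: UNIV_Times_UNIV)
  have F: "?Q (tensor_rep H \<rho> \<rho> (comult H F))"
    by (rule exI[of _ 0]) (simp add: comult_F simps flip: UNIV_Times_UNIV)
  show ?thesis
  proof (rule generated_subalgebra_hom_induct[OF kalgebra_matrix convolution_hom[OF \<rho>(1,1)]])
    show "{K, E, F} \<subseteq> carrier H" "y \<in> generated_subalgebra H {K, E, F}"
      using assms generated by auto
    show "?Q (tensor_rep H \<rho> \<rho> (comult H s))" if "s \<in> {K, E, F}" for s
      using that K E F by blast
    show "?Q \<one>\<^bsub>matrix_algebra\<^esub>"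
      by (rule exI[of _ 1]) (simp add: if_distrib if_distribR sum.delta sum.delta' cong: if_cong)
    show "?Q (M \<oplus>\<^bsub>matrix_algebra\<^esub> M')" if M: "?Q M" and M': "?Q M'" for M M'
    proof -
      from M M' obtain m m' where "\<forall>i. (\<Sum>j\<in>UNIV. M i j * quantum_det_vector j) = m * quantum_det_vector i"
        "\<forall>i. (\<Sum>j\<in>UNIV. M' i j * quantum_det_vector j) = m' * quantum_det_vector i" by blast
      then show ?thesis
        by (intro exI[of _ "m + m'"]) (simp add: distrib_right sum.distrib)
    qed
    show "?Q (M \<otimes>\<^bsub>matrix_algebra\<^esub> M')" if "?Q M" "?Q M'" for M M'
      using common_eigenvector_mult[OF that] by simp
    show "?Q (c \<odot>\<^bsub>matrix_algebra\<^esub> M)" if M: "?Q M" for c M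
    proof -
      from M obtain m where "\<forall>i. (\<Sum>j\<in>UNIV. M i j * quantum_det_vector j) = m * quantum_det_vector i" by blast
      then show ?thesis
        by (intro exI[of _ "c * m"]) (simp add: mult.assoc flip: sum_distrib_left)
    qed
  qed
qed

text \<open>The coefficients of \<rho> composed with \<theta> inherit the determinant relations. On
  a grouplike element these force a diagonal matrix, on skew primitives they restrict the
  off-diagonal entries, and the relations of the quantum group fix the rest.\<close>

lemma automorphism_on_rep:
  assumes \<theta>: "\<theta> \<in> hopf_automorphisms H"
  obtains \<alpha> \<beta> where "\<alpha> * \<beta> = 1" "\<rho> (\<theta> K) = U_rep_K q"
    "\<rho> (\<theta> E) = (\<lambda>i j. \<alpha> * U_rep_E i j)" "\<rho> (\<theta> F) = (\<lambda>i j. \<beta> * U_rep_F i j)"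
proof -
  define r where "r y = \<rho> (\<theta> y)" for y
  have hom: "\<theta> \<in> alg_hom H H" by (rule hopf_automorphism_alg_hom[OF \<theta>])
  have r: "r \<in> alg_hom H matrix_algebra" unfolding r_def by (rule alg_hom_comp[OF hom \<rho>(1)])
  interpret \<theta>: kalgebra_hom H H \<theta> by (intro kalgebra_homI kalgebra_axioms hom)
  interpret r: kalgebra_hom H matrix_algebra r by (intro kalgebra_homI kalgebra_axioms kalgebra_matrix r)
  have r1: "r \<one> = (\<lambda>i j. if i = j then 1 else 0)" using r.hom_one by simp
  define P Q Z P' where "P = r K" "Q = r E" "Z = r F" "P' = r K'"
  note defs = P_Q_Z_P'_def
  have q2: "q\<^sup>2 \<noteq> 1" and q4: "q ^ 4 \<noteq> 1" and q1: "q \<noteq> 1"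
    using primitive_root_power_neq[OF q N] by auto
  \<comment> \<open>These entries of P P' = 1 and P' P = 1 show that the first row and both columns
    of \<open>P\<close> are nonzero.\<close>
  have PP': "P False False * P' False False + P False True * P' True False = 1"
    "P' False False * P False False + P' False True * P True False = 1"
    "P' True False * P False True + P' True True * P True True = 1"
    using fun_cong[OF fun_cong[OF r.hom_mult[of K K']], of False False]
      fun_cong[OF fun_cong[OF r.hom_mult[of K' K]], of False False]
      fun_cong[OF fun_cong[OF r.hom_mult[of K' K]], of True True]
    by (simp_all add: defs r1 UNIV_bool add.commute)
  have conv: "tensor_rep H \<rho> \<rho> (comult H (\<theta> y)) = tensor_rep H r r (comult H y)" if "y \<in> carrier H" for y
    using convolution_automorphism[OF \<theta> that \<rho>(1,1)] by (simp add: r_def[abs_def])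
  have eig: "\<exists>m. \<forall>i. (\<Sum>j\<in>UNIV. tensor_rep H r r (comult H y) i j * quantum_det_vector j) = m * quantum_det_vector i"
    if "y \<in> carrier H" for y
    using convolution_eigenvector[of "\<theta> y"] that conv by simp
  note simps = tensor_rep_pure[OF r r] tensor_rep_add[OF r r] r1 kronecker_def quantum_det_vector_def
    UNIV_bool all_bool_eq split_paired_All
  \<comment> \<open>As \<open>K\<close> is grouplike, the Kronecker square of \<open>P\<close> has
    the determinant vector as an eigenvector. The entries of \<open>P\<close> thus q-commute like
    the generators of quantum matrices; being scalars they also commute, so the products below
    vanish.\<close>
  obtain m where m: "P False False * P False True * q = P False True * P False False"
    "P True False * P True True * q = P True True * P True False"
    "P False False * P True True * q - P False True * P True False = m * q"
    "P True False * P False True * q - P True True * P False False = - m"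
    using eig[of K] by (auto simp: comult_K simps algebra_simps defs simp flip: UNIV_Times_UNIV)
  have "P False False * P False True * (q - 1) = 0" "P True False * P True True * (q - 1) = 0"
    using m(1,2) by (simp_all add: algebra_simps)
  moreover have "P False True * P True False * (q\<^sup>2 - 1) = 0"
  proof -
    have "P False False * P True True = m + q * (P False True * P True False)"
      using m(4) by (simp add: algebra_simps)
    then have "(m + q * (P False True * P True False)) * q - P False True * P True False = m * q"
      using m(3) by simp
    moreover have "P False True * P True False * (q\<^sup>2 - 1) =
        (m + q * (P False True * P True False)) * q - P False True * P True False - m * q"
      by (simp add: algebra_simps power2_eq_square del: mult_eq_0_iff)
    ultimately show ?thesis by simp
  qed
  ultimately have prods: "P False False * P False True = 0" "P True False * P True True = 0"
    "P False True * P True False = 0" using q1 q2 by auto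
  have diag: "P False True = 0" "P True False = 0"
    using prods PP' by auto
  have nz: "P False False \<noteq> 0" "P True True \<noteq> 0" using PP' diag by auto
  \<comment> \<open>The eigenvector equation is read at the two coordinates where the determinant
    vector is zero, so the unknown eigenvalue drops out.\<close>
  have skew: "S False True * (P False False - q) = 0" "S True False * (P True True * q - 1) = 0"
    if y: "y \<in> carrier H" "comult H y = y \<otimes>\<^sub>h K \<oplus>\<^bsub>HH\<^esub> \<one> \<otimes>\<^sub>h y" and S: "S = r y" for y S
  proof -
    obtain m where "\<forall>i. (\<Sum>j\<in>UNIV. tensor_rep H r r (comult H y) i j * quantum_det_vector j) = m * quantum_det_vector i"
      using eig[OF y(1)] ..
    then have "(\<Sum>j\<in>UNIV. tensor_rep H r r (comult H y) (False, False) j * quantum_det_vector j) = 0"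
      "(\<Sum>j\<in>UNIV. tensor_rep H r r (comult H y) (True, True) j * quantum_det_vector j) = 0"
      by (simp_all add: quantum_det_vector_def)
    then show "S False True * (P False False - q) = 0" "S True False * (P True True * q - 1) = 0"
      using y(1) diag by (auto simp: y(2) S simps algebra_simps defs simp flip: UNIV_Times_UNIV)
  qed
  have W: "r (K \<otimes> F) = (\<lambda>i j. P i i * Z i j)"
  proof (intro ext)
    fix i j
    show "r (K \<otimes> F) i j = P i i * Z i j" using diag by (cases i) (simp_all add: defs UNIV_bool)
  qed
  note skew_E = skew[OF E comult_E refl] and skew_F = skew[OF _ comult_KF refl]
  have surj: "\<exists>y\<in>carrier H. \<theta> y = x" if "x \<in> carrier H" for x
    using hopf_automorphism_surj[OF \<theta>] that by (metis imageE)
  have gen: "{K, E, F} \<subseteq> carrier H" by auto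
  \<comment> \<open>Otherwise the upper right entry of \<open>r\<close> vanishes on
    \<open>K\<close>, \<open>E\<close> and \<open>F\<close>, hence on all of \<open>H\<close>. As
    \<theta> is surjective, \<rho>(E) would then have a zero there.\<close>
  have PFF: "P False False = q"
  proof (rule ccontr)
    assume ne: "P False False \<noteq> q"
    have "r y False True = 0" if "y \<in> carrier H" for y
    proof (rule generated_subalgebra_hom_induct[OF kalgebra_matrix r gen that[unfolded generated]])
      show "r s False True = 0" if "s \<in> {K, E, F}" for s
        using that ne skew_E(1) skew_F(1) diag nz by (auto simp: W simp flip: defs)
    qed (auto simp: UNIV_bool)
    moreover obtain y where "y \<in> carrier H" "\<theta> y = E" using surj[OF E] ..
    ultimately have "\<rho> E False True = 0" by (auto simp: r_def)
    then show False by (simp add: \<rho> U_rep_E_def)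
  qed
  have PTT: "P True True * q = 1"
  proof (rule ccontr)
    assume ne: "P True True * q \<noteq> 1"
    have "r y True False = 0" if "y \<in> carrier H" for y
    proof (rule generated_subalgebra_hom_induct[OF kalgebra_matrix r gen that[unfolded generated]])
      show "r s True False = 0" if "s \<in> {K, E, F}" for s
        using that ne skew_E(2) skew_F(2) diag nz by (auto simp: W simp flip: defs)
    qed (auto simp: UNIV_bool)
    moreover obtain y where "y \<in> carrier H" "\<theta> y = F" using surj[OF F] ..
    ultimately have "\<rho> F True False = 0" by (auto simp: r_def)
    then show False by (simp add: \<rho> U_rep_F_def)
  qed
  then have PTT': "P True True = 1 / q" by (simp add: field_simps)
  have PK: "P = U_rep_K q" by (simp add: fun_eq_iff all_bool_eq U_rep_K_def PFF PTT' diag)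
  have PQ: "(\<Sum>k\<in>UNIV. P i k * Q k j) = q\<^sup>2 * (\<Sum>k\<in>UNIV. Q i k * P k j)" for i j
  proof -
    have "r (K \<otimes> E) i j = r (q\<^sup>2 \<odot> (E \<otimes> K)) i j" by (simp only: KE)
    then show ?thesis by (simp add: defs)
  qed
  have PZ: "(\<Sum>k\<in>UNIV. P i k * Z k j) = (1 / q\<^sup>2) * (\<Sum>k\<in>UNIV. Z i k * P k j)" for i j
  proof -
    have "r (K \<otimes> F) i j = r ((1 / q\<^sup>2) \<odot> (F \<otimes> K)) i j" by (simp only: KF)
    then show ?thesis by (simp add: defs)
  qed
  \<comment> \<open>Conjugation by \<open>P\<close> = diag(q, 1/q) scales the entries by 1, q^2 and
    1/q^2. These are distinct because q^2 and q^4 differ from 1, so each of \<open>Q\<close> and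
    \<open>Z\<close> keeps a single entry.\<close>
  have "Q False False = 0" "Q True True = 0" "Q True False = 0"
    using PQ[of False False] PQ[of True True] PQ[of True False] q2 q4
    by (simp_all add: PK U_rep_K_def UNIV_bool field_simps power2_eq_square power4_eq_xxxx)
  then have Q: "Q = (\<lambda>i j. Q False True * U_rep_E i j)"
    by (simp add: fun_eq_iff all_bool_eq U_rep_E_def)
  have "Z False False = 0" "Z True True = 0" "Z False True = 0"
    using PZ[of False False] PZ[of True True] PZ[of False True] q2 q4
    by (simp_all add: PK U_rep_K_def UNIV_bool field_simps power2_eq_square power4_eq_xxxx)
  then have Z: "Z = (\<lambda>i j. Z True False * U_rep_F i j)"
    by (simp add: fun_eq_iff all_bool_eq U_rep_F_def)
  have "Q False True * Z True False = 1"
  proof -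
    have "r (E \<otimes> F \<ominus> F \<otimes> E) False False = r ((1 / (q - 1 / q)) \<odot> (K \<ominus> K')) False False" by (simp only: EF)
    then have "(\<Sum>k\<in>UNIV. Q False k * Z k False) - (\<Sum>k\<in>UNIV. Z False k * Q k False) =
        (1 / (q - 1 / q)) * (P False False - P' False False)"
      by (simp add: defs)
    moreover have "P' False False = 1 / q" using PP' PFF diag by (simp add: field_simps)
    moreover have "q - 1 / q \<noteq> 0" using q2 by (simp add: field_simps power2_eq_square)
    ultimately show ?thesis
      by (subst (asm) (2) Z, subst (asm) Z) (simp add: UNIV_bool PFF U_rep_F_def)
  qed
  then show thesis
    using that PK Q Z by (simp add: defs r_def)
qed

lemma infinite_orbits_U:
  assumes inf: "infinite (UNIV :: 'k set)"
  shows "infinite (right_coideal_subalgebra_orbits H)"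
proof (rule infinite_orbits[OF inf])
  define x where "x t = E \<oplus> t \<odot> (K \<otimes> F) \<oplus> K" for t
  define B where "B t = generated_subalgebra H {x t}" for t
  interpret M: kalgebra "matrix_algebra :: ('k, bool \<Rightarrow> bool \<Rightarrow> 'k) module" by (rule kalgebra_matrix)
  interpret \<rho>: kalgebra_hom H matrix_algebra \<rho>
    by (intro kalgebra_homI kalgebra_axioms kalgebra_matrix \<rho>(1))
  have x: "x t \<in> carrier H" for t by (simp add: x_def)
  have sub: "B t \<subseteq> carrier H" for t unfolding B_def using x by (intro generated_subalgebra_subset) auto
  show "B t \<in> right_coideal_subalgebras H" for t
    unfolding B_def
  proof (rule generated_right_coideal_subalgebra)
    have "comult H (x t) = x t \<otimes>\<^sub>h K \<oplus>\<^bsub>HH\<^esub> \<one> \<otimes>\<^sub>h (E \<oplus> t \<odot> (K \<otimes> F))"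
      by (simp add: x_def comult_E comult_KF comult_K pure_add_l pure_add_r pure_smult_l pure_smult_r
          T.smult_r_distr T.a_ac del: \<Delta>.hom_mult)
    moreover have "\<dots> \<in> tensor_subspace H H (B t) (carrier H)"
      using sub by (intro tensor_subspace_add tensor_subspace_pure)
        (auto simp: B_def x intro: generated_subalgebra.intros)
    ultimately show "comult H s \<in> tensor_subspace H H (generated_subalgebra H {x t}) (carrier H)"
      if "s \<in> {x t}" for s using that by (simp add: B_def)
  qed (use x in simp)
  fix \<theta> s t assume \<theta>: "\<theta> \<in> hopf_automorphisms H" and eq: "\<theta> ` B t = B s"
  obtain \<alpha> \<beta> where lm: "\<alpha> * \<beta> = 1" "\<rho> (\<theta> K) = U_rep_K q"
    "\<rho> (\<theta> E) = (\<lambda>i j. \<alpha> * U_rep_E i j)" "\<rho> (\<theta> F) = (\<lambda>i j. \<beta> * U_rep_F i j)"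
    using automorphism_on_rep[OF \<theta>] .
  interpret \<theta>: kalgebra_hom H H \<theta>
    by (intro kalgebra_homI kalgebra_axioms hopf_automorphism_alg_hom[OF \<theta>])
  have "x t \<in> B t" unfolding B_def by (auto intro: generated_subalgebra.incl)
  then have "\<theta> (x t) \<in> generated_subalgebra H {x s}" using eq by (auto simp: B_def)
  \<comment> \<open>An algebra generated by one element is commutative, so membership of \<theta>(x
    t) gives a commutator equation between two explicit matrices.\<close>
  then have comm: "\<rho> (\<theta> (x t)) \<otimes>\<^bsub>matrix_algebra\<^esub> \<rho> (x s) = \<rho> (x s) \<otimes>\<^bsub>matrix_algebra\<^esub> \<rho> (\<theta> (x t))"
  proof (rule generated_subalgebra_hom_induct[OF kalgebra_matrix \<rho>(1), rotated])
    fix M M' :: "bool \<Rightarrow> bool \<Rightarrow> 'k"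
    assume MM': "M \<otimes>\<^bsub>matrix_algebra\<^esub> \<rho> (x s) = \<rho> (x s) \<otimes>\<^bsub>matrix_algebra\<^esub> M"
      "M' \<otimes>\<^bsub>matrix_algebra\<^esub> \<rho> (x s) = \<rho> (x s) \<otimes>\<^bsub>matrix_algebra\<^esub> M'"
    show "(M \<otimes>\<^bsub>matrix_algebra\<^esub> M') \<otimes>\<^bsub>matrix_algebra\<^esub> \<rho> (x s) = \<rho> (x s) \<otimes>\<^bsub>matrix_algebra\<^esub> (M \<otimes>\<^bsub>matrix_algebra\<^esub> M')"
      using MM' M.m_assoc[of M M' "\<rho> (x s)"] M.m_assoc[of M "\<rho> (x s)" M'] M.m_assoc[of "\<rho> (x s)" M M']
      by (simp del: matrix_algebra_simps(2))
    show "(M \<oplus>\<^bsub>matrix_algebra\<^esub> M') \<otimes>\<^bsub>matrix_algebra\<^esub> \<rho> (x s) = \<rho> (x s) \<otimes>\<^bsub>matrix_algebra\<^esub> (M \<oplus>\<^bsub>matrix_algebra\<^esub> M')"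
      using MM' M.l_distr[of M M' "\<rho> (x s)"] M.r_distr[of M M' "\<rho> (x s)"]
      by (simp del: matrix_algebra_simps(2,5))
  next
    fix c and M :: "bool \<Rightarrow> bool \<Rightarrow> 'k"
    assume M: "M \<otimes>\<^bsub>matrix_algebra\<^esub> \<rho> (x s) = \<rho> (x s) \<otimes>\<^bsub>matrix_algebra\<^esub> M"
    show "(c \<odot>\<^bsub>matrix_algebra\<^esub> M) \<otimes>\<^bsub>matrix_algebra\<^esub> \<rho> (x s) = \<rho> (x s) \<otimes>\<^bsub>matrix_algebra\<^esub> (c \<odot>\<^bsub>matrix_algebra\<^esub> M)"
      using M M.smult_mult_l[of M "\<rho> (x s)" c] M.smult_mult_r[of "\<rho> (x s)" M c]
      by (simp del: matrix_algebra_simps(2,6))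
  qed (use x M.l_one M.r_one in \<open>auto simp del: matrix_algebra_simps(2,3)\<close>)
  have \<rho>x: "\<rho> (x s) = (\<lambda>i j. U_rep_E i j + s * (\<Sum>k\<in>UNIV. U_rep_K q i k * U_rep_F k j) + U_rep_K q i j)"
    by (simp add: x_def \<rho>)
  have \<rho>\<theta>x: "\<rho> (\<theta> (x t)) =
      (\<lambda>i j. \<alpha> * U_rep_E i j + t * (\<Sum>k\<in>UNIV. U_rep_K q i k * (\<beta> * U_rep_F k j)) + U_rep_K q i j)"
    by (simp add: x_def lm)
  note simps = \<rho>x \<rho>\<theta>x UNIV_bool U_rep_K_def U_rep_E_def U_rep_F_def
  have "q\<^sup>2 \<noteq> 1" using primitive_root_power_neq[OF q N] by simp
  \<comment> \<open>The upper right entry of the commutator compares \<alpha> with the coefficient 1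
    of \<open>E\<close>, thanks to the distinct diagonal entries contributed by \<open>K\<close>;
    the diagonal entry then compares the parameters.\<close>
  moreover have "q + \<alpha> * (1 / q) = q * \<alpha> + 1 / q" and *: "\<alpha> * (s * (1 / q)) = t * (1 / q * \<beta>)"
    using fun_cong[OF fun_cong[OF comm], of False True] fun_cong[OF fun_cong[OF comm], of False False]
    by (simp_all add: simps algebra_simps)
  then have "(q\<^sup>2 - 1) * (1 - \<alpha>) = 0" by (simp add: field_simps power2_eq_square)
  ultimately have "\<alpha> = 1" by simp
  then show "t = s" using * lm(1) by simp
qed

end

lemma presented_hopf_derived_simps [simp]:
  "x [^]\<^bsub>presented_hopf_algebra R \<delta> \<epsilon> \<sigma>\<^esub> (n::nat) = x [^]\<^bsub>presented_algebra R\<^esub> n"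
  "\<ominus>\<^bsub>presented_hopf_algebra R \<delta> \<epsilon> \<sigma>\<^esub> x = \<ominus>\<^bsub>presented_algebra R\<^esub> x"
  "x \<ominus>\<^bsub>presented_hopf_algebra R \<delta> \<epsilon> \<sigma>\<^esub> y = x \<ominus>\<^bsub>presented_algebra R\<^esub> y"
  by (simp_all add: nat_pow_def a_minus_def a_inv_def m_inv_def)

lemma infinite_orbits_U_bar:
  fixes q :: "'k::field"
  assumes N: "N > 1" "odd N" and q: "primitive_root_of_unity N q" and inf: "infinite (UNIV :: 'k set)"
  shows "infinite (right_coideal_subalgebra_orbits (U_bar N q))"
proof -
  interpret U_presentation N q .
  let ?R = "U_relations N q"
  let ?K = "gen U_K" and ?E = "gen U_E" and ?F = "gen U_F"
  let ?T = "tensor_algebra P P" and ?t = "pure_tensor P P"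
  interpret A: U_triple P N q ?K ?E ?F
    by (intro U_triple.intro U_triple_axioms.intro kalgebra_presented N q presented_generator_closed relations_hold)
  interpret PP: tensor_product P P by (simp add: tensor_product_def kalgebra_presented)
  define \<delta> where "\<delta> g = (case g of U_K \<Rightarrow> ?t ?K ?K | U_E \<Rightarrow> ?t ?E ?K \<oplus>\<^bsub>?T\<^esub> ?t \<one>\<^bsub>P\<^esub> ?E
      | U_F \<Rightarrow> ?t ?F \<one>\<^bsub>P\<^esub> \<oplus>\<^bsub>?T\<^esub> ?t A.K' ?F)" for g
  define \<epsilon> :: "U_gen \<Rightarrow> 'k" where "\<epsilon> g = (case g of U_K \<Rightarrow> 1 | U_E \<Rightarrow> 0 | U_F \<Rightarrow> 0)" for g
  define \<sigma> where "\<sigma> g = (case g of U_K \<Rightarrow> A.K' | U_E \<Rightarrow> \<ominus>\<^bsub>P\<^esub> (?E \<otimes>\<^bsub>P\<^esub> A.K') | U_F \<Rightarrow> \<ominus>\<^bsub>P\<^esub> (?K \<otimes>\<^bsub>P\<^esub> ?F))" for g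
  define \<gamma> where "\<gamma> g = (case g of U_K \<Rightarrow> U_rep_K q | U_E \<Rightarrow> U_rep_E | U_F \<Rightarrow> U_rep_F)" for g
  have H: "U_bar N q = presented_hopf_algebra ?R \<delta> \<epsilon> \<sigma>"
    by (simp add: U_bar_def Let_def \<delta>_def[abs_def] \<epsilon>_def[abs_def] \<sigma>_def[abs_def] A.K'_def)
  have \<delta>: "\<delta> g \<in> carrier ?T" for g by (cases g) (auto simp: \<delta>_def)
  have \<sigma>: "\<sigma> g \<in> carrier P" for g by (cases g) (auto simp: \<sigma>_def)
  have "free_extension ?T \<delta> ` ?R \<subseteq> {\<zero>\<^bsub>?T\<^esub>}"
    unfolding free_extension_relations[OF PP.kalgebra_tensor \<delta>]
    using A.comult_relations by (simp add: \<delta>_def)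
  moreover have "free_extension (opposite_algebra P) \<sigma> ` ?R \<subseteq> {\<zero>\<^bsub>opposite_algebra P\<^esub>}"
    using A.antipode_relations \<sigma>
    by (subst free_extension_relations[OF A.kalgebra_opposite]) (simp_all add: \<sigma>_def)
  ultimately interpret U: hopf_presentation ?R \<delta> \<epsilon> \<sigma>
    using \<delta> \<sigma> by unfold_locales auto
  have M: "kalgebra (matrix_algebra :: ('k, bool \<Rightarrow> bool \<Rightarrow> 'k) module)" by (rule kalgebra_matrix)
  have zero: "free_extension matrix_algebra \<gamma> ` ?R \<subseteq> {\<zero>\<^bsub>matrix_algebra\<^esub>}"
    using U_rep_relations[OF q N] by (subst free_extension_relations[OF M]) (simp_all add: \<gamma>_def)
  define \<rho> where "\<rho> = quotient_lift (free_extension matrix_algebra \<gamma>)"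
  have \<rho>: "\<rho> \<in> alg_hom P matrix_algebra" "\<rho> (gen g) = \<gamma> g" for g
    using presented_lift_alg_hom[OF M _ zero] presented_lift_generator[OF M _ zero] by (simp_all add: \<rho>_def)
  have univ: "UNIV = {U_K, U_E, U_F}" by (auto intro: U_gen.exhaust)
  have range: "range gen = {?K, ?E, ?F}" unfolding univ by simp
  interpret B: U_triple U.H N q ?K ?E ?F
    using A.relations A.K A.E A.F
    by (intro U_triple.intro U_triple_axioms.intro U.kalgebra_H N q) (simp_all add: U_relations_hold_def)
  have "B.K' = A.K'" by (simp add: A.K'_def B.K'_def)
  then interpret U_hopf U.H N q ?K ?E ?F \<rho>
    using U.comult_generator[of U_K] U.comult_generator[of U_E] U.comult_generator[of U_F]
      presented_algebra_generated \<rho>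
    by (intro U_hopf.intro U.Hopf.hopf_structure_axioms B.U_triple_axioms U_hopf_axioms.intro)
       (simp_all add: range \<delta>_def \<gamma>_def)
  show ?thesis unfolding H by (rule infinite_orbits_U[OF inf])
qed

section \<open>The small quantized coordinate ring\<close>

text \<open>The equations are oriented towards the order a, b, c, d, with both \<open>a d\<close>
  and \<open>d a\<close> expressed through \<open>b c\<close>; used from left to right they bring
  quadratic expressions to normal form.\<close>

definition O_relations_hold ::
    "('k::field, 'a, 'x) module_scheme \<Rightarrow> nat \<Rightarrow> 'k \<Rightarrow> 'a \<Rightarrow> 'a \<Rightarrow> 'a \<Rightarrow> 'a \<Rightarrow> bool" where
  "O_relations_hold A N q a b c d \<longleftrightarrow>
     b \<otimes>\<^bsub>A\<^esub> a = q \<odot>\<^bsub>A\<^esub> (a \<otimes>\<^bsub>A\<^esub> b) \<and>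
     c \<otimes>\<^bsub>A\<^esub> a = q \<odot>\<^bsub>A\<^esub> (a \<otimes>\<^bsub>A\<^esub> c) \<and>
     c \<otimes>\<^bsub>A\<^esub> b = b \<otimes>\<^bsub>A\<^esub> c \<and>
     d \<otimes>\<^bsub>A\<^esub> b = q \<odot>\<^bsub>A\<^esub> (b \<otimes>\<^bsub>A\<^esub> d) \<and>
     d \<otimes>\<^bsub>A\<^esub> c = q \<odot>\<^bsub>A\<^esub> (c \<otimes>\<^bsub>A\<^esub> d) \<and>
     a \<otimes>\<^bsub>A\<^esub> d = \<one>\<^bsub>A\<^esub> \<oplus>\<^bsub>A\<^esub> (1 / q) \<odot>\<^bsub>A\<^esub> (b \<otimes>\<^bsub>A\<^esub> c) \<and>
     d \<otimes>\<^bsub>A\<^esub> a = \<one>\<^bsub>A\<^esub> \<oplus>\<^bsub>A\<^esub> q \<odot>\<^bsub>A\<^esub> (b \<otimes>\<^bsub>A\<^esub> c) \<and>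
     a [^]\<^bsub>A\<^esub> N = \<one>\<^bsub>A\<^esub> \<and> d [^]\<^bsub>A\<^esub> N = \<one>\<^bsub>A\<^esub> \<and>
     b [^]\<^bsub>A\<^esub> N = \<zero>\<^bsub>A\<^esub> \<and> c [^]\<^bsub>A\<^esub> N = \<zero>\<^bsub>A\<^esub>"

lemma O_relators_iff:
  fixes B :: "('k::field, 'b) module"
  assumes "kalgebra B" "a \<in> carrier B" "b \<in> carrier B" "c \<in> carrier B" "d \<in> carrier B"
  shows "O_relators B N q a b c d \<subseteq> {\<zero>\<^bsub>B\<^esub>} \<longleftrightarrow> O_relations_hold B N q a b c d"
proof -
  interpret B: kalgebra B by fact
  show ?thesis
    unfolding O_relators_def O_relations_hold_def
    using assms(2-5) by (auto simp: B.diff_eq_zero_iff B.diff_eq_iff)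
qed

lemma O_relators_closed:
  fixes A :: "('k::field, 'a) module"
  assumes "kalgebra A" "a \<in> carrier A" "b \<in> carrier A" "c \<in> carrier A" "d \<in> carrier A"
  shows "O_relators A N q a b c d \<subseteq> carrier A"
proof -
  interpret kalgebra A by fact
  show ?thesis
    unfolding O_relators_def using assms(2-5) by (auto simp del: monoid_algebra_simps)
qed

lemma O_relators_image:
  fixes A :: "('k::field, 'a) module" and B :: "('k, 'b) module"
  assumes "kalgebra A" "kalgebra B" "f \<in> alg_hom A B"
    "a \<in> carrier A" "b \<in> carrier A" "c \<in> carrier A" "d \<in> carrier A"
  shows "f ` O_relators A N q a b c d = O_relators B N q (f a) (f b) (f c) (f d)"
proof -
  interpret f: kalgebra_hom A B f using assms by (intro kalgebra_homI)
  show ?thesis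
    unfolding O_relators_def using assms(4-7) by simp
qed

locale O_presentation =
  fixes N :: nat and q :: "'k::field"
begin

sublocale presentation "O_relations N q"
  by unfold_locales (simp only: O_relations_def O_relators_closed kalgebra_free_algebra free_generator_closed)

abbreviation "gen \<equiv> presented_generator (O_relations N q)"

lemma free_extension_relations:
  fixes B :: "('k, 'b) module"
  assumes B: "kalgebra B" and \<gamma>: "\<And>g. \<gamma> g \<in> carrier B"
  shows "free_extension B \<gamma> ` O_relations N q \<subseteq> {\<zero>\<^bsub>B\<^esub>} \<longleftrightarrow>
    O_relations_hold B N q (\<gamma> O_a) (\<gamma> O_b) (\<gamma> O_c) (\<gamma> O_d)"
  unfolding O_relations_def
  by (simp only: O_relators_image[OF kalgebra_free_algebra B kalgebra.free_extension_alg_hom[OF B \<gamma>]]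
      free_generator_closed kalgebra.free_extension_generator[OF B \<gamma>] O_relators_iff[OF B] \<gamma>)

lemma relations_hold: "O_relations_hold P N q (gen O_a) (gen O_b) (gen O_c) (gen O_d)"
proof -
  have "(\<lambda>x. Idl\<^bsub>free_algebra\<^esub> (O_relations N q) +>\<^bsub>free_algebra\<^esub> x) ` O_relations N q \<subseteq> {\<zero>\<^bsub>P\<^esub>}"
    using projection_relator by blast
  then have "O_relators P N q (gen O_a) (gen O_b) (gen O_c) (gen O_d) \<subseteq> {\<zero>\<^bsub>P\<^esub>}"
    unfolding presented_generator_def
    by (subst (asm) (2) O_relations_def)
       (simp only: O_relators_image[OF kalgebra_free_algebra kalgebra_presented projection_alg_hom]
          free_generator_closed)
  then show ?thesis
    by (simp only: O_relators_iff[OF kalgebra_presented] presented_generator_closed)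
qed

end

locale O_quadruple = kalgebra A for A :: "('k::field, 'a, 'x) module_scheme" (structure) +
  fixes N :: nat and q :: 'k and a b c d
  assumes N: "N > 1" "odd N" and q: "primitive_root_of_unity N q"
    and a [simp, intro]: "a \<in> carrier A" and b [simp, intro]: "b \<in> carrier A"
    and c [simp, intro]: "c \<in> carrier A" and d [simp, intro]: "d \<in> carrier A"
    and relations: "O_relations_hold A N q a b c d"
begin

lemma q_nonzero [simp]: "q \<noteq> 0" using primitive_root_nonzero[OF q] N by simp

lemma pows: "a [^] N = \<one>" "d [^] N = \<one>" "b [^] N = \<zero>" "c [^] N = \<zero>"
  and quads: "b \<otimes> a = q \<odot> (a \<otimes> b)" "c \<otimes> a = q \<odot> (a \<otimes> c)" "c \<otimes> b = b \<otimes> c"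
    "d \<otimes> b = q \<odot> (b \<otimes> d)" "d \<otimes> c = q \<odot> (c \<otimes> d)"
    "a \<otimes> d = \<one> \<oplus> (1 / q) \<odot> (b \<otimes> c)" "d \<otimes> a = \<one> \<oplus> q \<odot> (b \<otimes> c)"
  using relations by (simp_all add: O_relations_hold_def)

lemma antipode_relations:
  "O_relations_hold (opposite_algebra A) N q d ((- q) \<odot> b) ((- (1 / q)) \<odot> c) a"
  unfolding O_relations_hold_def
  by (simp add: opposite_pow smult_pow smult_mult_l smult_mult_r pows quads mult_ac flip: smult_assoc)

text \<open>The quadratic relations follow by normal ordering in each tensor factor. For the power
  relations, the two summands of each coproduct commute up to 1/q^2, a primitive \<open>N\<close>-th
  root of unity, so \<open>N\<close>-th powers are additive on them.\<close>

lemma comult_relations: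
  defines "T \<equiv> tensor_algebra A A" and "t \<equiv> pure_tensor A A"
  shows "O_relations_hold T N q (t a a \<oplus>\<^bsub>T\<^esub> t b c) (t a b \<oplus>\<^bsub>T\<^esub> t b d)
    (t c a \<oplus>\<^bsub>T\<^esub> t d c) (t c b \<oplus>\<^bsub>T\<^esub> t d d)"
proof -
  interpret tensor_product A A by (simp add: tensor_product_def kalgebra_axioms)
  have w: "primitive_root_of_unity N (1 / q ^ 2)"
    using primitive_root_square[OF q] N by (intro primitive_root_inverse) auto
  note [simp] = T_def t_def
  note tensor = pure_mult pure_add_l pure_add_r pure_smult_l pure_smult_r T.l_distr T.r_distr
    T.smult_r_distr quads power2_eq_square mult_ac pure_one
  have pow: "(t x y \<oplus>\<^bsub>T\<^esub> t x' y') [^]\<^bsub>T\<^esub> N = t (x [^] N) (y [^] N) \<oplus>\<^bsub>T\<^esub> t (x' [^] N) (y' [^] N)"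
    if "t x y \<otimes>\<^bsub>T\<^esub> t x' y' = (1 / q ^ 2) \<odot>\<^bsub>T\<^esub> (t x' y' \<otimes>\<^bsub>T\<^esub> t x y)"
      "x \<in> carrier A" "y \<in> carrier A" "x' \<in> carrier A" "y' \<in> carrier A" for x y x' y'
  proof -
    have "(t x y \<oplus>\<^bsub>T\<^esub> t x' y') [^]\<^bsub>T\<^esub> N = t x y [^]\<^bsub>T\<^esub> N \<oplus>\<^bsub>T\<^esub> t x' y' [^]\<^bsub>T\<^esub> N"
      using N w that by (intro T.q_binomial_root_of_unity[where w = "1 / q ^ 2", folded T_def]) auto
    then show ?thesis using that by (simp add: pure_pow)
  qed
  show ?thesis
    unfolding O_relations_hold_def
  proof (intro conjI)
    show "(t a b \<oplus>\<^bsub>T\<^esub> t b d) \<otimes>\<^bsub>T\<^esub> (t a a \<oplus>\<^bsub>T\<^esub> t b c) = q \<odot>\<^bsub>T\<^esub> ((t a a \<oplus>\<^bsub>T\<^esub> t b c) \<otimes>\<^bsub>T\<^esub> (t a b \<oplus>\<^bsub>T\<^esub> t b d))"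
      "(t c a \<oplus>\<^bsub>T\<^esub> t d c) \<otimes>\<^bsub>T\<^esub> (t a a \<oplus>\<^bsub>T\<^esub> t b c) = q \<odot>\<^bsub>T\<^esub> ((t a a \<oplus>\<^bsub>T\<^esub> t b c) \<otimes>\<^bsub>T\<^esub> (t c a \<oplus>\<^bsub>T\<^esub> t d c))"
      "(t c a \<oplus>\<^bsub>T\<^esub> t d c) \<otimes>\<^bsub>T\<^esub> (t a b \<oplus>\<^bsub>T\<^esub> t b d) = (t a b \<oplus>\<^bsub>T\<^esub> t b d) \<otimes>\<^bsub>T\<^esub> (t c a \<oplus>\<^bsub>T\<^esub> t d c)"
      "(t c b \<oplus>\<^bsub>T\<^esub> t d d) \<otimes>\<^bsub>T\<^esub> (t a b \<oplus>\<^bsub>T\<^esub> t b d) = q \<odot>\<^bsub>T\<^esub> ((t a b \<oplus>\<^bsub>T\<^esub> t b d) \<otimes>\<^bsub>T\<^esub> (t c b \<oplus>\<^bsub>T\<^esub> t d d))"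
      "(t c b \<oplus>\<^bsub>T\<^esub> t d d) \<otimes>\<^bsub>T\<^esub> (t c a \<oplus>\<^bsub>T\<^esub> t d c) = q \<odot>\<^bsub>T\<^esub> ((t c a \<oplus>\<^bsub>T\<^esub> t d c) \<otimes>\<^bsub>T\<^esub> (t c b \<oplus>\<^bsub>T\<^esub> t d d))"
      "(t a a \<oplus>\<^bsub>T\<^esub> t b c) \<otimes>\<^bsub>T\<^esub> (t c b \<oplus>\<^bsub>T\<^esub> t d d) =
        \<one>\<^bsub>T\<^esub> \<oplus>\<^bsub>T\<^esub> (1 / q) \<odot>\<^bsub>T\<^esub> ((t a b \<oplus>\<^bsub>T\<^esub> t b d) \<otimes>\<^bsub>T\<^esub> (t c a \<oplus>\<^bsub>T\<^esub> t d c))"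
      "(t c b \<oplus>\<^bsub>T\<^esub> t d d) \<otimes>\<^bsub>T\<^esub> (t a a \<oplus>\<^bsub>T\<^esub> t b c) =
        \<one>\<^bsub>T\<^esub> \<oplus>\<^bsub>T\<^esub> q \<odot>\<^bsub>T\<^esub> ((t a b \<oplus>\<^bsub>T\<^esub> t b d) \<otimes>\<^bsub>T\<^esub> (t c a \<oplus>\<^bsub>T\<^esub> t d c))"
      by (simp_all add: tensor T.a_ac flip: T.smult_assoc)
    show "(t a a \<oplus>\<^bsub>T\<^esub> t b c) [^]\<^bsub>T\<^esub> N = \<one>\<^bsub>T\<^esub>" "(t c b \<oplus>\<^bsub>T\<^esub> t d d) [^]\<^bsub>T\<^esub> N = \<one>\<^bsub>T\<^esub>"
      "(t a b \<oplus>\<^bsub>T\<^esub> t b d) [^]\<^bsub>T\<^esub> N = \<zero>\<^bsub>T\<^esub>" "(t c a \<oplus>\<^bsub>T\<^esub> t d c) [^]\<^bsub>T\<^esub> N = \<zero>\<^bsub>T\<^esub>"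
      by (subst pow; simp add: tensor flip: T.smult_assoc; simp add: pows pure_one)+
  qed
qed

end

section \<open>Skew derivations of the coordinate ring and relations between their convolution
  products\<close>

abbreviation ix0 :: Enum.finite_3 where "ix0 \<equiv> finite_3.a\<^sub>1"
abbreviation ix1 :: Enum.finite_3 where "ix1 \<equiv> finite_3.a\<^sub>2"
abbreviation ix2 :: Enum.finite_3 where "ix2 \<equiv> finite_3.a\<^sub>3"

text \<open>
  The functionals \<open>\<epsilon>\<close>, \<open>K\<close>, \<open>E\<close>, \<open>K F\<close> on the quantized coordinate ring are arranged
  in the matrices with first row \<open>(\<epsilon>, E, K F)\<close> and lower right block \<open>K\<close> times the identity; this is
  a representation because \<open>E\<close> and \<open>K F\<close> are skew derivations.
\<close>

definition O_rep_diag :: "'k::field \<Rightarrow> Enum.finite_3 \<Rightarrow> Enum.finite_3 \<Rightarrow> 'k" where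
  "O_rep_diag x i j = (if i = j then if i = ix0 then 1 else x else 0)"

definition O_rep_unit :: "Enum.finite_3 \<Rightarrow> Enum.finite_3 \<Rightarrow> Enum.finite_3 \<Rightarrow> 'k::field" where
  "O_rep_unit k i j = (if i = ix0 \<and> j = k then 1 else 0)"

lemma all_finite_3: "(\<forall>i::Enum.finite_3. P i) \<longleftrightarrow> P ix0 \<and> P ix1 \<and> P ix2"
  by (metis finite_3.exhaust)

lemma sum_finite_3: "(\<Sum>i\<in>UNIV. f i) = f ix0 + f ix1 + f ix2" for f :: "Enum.finite_3 \<Rightarrow> 'k::field"
  by (simp add: UNIV_finite_3 add.assoc)

lemma sum_finite_3_times: "(\<Sum>i\<in>UNIV. f i) =
    f (ix0, ix0) + f (ix0, ix1) + f (ix0, ix2) + f (ix1, ix0) + f (ix1, ix1) + f (ix1, ix2) +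
    f (ix2, ix0) + f (ix2, ix1) + f (ix2, ix2)"
  for f :: "Enum.finite_3 \<times> Enum.finite_3 \<Rightarrow> 'k::field"
  unfolding UNIV_Times_UNIV[symmetric] sum.cartesian_product'[symmetric]
  by (simp add: UNIV_finite_3 add.assoc)

lemma O_rep_diag_pow: "O_rep_diag x [^]\<^bsub>matrix_algebra\<^esub> n = O_rep_diag (x ^ n)"
proof -
  interpret kalgebra matrix_algebra by (rule kalgebra_matrix)
  show ?thesis
    by (induction n) (simp_all add: O_rep_diag_def fun_eq_iff all_finite_3 sum_finite_3)
qed

lemma O_rep_relations:
  fixes q :: "'k::field"
  assumes q: "primitive_root_of_unity N q" and N: "N > 1" "odd N"
  shows "O_relations_hold matrix_algebra N q (O_rep_diag q) (O_rep_unit ix1) (O_rep_unit ix2) (O_rep_diag (1 / q))"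
proof -
  interpret kalgebra "matrix_algebra :: ('k, Enum.finite_3 \<Rightarrow> Enum.finite_3 \<Rightarrow> 'k) module"
    by (rule kalgebra_matrix)
  have q0: "q \<noteq> 0" using primitive_root_nonzero[OF q] N by simp
  have qN: "q ^ N = 1" "(1 / q) ^ N = 1" using q by (simp_all add: primitive_root_of_unity_def power_one_over)
  have "O_rep_unit ix1 [^]\<^bsub>matrix_algebra\<^esub> N = (\<lambda>i j. 0 :: 'k)"
    "O_rep_unit ix2 [^]\<^bsub>matrix_algebra\<^esub> N = (\<lambda>i j. 0 :: 'k)"
    using N by (simp_all add: nilpotent_pow[simplified] O_rep_unit_def sum_finite_3)
  then show ?thesis
    unfolding O_relations_hold_def O_rep_diag_pow qN
    using q0
    by (simp add: fun_eq_iff all_finite_3) (simp add: sum_finite_3 O_rep_diag_def O_rep_unit_def)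
qed

text \<open>These matrices form a subalgebra in which both off-diagonal entries of the first row
  obey f(x y) = \<epsilon>(x) f(y) + f(x) K(y). The image of \<pi> lies in it, and therefore so does
  that of \<pi> composed with any automorphism.\<close>

definition skew_form :: "(Enum.finite_3 \<Rightarrow> Enum.finite_3 \<Rightarrow> 'k::field) \<Rightarrow> bool" where
  "skew_form M \<longleftrightarrow> M ix1 ix0 = 0 \<and> M ix2 ix0 = 0 \<and> M ix1 ix2 = 0 \<and> M ix2 ix1 = 0 \<and> M ix1 ix1 = M ix2 ix2"

text \<open>
  The relations \<open>K E = q\<^sup>2 E K\<close>, \<open>K\<cdot>K F = q\<^sup>-\<^sup>2 K F\<cdot>K\<close> and \<open>E\<cdot>K F - q\<^sup>-\<^sup>2 K F\<cdot>E = (K\<^sup>2 - 1) / (q\<^sup>2 - 1)\<close>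
  between convolution products of the functionals, with the denominators cleared, together with the
  vanishing and coincidence conditions which make them stable under matrix multiplication.
\<close>

definition convolution_form ::
    "'k::field \<Rightarrow> (Enum.finite_3 \<times> Enum.finite_3 \<Rightarrow> Enum.finite_3 \<times> Enum.finite_3 \<Rightarrow> 'k) \<Rightarrow> bool" where
  "convolution_form q M \<longleftrightarrow>
     (\<forall>i i' k k'. (i = k \<or> i = ix0) \<and> (i' = k' \<or> i' = ix0) \<or> M (i, i') (k, k') = 0) \<and>
     M (ix0, ix1) (ix0, ix1) = M (ix1, ix0) (ix1, ix0) \<and>
     M (ix0, ix2) (ix0, ix2) = M (ix2, ix0) (ix2, ix0) \<and>
     M (ix1, ix2) (ix1, ix2) = M (ix2, ix1) (ix2, ix1) \<and>
     M (ix0, ix0) (ix1, ix0) = M (ix0, ix0) (ix0, ix1) \<and>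
     M (ix0, ix0) (ix2, ix0) = M (ix0, ix0) (ix0, ix2) \<and>
     q\<^sup>2 * M (ix1, ix0) (ix1, ix2) = M (ix0, ix1) (ix2, ix1) \<and>
     M (ix2, ix0) (ix2, ix1) = q\<^sup>2 * M (ix0, ix2) (ix1, ix2) \<and>
     (q\<^sup>2 - 1) * (q\<^sup>2 * M (ix0, ix0) (ix1, ix2) - M (ix0, ix0) (ix2, ix1)) =
       q\<^sup>2 * (M (ix1, ix2) (ix1, ix2) - M (ix0, ix0) (ix0, ix0))"

lemma convolution_form_one: "convolution_form q (\<lambda>i j. if i = j then 1 else 0)"
  by (auto simp: convolution_form_def)

lemma convolution_form_zero:
  assumes "convolution_form q M" "\<not> ((i = k \<or> i = ix0) \<and> (i' = k' \<or> i' = ix0))"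
  shows "M (i, i') (k, k') = 0"
  using assms unfolding convolution_form_def by blast

lemma convolution_form_lincomb:
  assumes M: "convolution_form q M" and M': "convolution_form q M'"
  shows "convolution_form q (\<lambda>i j. M i j + c * M' i j)"
  unfolding convolution_form_def
proof (intro conjI allI)
  show "(i = k \<or> i = ix0) \<and> (i' = k' \<or> i' = ix0) \<or> M (i, i') (k, k') + c * M' (i, i') (k, k') = 0"
    for i i' k k'
    using convolution_form_zero[OF M, of i k i' k'] convolution_form_zero[OF M', of i k i' k']
    by (cases "(i = k \<or> i = ix0) \<and> (i' = k' \<or> i' = ix0)") simp_all
  have main: "(q\<^sup>2 - 1) * (q\<^sup>2 * M (ix0, ix0) (ix1, ix2) - M (ix0, ix0) (ix2, ix1)) =
      q\<^sup>2 * (M (ix1, ix2) (ix1, ix2) - M (ix0, ix0) (ix0, ix0))"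
    if "convolution_form q M" for M
    using that unfolding convolution_form_def by (elim conjE)
  have "(q\<^sup>2 - 1) * (q\<^sup>2 * (M (ix0, ix0) (ix1, ix2) + c * M' (ix0, ix0) (ix1, ix2)) -
        (M (ix0, ix0) (ix2, ix1) + c * M' (ix0, ix0) (ix2, ix1))) =
      (q\<^sup>2 - 1) * (q\<^sup>2 * M (ix0, ix0) (ix1, ix2) - M (ix0, ix0) (ix2, ix1)) +
      c * ((q\<^sup>2 - 1) * (q\<^sup>2 * M' (ix0, ix0) (ix1, ix2) - M' (ix0, ix0) (ix2, ix1)))"
    by (simp add: algebra_simps)
  also have "\<dots> = q\<^sup>2 * (M (ix1, ix2) (ix1, ix2) + c * M' (ix1, ix2) (ix1, ix2) -
      (M (ix0, ix0) (ix0, ix0) + c * M' (ix0, ix0) (ix0, ix0)))"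
    unfolding main[OF M] main[OF M'] by (simp add: algebra_simps)
  finally show "(q\<^sup>2 - 1) * (q\<^sup>2 * (M (ix0, ix0) (ix1, ix2) + c * M' (ix0, ix0) (ix1, ix2)) -
        (M (ix0, ix0) (ix2, ix1) + c * M' (ix0, ix0) (ix2, ix1))) =
      q\<^sup>2 * (M (ix1, ix2) (ix1, ix2) + c * M' (ix1, ix2) (ix1, ix2) -
        (M (ix0, ix0) (ix0, ix0) + c * M' (ix0, ix0) (ix0, ix0)))" .
qed (use M M' in \<open>unfold convolution_form_def, elim conjE, simp add: algebra_simps\<close>)+

lemma convolution_form_add:
  "convolution_form q M \<Longrightarrow> convolution_form q M' \<Longrightarrow> convolution_form q (\<lambda>i j. M i j + M' i j)"
  using convolution_form_lincomb[of q M M' 1] by simp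

lemma convolution_form_smult:
  assumes "convolution_form q M" shows "convolution_form q (\<lambda>i j. c * M i j)"
  using convolution_form_lincomb[OF _ assms, of "\<lambda>i j. 0" c] by (simp add: convolution_form_def)

text \<open>The vanishing conditions leave few terms in each product sum, and the coincidences match
  them. The essential point is that q^2 E * KF - KF * E and K * K - \<epsilon> satisfy the same skew
  Leibniz rule, so a relation between them passes to products.\<close>

lemma convolution_form_mult:
  assumes M: "convolution_form q M" and M': "convolution_form q M'"
  shows "convolution_form q (\<lambda>i j. \<Sum>k\<in>UNIV. M i k * M' k j)"
proof -
  note zero = convolution_form_zero[OF M] convolution_form_zero[OF M']
  have "(\<Sum>j\<in>UNIV. M (i, i') j * M' j (k, k')) = 0"
    if "\<not> ((i = k \<or> i = ix0) \<and> (i' = k' \<or> i' = ix0))" for i i' k k'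
  proof (rule sum.neutral, rule ballI)
    fix j :: "Enum.finite_3 \<times> Enum.finite_3"
    obtain l l' where j: "j = (l, l')" by (cases j)
    show "M (i, i') j * M' j (k, k') = 0"
      unfolding j using zero(1)[of i l i' l'] zero(2)[of l k l' k'] that by (metis mult_zero_left mult_zero_right)
  qed
  note support = this
  have eqs: "M (ix0, ix1) (ix0, ix1) = M (ix1, ix0) (ix1, ix0)" "M (ix0, ix2) (ix0, ix2) = M (ix2, ix0) (ix2, ix0)"
    "M (ix1, ix2) (ix1, ix2) = M (ix2, ix1) (ix2, ix1)" "M (ix0, ix0) (ix1, ix0) = M (ix0, ix0) (ix0, ix1)"
    "M (ix0, ix0) (ix2, ix0) = M (ix0, ix0) (ix0, ix2)" "M (ix0, ix1) (ix2, ix1) = q\<^sup>2 * M (ix1, ix0) (ix1, ix2)"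
    "M (ix2, ix0) (ix2, ix1) = q\<^sup>2 * M (ix0, ix2) (ix1, ix2)"
    and main: "(q\<^sup>2 - 1) * (q\<^sup>2 * M (ix0, ix0) (ix1, ix2) - M (ix0, ix0) (ix2, ix1)) =
       q\<^sup>2 * (M (ix1, ix2) (ix1, ix2) - M (ix0, ix0) (ix0, ix0))"
    using M unfolding convolution_form_def by (elim conjE, simp)+
  have eqs': "M' (ix0, ix1) (ix0, ix1) = M' (ix1, ix0) (ix1, ix0)" "M' (ix0, ix2) (ix0, ix2) = M' (ix2, ix0) (ix2, ix0)"
    "M' (ix1, ix2) (ix1, ix2) = M' (ix2, ix1) (ix2, ix1)" "M' (ix0, ix0) (ix1, ix0) = M' (ix0, ix0) (ix0, ix1)"
    "M' (ix0, ix0) (ix2, ix0) = M' (ix0, ix0) (ix0, ix2)" "M' (ix0, ix1) (ix2, ix1) = q\<^sup>2 * M' (ix1, ix0) (ix1, ix2)"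
    "M' (ix2, ix0) (ix2, ix1) = q\<^sup>2 * M' (ix0, ix2) (ix1, ix2)"
    and main': "(q\<^sup>2 - 1) * (q\<^sup>2 * M' (ix0, ix0) (ix1, ix2) - M' (ix0, ix0) (ix2, ix1)) =
       q\<^sup>2 * (M' (ix1, ix2) (ix1, ix2) - M' (ix0, ix0) (ix0, ix0))"
    using M' unfolding convolution_form_def by (elim conjE, simp)+
  note sums = sum_finite_3_times zero
  let ?P = "\<lambda>i j. \<Sum>k\<in>UNIV. M i k * M' k j"
  \<comment> \<open>The mixed terms, in which one functional falls on each factor, cancel by the
    q-commutation of \<open>K\<close> with \<open>E\<close> and \<open>K F\<close>; only the two
    Leibniz terms remain.\<close>
  have "(q\<^sup>2 - 1) * (q\<^sup>2 * ?P (ix0, ix0) (ix1, ix2) - ?P (ix0, ix0) (ix2, ix1)) =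
      M (ix0, ix0) (ix0, ix0) * ((q\<^sup>2 - 1) * (q\<^sup>2 * M' (ix0, ix0) (ix1, ix2) - M' (ix0, ix0) (ix2, ix1))) +
      ((q\<^sup>2 - 1) * (q\<^sup>2 * M (ix0, ix0) (ix1, ix2) - M (ix0, ix0) (ix2, ix1))) * M' (ix1, ix2) (ix1, ix2)"
    by (simp add: sums eqs eqs') (simp add: algebra_simps)
  also have "\<dots> = q\<^sup>2 * (?P (ix1, ix2) (ix1, ix2) - ?P (ix0, ix0) (ix0, ix0))"
    unfolding main main' by (simp add: sums) (simp add: algebra_simps)
  finally have final: "(q\<^sup>2 - 1) * (q\<^sup>2 * ?P (ix0, ix0) (ix1, ix2) - ?P (ix0, ix0) (ix2, ix1)) =
      q\<^sup>2 * (?P (ix1, ix2) (ix1, ix2) - ?P (ix0, ix0) (ix0, ix0))" .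
  show ?thesis
    unfolding convolution_form_def
  proof (intro conjI allI)
    show "(i = k \<or> i = ix0) \<and> (i' = k' \<or> i' = ix0) \<or> ?P (i, i') (k, k') = 0" for i i' k k'
      using support by blast
  qed (fact final | simp add: sums eqs eqs' algebra_simps)+
qed

section \<open>Orbits for the quantized coordinate ring\<close>

locale O_hopf = hopf_structure H + O_quadruple H N q a b c d
  for H :: "('k::field, 'h) hopf" (structure) and N q a b c d +
  fixes \<pi> :: "'h \<Rightarrow> Enum.finite_3 \<Rightarrow> Enum.finite_3 \<Rightarrow> 'k"
  assumes generated: "carrier H = generated_subalgebra H {a, b, c, d}"
    and comult_a: "comult H a = pure_tensor H H a a \<oplus>\<^bsub>tensor_algebra H H\<^esub> pure_tensor H H b c"
    and comult_b: "comult H b = pure_tensor H H a b \<oplus>\<^bsub>tensor_algebra H H\<^esub> pure_tensor H H b d"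
    and comult_c: "comult H c = pure_tensor H H c a \<oplus>\<^bsub>tensor_algebra H H\<^esub> pure_tensor H H d c"
    and comult_d: "comult H d = pure_tensor H H c b \<oplus>\<^bsub>tensor_algebra H H\<^esub> pure_tensor H H d d"
    and \<pi>: "\<pi> \<in> alg_hom H matrix_algebra" "\<pi> a = O_rep_diag q" "\<pi> b = O_rep_unit ix1"
      "\<pi> c = O_rep_unit ix2" "\<pi> d = O_rep_diag (1 / q)"
    and counit: "counit H \<in> alg_hom H ground_algebra" "counit H a = 1" "counit H b = 0"
      "counit H c = 0" "counit H d = 1"
begin

lemmas comults = comult_a comult_b comult_c comult_d

lemma generators: "{a, b, c, d} \<subseteq> carrier H" by auto

lemma skew_form_rep:
  assumes "y \<in> carrier H" shows "skew_form (\<pi> y)"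
proof (rule generated_subalgebra_hom_induct[OF kalgebra_matrix \<pi>(1) generators])
  show "y \<in> generated_subalgebra H {a, b, c, d}" using assms generated by simp
  show "skew_form (\<pi> s)" if "s \<in> {a, b, c, d}" for s
    using that by (elim insertE emptyE) (simp_all add: skew_form_def \<pi> O_rep_diag_def O_rep_unit_def)
qed (simp_all add: skew_form_def sum_finite_3)

lemma convolution_form_rep:
  assumes "y \<in> carrier H" shows "convolution_form q (tensor_rep H \<pi> \<pi> (comult H y))"
proof (rule generated_subalgebra_hom_induct[OF kalgebra_matrix convolution_hom[OF \<pi>(1,1)] generators])
  show "y \<in> generated_subalgebra H {a, b, c, d}" using assms generated by simp
  note simps = comults tensor_rep_pure[OF \<pi>(1,1)] tensor_rep_add[OF \<pi>(1,1)] \<pi>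
    kronecker_def O_rep_diag_def O_rep_unit_def power2_eq_square
  show "convolution_form q (tensor_rep H \<pi> \<pi> (comult H s))" if "s \<in> {a, b, c, d}" for s
  proof -
    have "convolution_form q (tensor_rep H \<pi> \<pi> (comult H a))"
      unfolding convolution_form_def by (auto simp: simps algebra_simps)
    moreover have "convolution_form q (tensor_rep H \<pi> \<pi> (comult H b))"
      unfolding convolution_form_def by (auto simp: simps algebra_simps)
    moreover have "convolution_form q (tensor_rep H \<pi> \<pi> (comult H c))"
      unfolding convolution_form_def by (auto simp: simps algebra_simps)
    moreover have "convolution_form q (tensor_rep H \<pi> \<pi> (comult H d))"
      unfolding convolution_form_def by (auto simp: simps algebra_simps)
    ultimately show ?thesis using that by blast
  qed
qed (simp_all add: convolution_form_one convolution_form_add convolution_form_smult convolution_form_mult)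

text \<open>Automorphisms preserve the counit by definition; identifying it with a matrix entry
  makes this information available for \<pi> composed with \<theta>.\<close>

lemma counit_eq_rep: "y \<in> carrier H \<Longrightarrow> counit H y = \<pi> y ix0 ix0"
proof -
  interpret \<pi>: kalgebra_hom H matrix_algebra \<pi>
    by (intro kalgebra_homI kalgebra_axioms kalgebra_matrix \<pi>(1))
  have "(\<lambda>y. \<pi> y ix0 ix0) \<in> alg_hom H ground_algebra"
  proof (rule alg_homI)
    fix x y assume "x \<in> carrier H" "y \<in> carrier H"
    then show "\<pi> (x \<otimes> y) ix0 ix0 = \<pi> x ix0 ix0 \<otimes>\<^bsub>ground_algebra\<^esub> \<pi> y ix0 ix0"
      using skew_form_rep[of y] by (simp add: sum_finite_3 skew_form_def)
  next
    show "\<pi> \<one> ix0 ix0 = \<one>\<^bsub>ground_algebra\<^esub>" using \<pi>.hom_one by simp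
  qed simp_all
  note eq = alg_hom_eq_on_generated[OF kalgebra_axioms kalgebra_ground counit(1) this generators,
      folded generated]
  show "counit H y = \<pi> y ix0 ix0" if "y \<in> carrier H"
  proof (rule eq[OF _ that])
    show "counit H x = \<pi> x ix0 ix0" if "x \<in> {a, b, c, d}" for x
      using that by (elim insertE emptyE) (simp_all add: counit \<pi> O_rep_diag_def O_rep_unit_def)
  qed
qed

text \<open>The common lower diagonal entry of \<pi> composed with \<theta> is a character, and the
  first row consists of \<epsilon> and two skew derivations. The relations of the ring restrict
  their values on the generators, and the relations between convolution products separate
  \<open>E\<close> from \<open>K F\<close>.\<close>

lemma automorphism_on_rep:
  assumes \<theta>: "\<theta> \<in> hopf_automorphisms H"
  obtains \<alpha> \<beta> where "\<alpha> * \<beta> = 1"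
    "\<pi> (\<theta> a) = O_rep_diag q" "\<pi> (\<theta> b) = (\<lambda>i j. \<alpha> * O_rep_unit ix1 i j)"
    "\<pi> (\<theta> c) = (\<lambda>i j. \<beta> * O_rep_unit ix2 i j)" "\<pi> (\<theta> d) = O_rep_diag (1 / q)"
proof -
  define r where "r y = \<pi> (\<theta> y)" for y
  have hom: "\<theta> \<in> alg_hom H H" by (rule hopf_automorphism_alg_hom[OF \<theta>])
  have r: "r \<in> alg_hom H matrix_algebra" unfolding r_def by (rule alg_hom_comp[OF hom \<pi>(1)])
  interpret \<theta>: kalgebra_hom H H \<theta> by (intro kalgebra_homI kalgebra_axioms hom)
  interpret r: kalgebra_hom H matrix_algebra r by (intro kalgebra_homI kalgebra_axioms kalgebra_matrix r)
  have q2: "q\<^sup>2 \<noteq> 1" and q4: "q ^ 4 \<noteq> 1" and q1: "q \<noteq> 1"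
    using primitive_root_power_neq[OF q N] by auto
  define A B C D where "A = r a" "B = r b" "C = r c" "D = r d"
  note defs = A_B_C_D_def
  have form: "skew_form (r y)" if "y \<in> carrier H" for y
    unfolding r_def using that by (intro skew_form_rep) simp
  note forms = form[OF a] form[OF b] form[OF c] form[OF d]
  then have zeros: "M ix1 ix0 = 0" "M ix2 ix0 = 0" "M ix1 ix2 = 0" "M ix2 ix1 = 0" "M ix2 ix2 = M ix1 ix1"
    if "M \<in> {A, B, C, D}" for M using that by (auto simp: skew_form_def defs)
  note zeros = zeros[of A, simplified] zeros[of B, simplified] zeros[of C, simplified] zeros[of D, simplified]
  have "r y ix0 ix0 = \<pi> y ix0 ix0" if "y \<in> carrier H" for y
    using \<theta> that counit_eq_rep[of y] counit_eq_rep[of "\<theta> y"] by (simp add: hopf_automorphisms_def r_def)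
  then have eps: "A ix0 ix0 = 1" "B ix0 ix0 = 0" "C ix0 ix0 = 0" "D ix0 ix0 = 1"
    by (simp_all add: defs \<pi> O_rep_diag_def O_rep_unit_def)
  have rel: "r (b \<otimes> a) = r (q \<odot> (a \<otimes> b))" "r (c \<otimes> a) = r (q \<odot> (a \<otimes> c))"
    "r (a \<otimes> d) = r (\<one> \<oplus> (1 / q) \<odot> (b \<otimes> c))" "r (d \<otimes> a) = r (\<one> \<oplus> q \<odot> (b \<otimes> c))"
    by (simp_all only: quads)
  have one: "r \<one> = (\<lambda>i j. if i = j then 1 else 0)" using r.hom_one by simp
  note simps = sum_finite_3 zeros eps one
  \<comment> \<open>The two determinant relations, evaluated under the character, have the same left
    side because scalars commute; comparing them kills the product of the values of b and c.\<close>
  have "A ix1 ix1 * D ix1 ix1 = 1 + 1 / q * (B ix1 ix1 * C ix1 ix1)"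
    "D ix1 ix1 * A ix1 ix1 = 1 + q * (B ix1 ix1 * C ix1 ix1)"
    using fun_cong[OF fun_cong[OF rel(3)], of ix1 ix1] fun_cong[OF fun_cong[OF rel(4)], of ix1 ix1]
    by (simp_all add: one flip: defs) (simp_all add: simps)
  then have "(q\<^sup>2 - 1) * (B ix1 ix1 * C ix1 ix1) = 0" and *: "A ix1 ix1 * D ix1 ix1 = 1 + q * (B ix1 ix1 * C ix1 ix1)"
    by (simp_all add: field_simps power2_eq_square)
  then have AD: "A ix1 ix1 * D ix1 ix1 = 1" using q2 by simp
  have BA: "B i ix0 * A ix0 j + B i ix1 * A ix1 j + B i ix2 * A ix2 j =
      q * (A i ix0 * B ix0 j + A i ix1 * B ix1 j + A i ix2 * B ix2 j)"
    and CA: "C i ix0 * A ix0 j + C i ix1 * A ix1 j + C i ix2 * A ix2 j =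
      q * (A i ix0 * C ix0 j + A i ix1 * C ix1 j + A i ix2 * C ix2 j)" for i j
    using fun_cong[OF fun_cong[OF rel(1)], of i j] fun_cong[OF fun_cong[OF rel(2)], of i j]
    by (simp_all add: sum_finite_3 flip: defs)
  have BC: "B ix1 ix1 = 0" "C ix1 ix1 = 0"
  proof -
    have "B ix1 ix1 * (A ix1 ix1 * (1 - q)) = 0" "C ix1 ix1 * (A ix1 ix1 * (1 - q)) = 0"
      using BA[of ix1 ix1] CA[of ix1 ix1] by (simp_all add: simps algebra_simps)
    then show "B ix1 ix1 = 0" "C ix1 ix1 = 0" using AD q1 by auto
  qed
  have skew: "B ix0 ix1 * (A ix1 ix1 - q) = 0" "B ix0 ix2 * (A ix1 ix1 - q) = 0"
    "C ix0 ix1 * (A ix1 ix1 - q) = 0" "C ix0 ix2 * (A ix1 ix1 - q) = 0"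
    using BA[of ix0 ix1] BA[of ix0 ix2] CA[of ix0 ix1] CA[of ix0 ix2]
    by (simp_all add: simps BC algebra_simps)
  have conv: "convolution_form q (tensor_rep H r r (comult H y))" if "y \<in> carrier H" for y
    using convolution_form_rep[of "\<theta> y"] convolution_automorphism[OF \<theta> that \<pi>(1,1)] that
    by (simp add: r_def[abs_def])
  have q_comm: "q\<^sup>2 * tensor_rep H r r (comult H y) (ix1, ix0) (ix1, ix2) = tensor_rep H r r (comult H y) (ix0, ix1) (ix2, ix1)"
    "tensor_rep H r r (comult H y) (ix2, ix0) (ix2, ix1) = q\<^sup>2 * tensor_rep H r r (comult H y) (ix0, ix2) (ix1, ix2)"
    and commutator: "(q\<^sup>2 - 1) * (q\<^sup>2 * tensor_rep H r r (comult H y) (ix0, ix0) (ix1, ix2) - tensor_rep H r r (comult H y) (ix0, ix0) (ix2, ix1)) =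
       q\<^sup>2 * (tensor_rep H r r (comult H y) (ix1, ix2) (ix1, ix2) - tensor_rep H r r (comult H y) (ix0, ix0) (ix0, ix0))"
    if "y \<in> carrier H" for y
    using conv[OF that] unfolding convolution_form_def by - (elim conjE, assumption)+
  note rep = tensor_rep_pure[OF r r] tensor_rep_add[OF r r] kronecker_def comults
  have nz: "A ix1 ix1 \<noteq> 0" "D ix1 ix1 \<noteq> 0" using AD by auto
  \<comment> \<open>On a and d the convolutions of \<open>K\<close> with a skew derivation in either
    order have equal values, since the character kills b and c. They should differ by the factor
    q^2, so they are zero.\<close>
  have "A ix1 ix1 * A ix0 ix2 * (q\<^sup>2 - 1) = 0" "A ix1 ix1 * A ix0 ix1 * (q\<^sup>2 - 1) = 0"
    "D ix1 ix1 * D ix0 ix2 * (q\<^sup>2 - 1) = 0" "D ix1 ix1 * D ix0 ix1 * (q\<^sup>2 - 1) = 0"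
    using q_comm[OF a] q_comm[OF d]
    by (simp_all add: rep flip: defs, auto simp: simps BC algebra_simps)
  then have AD0: "A ix0 ix2 = 0" "A ix0 ix1 = 0" "D ix0 ix2 = 0" "D ix0 ix1 = 0"
    using nz q2 by auto
  have bc: "q\<^sup>2 * (A ix1 ix1 * B ix0 ix2) = B ix0 ix2 * D ix1 ix1" "D ix1 ix1 * C ix0 ix1 = q\<^sup>2 * (A ix1 ix1 * C ix0 ix1)"
    using q_comm[OF b] q_comm[OF c]
    by (simp_all add: rep flip: defs, simp_all add: simps BC AD0 algebra_simps)
  \<comment> \<open>Otherwise the functional \<open>E\<close> composed with \<theta> vanishes on the
    generators, and by the Leibniz rule everywhere, although \<open>E\<close> is 1 on b, which lies
    in the image of \<theta>.\<close>
  have A11: "A ix1 ix1 = q"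
  proof (rule ccontr)
    assume "A ix1 ix1 \<noteq> q"
    then have BC0: "B ix0 ix1 = 0" "C ix0 ix1 = 0" using skew by auto
    have "skew_form (r y) \<and> r y ix0 ix1 = 0" if "y \<in> carrier H" for y
    proof (rule generated_subalgebra_hom_induct[OF kalgebra_matrix r generators that[unfolded generated]])
      show "skew_form (r s) \<and> r s ix0 ix1 = 0" if "s \<in> {a, b, c, d}" for s
        using that AD0 BC0 forms by (auto simp: defs)
    qed (auto simp: skew_form_def sum_finite_3)
    moreover obtain y where "y \<in> carrier H" "\<theta> y = b"
      using hopf_automorphism_surj[OF \<theta>] b by (metis imageE)
    ultimately have "\<pi> b ix0 ix1 = 0" by (auto simp: r_def)
    then show False by (simp add: \<pi> O_rep_unit_def)
  qed
  then have D11: "D ix1 ix1 = 1 / q" using AD by (simp add: field_simps)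
  \<comment> \<open>On b and c the order of convolution changes the value by the ratio of the
    character at a and d, which is q^2; compared with the required factor this leaves q^4 -
    1.\<close>
  have "B ix0 ix2 * (q ^ 4 - 1) = 0" "C ix0 ix1 * (q ^ 4 - 1) = 0"
    using bc by (simp_all add: A11 D11 field_simps power2_eq_square power4_eq_xxxx)
  then have BC0: "B ix0 ix2 = 0" "C ix0 ix1 = 0" using q4 by auto
  \<comment> \<open>On a, with coproduct \<open>a \<otimes> a + b \<otimes> c\<close>, only
    \<open>E\<close> on b times \<open>K F\<close> on c survives, and \<open>K * K\<close> takes the
    value q^2.\<close>
  have "(q\<^sup>2 - 1) * (q\<^sup>2 * (B ix0 ix1 * C ix0 ix2)) = q\<^sup>2 * (q\<^sup>2 - 1)"
    using commutator[OF a]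
    by (simp add: rep flip: defs) (simp add: simps BC BC0 AD0 A11 power2_eq_square)
  then have "B ix0 ix1 * C ix0 ix2 = 1" using q2 by simp
  moreover have "A = O_rep_diag q" "D = O_rep_diag (1 / q)"
    "B = (\<lambda>i j. B ix0 ix1 * O_rep_unit ix1 i j)" "C = (\<lambda>i j. C ix0 ix2 * O_rep_unit ix2 i j)"
    by (simp_all add: fun_eq_iff all_finite_3 O_rep_diag_def O_rep_unit_def simps BC BC0 AD0 A11 D11)
  ultimately show thesis using that by (simp add: defs r_def)
qed

text \<open>
  The quantum spheres of Podles: if \<open>(a, b)\<close> and \<open>(c, d)\<close> are the rows of the fundamental matrix and
  \<open>v \<otimes> w\<close> denotes the products of their entries, the four elements are the entries of
  \<open>(a, b) \<otimes> (a, b) + (a, b) \<otimes> (c, d) + t (c, d) \<otimes> (c, d)\<close>.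
\<close>

definition sphere :: "'k \<Rightarrow> bool \<Rightarrow> bool \<Rightarrow> 'h" where
  "sphere t i j = (let u = (\<lambda>i. if i then b else a); v = (\<lambda>i. if i then d else c) in
     u i \<otimes> u j \<oplus> u i \<otimes> v j \<oplus> t \<odot> (v i \<otimes> v j))"

lemma sphere_closed [simp, intro]: "sphere t i j \<in> carrier H"
  by (simp add: sphere_def Let_def)

text \<open>Each row of the fundamental matrix spans a right coideal, and both rows have the same
  coefficients. Hence every fixed combination of products of rows transforms into itself in the left
  tensor factor.\<close>

lemma comult_sphere:
  defines "m \<equiv> (\<lambda>i j. if i then if j then d else c else if j then b else a)"
  shows "comult H (sphere t i j) =
    sphere t False False \<otimes>\<^sub>h (m False i \<otimes> m False j) \<oplus>\<^bsub>HH\<^esub> sphere t False True \<otimes>\<^sub>h (m False i \<otimes> m True j) \<oplus>\<^bsub>HH\<^esub>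
    sphere t True False \<otimes>\<^sub>h (m True i \<otimes> m False j) \<oplus>\<^bsub>HH\<^esub> sphere t True True \<otimes>\<^sub>h (m True i \<otimes> m True j)"
  unfolding m_def
  by (cases i; cases j)
     (simp_all add: sphere_def comults pure_mult pure_add_l pure_smult_l T.l_distr T.r_distr T.smult_r_distr T.a_ac)

lemma infinite_orbits_O:
  assumes inf: "infinite (UNIV :: 'k set)"
  shows "infinite (right_coideal_subalgebra_orbits H)"
proof (rule infinite_orbits[OF inf])
  define S where "S t = {sphere t i j | i j. True}" for t
  define Y where "Y t = generated_subalgebra H (S t)" for t
  have S: "S t \<subseteq> carrier H" for t by (auto simp: S_def)
  have sub: "Y t \<subseteq> carrier H" for t unfolding Y_def using S by (rule generated_subalgebra_subset)
  have sphere: "sphere t i j \<in> Y t" for t i j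
    unfolding Y_def by (rule generated_subalgebra.incl) (auto simp: S_def)
  show "Y t \<in> right_coideal_subalgebras H" for t
    unfolding Y_def
  proof (rule generated_right_coideal_subalgebra[OF S])
    fix s assume "s \<in> S t"
    then obtain i j where "s = sphere t i j" by (auto simp: S_def)
    then show "comult H s \<in> tensor_subspace H H (generated_subalgebra H (S t)) (carrier H)"
      unfolding Y_def[symmetric] using sub sphere
      by (simp only: comult_sphere) (intro tensor_subspace_add tensor_subspace_pure; simp)
  qed
  have q1: "(1 + q) * (q - 1) \<noteq> 0"
    using primitive_root_power_neq[OF q N] by (auto simp: add_eq_0_iff)
  \<comment> \<open>This is 1/(q^2 - 1): on \<open>a a + a c + s c c\<close> the functional
    \<open>K F\<close> takes the value 1 and K - \<epsilon> the value q^2 - 1.\<close>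
  define \<kappa> where "\<kappa> = 1 / ((1 + q) * (q - 1))"
  \<comment> \<open>The coefficient s/q is read off from \<open>a b + a d + s c d\<close>, where
    \<open>E\<close> is 1, \<open>K F\<close> is s/q and K - \<epsilon> is zero.\<close>
  define h where "h s M = M ix0 ix2 - s / q * M ix0 ix1 - \<kappa> * (M ix1 ix1 - M ix0 ix0)"
    for s and M :: "Enum.finite_3 \<Rightarrow> Enum.finite_3 \<Rightarrow> 'k"
  interpret \<pi>: kalgebra_hom H matrix_algebra \<pi>
    by (intro kalgebra_homI kalgebra_axioms kalgebra_matrix \<pi>(1))
  note simps = sum_finite_3 O_rep_diag_def O_rep_unit_def
  \<comment> \<open>Since K - \<epsilon> obeys the same skew Leibniz rule as \<open>E\<close> and
    \<open>K F\<close>, so does \<open>h s\<close>; vanishing on the spheres therefore extends to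
    the subalgebra. The shape \<open>skew_form\<close> is carried along because the rule depends on
    it.\<close>
  have vanish: "skew_form (\<pi> y) \<and> h s (\<pi> y) = 0" if "y \<in> Y s" for s y
  proof (rule generated_subalgebra_hom_induct[OF kalgebra_matrix \<pi>(1) S that[unfolded Y_def]])
    fix x assume "x \<in> S s"
    then obtain i j where x: "x = sphere s i j" by (auto simp: S_def)
    have "h s (\<pi> (sphere s i j)) = 0"
      using q1 by (cases i; cases j) (simp_all add: sphere_def h_def \<kappa>_def \<pi> simps field_simps)
    then show "skew_form (\<pi> x) \<and> h s (\<pi> x) = 0" using skew_form_rep x by simp
  next
    fix M M' assume M: "skew_form M \<and> h s M = 0" and M': "skew_form M' \<and> h s M' = 0"
    have "h s (M \<otimes>\<^bsub>matrix_algebra\<^esub> M') = M ix0 ix0 * h s M' + h s M * M' ix1 ix1"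
      using conjunct1[OF M] conjunct1[OF M']
      by (simp add: h_def sum_finite_3 skew_form_def algebra_simps add_divide_distrib)
    then show "skew_form (M \<otimes>\<^bsub>matrix_algebra\<^esub> M') \<and> h s (M \<otimes>\<^bsub>matrix_algebra\<^esub> M') = 0"
      using M M' by (simp add: skew_form_def sum_finite_3)
    have "h s (M \<oplus>\<^bsub>matrix_algebra\<^esub> M') = h s M + h s M'"
      by (simp add: h_def algebra_simps add_divide_distrib)
    then show "skew_form (M \<oplus>\<^bsub>matrix_algebra\<^esub> M') \<and> h s (M \<oplus>\<^bsub>matrix_algebra\<^esub> M') = 0"
      using M M' by (simp add: skew_form_def)
  next
    fix c and M assume M: "skew_form M \<and> h s M = 0"
    have "h s (c \<odot>\<^bsub>matrix_algebra\<^esub> M) = c * h s M" by (simp add: h_def algebra_simps add_divide_distrib)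
    then show "skew_form (c \<odot>\<^bsub>matrix_algebra\<^esub> M) \<and> h s (c \<odot>\<^bsub>matrix_algebra\<^esub> M) = 0"
      using M by (simp add: skew_form_def)
  qed (simp_all add: skew_form_def h_def)
  fix \<theta> s t assume \<theta>: "\<theta> \<in> hopf_automorphisms H" and eq: "\<theta> ` Y t = Y s"
  obtain \<alpha> \<beta> where ab: "\<alpha> * \<beta> = 1"
    "\<pi> (\<theta> a) = O_rep_diag q" "\<pi> (\<theta> b) = (\<lambda>i j. \<alpha> * O_rep_unit ix1 i j)"
    "\<pi> (\<theta> c) = (\<lambda>i j. \<beta> * O_rep_unit ix2 i j)" "\<pi> (\<theta> d) = O_rep_diag (1 / q)"
    using automorphism_on_rep[OF \<theta>] .
  interpret \<theta>: kalgebra_hom H H \<theta>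
    by (intro kalgebra_homI kalgebra_axioms hopf_automorphism_alg_hom[OF \<theta>])
  have zero: "h s (\<pi> (\<theta> (sphere t i j))) = 0" for i j
    using vanish[of "\<theta> (sphere t i j)" s] sphere eq by blast
  \<comment> \<open>On \<open>a a + a c + t c c\<close> the rescaled functional gives \<beta> from
    the mixed term against the constant 1 from K - \<epsilon>.\<close>
  have "\<beta> = 1"
    using zero[of False False] q1 by (simp add: sphere_def h_def \<kappa>_def ab simps field_simps)
  moreover have "t * \<beta> = s * \<alpha>"
    using zero[of False True] by (simp add: sphere_def h_def \<kappa>_def ab simps field_simps)
  ultimately show "t = s" using ab(1) by simp
qed

end

lemma (in presentation) presented_hopf_counit:
  assumes "free_extension ground_algebra \<epsilon> ` R \<subseteq> {0}"
  shows "counit (presented_hopf_algebra R \<delta> \<epsilon> \<sigma>) \<in> alg_hom P ground_algebra"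
    and "counit (presented_hopf_algebra R \<delta> \<epsilon> \<sigma>) (presented_generator R g) = \<epsilon> g"
  using presented_lift_alg_hom[OF kalgebra_ground, of \<epsilon>] presented_lift_generator[OF kalgebra_ground, of \<epsilon>]
    assms by simp_all

lemma ground_pow: "x [^]\<^bsub>ground_algebra\<^esub> (n::nat) = x ^ n"
proof -
  interpret kalgebra ground_algebra by (rule kalgebra_ground)
  show ?thesis by (induction n) simp_all
qed

lemma infinite_orbits_O_bar:
  fixes q :: "'k::field"
  assumes N: "N > 1" "odd N" and q: "primitive_root_of_unity N q" and inf: "infinite (UNIV :: 'k set)"
  shows "infinite (right_coideal_subalgebra_orbits (O_bar N q))"
proof -
  interpret O_presentation N q .
  let ?R = "O_relations N q"
  let ?a = "gen O_a" and ?b = "gen O_b" and ?c = "gen O_c" and ?d = "gen O_d"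
  let ?T = "tensor_algebra P P" and ?t = "pure_tensor P P"
  interpret A: O_quadruple P N q ?a ?b ?c ?d
    by (intro O_quadruple.intro O_quadruple_axioms.intro kalgebra_presented N q
        presented_generator_closed relations_hold)
  interpret PP: tensor_product P P by (simp add: tensor_product_def kalgebra_presented)
  define \<delta> where "\<delta> g = (case g of O_a \<Rightarrow> ?t ?a ?a \<oplus>\<^bsub>?T\<^esub> ?t ?b ?c | O_b \<Rightarrow> ?t ?a ?b \<oplus>\<^bsub>?T\<^esub> ?t ?b ?d
      | O_c \<Rightarrow> ?t ?c ?a \<oplus>\<^bsub>?T\<^esub> ?t ?d ?c | O_d \<Rightarrow> ?t ?c ?b \<oplus>\<^bsub>?T\<^esub> ?t ?d ?d)" for g
  define \<epsilon> :: "O_gen \<Rightarrow> 'k" where "\<epsilon> g = (case g of O_a \<Rightarrow> 1 | O_b \<Rightarrow> 0 | O_c \<Rightarrow> 0 | O_d \<Rightarrow> 1)" for g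
  define \<sigma> where "\<sigma> g = (case g of O_a \<Rightarrow> ?d | O_b \<Rightarrow> (- q) \<odot>\<^bsub>P\<^esub> ?b | O_c \<Rightarrow> (- (1 / q)) \<odot>\<^bsub>P\<^esub> ?c | O_d \<Rightarrow> ?a)" for g
  define \<gamma> where "\<gamma> g = (case g of O_a \<Rightarrow> O_rep_diag q | O_b \<Rightarrow> O_rep_unit ix1 | O_c \<Rightarrow> O_rep_unit ix2
      | O_d \<Rightarrow> O_rep_diag (1 / q))" for g
  have H: "O_bar N q = presented_hopf_algebra ?R \<delta> \<epsilon> \<sigma>"
    by (simp add: O_bar_def Let_def \<delta>_def[abs_def] \<epsilon>_def[abs_def] \<sigma>_def[abs_def])
  have \<delta>: "\<delta> g \<in> carrier ?T" for g by (cases g) (auto simp: \<delta>_def)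
  have \<sigma>: "\<sigma> g \<in> carrier P" for g by (cases g) (auto simp: \<sigma>_def)
  have "free_extension ?T \<delta> ` ?R \<subseteq> {\<zero>\<^bsub>?T\<^esub>}"
    unfolding free_extension_relations[OF PP.kalgebra_tensor \<delta>]
    using A.comult_relations by (simp add: \<delta>_def)
  moreover have "free_extension (opposite_algebra P) \<sigma> ` ?R \<subseteq> {\<zero>\<^bsub>opposite_algebra P\<^esub>}"
    using A.antipode_relations \<sigma>
    by (subst free_extension_relations[OF A.kalgebra_opposite]) (simp_all add: \<sigma>_def)
  ultimately interpret O: hopf_presentation ?R \<delta> \<epsilon> \<sigma>
    using \<delta> \<sigma> by unfold_locales auto
  have "O_relations_hold ground_algebra N q 1 0 0 1"
    using N by (simp add: O_relations_hold_def ground_pow)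
  then have "free_extension ground_algebra \<epsilon> ` ?R \<subseteq> {\<zero>\<^bsub>ground_algebra\<^esub>}"
    by (subst free_extension_relations[OF kalgebra_ground]) (simp_all add: \<epsilon>_def)
  then have \<epsilon>: "free_extension ground_algebra \<epsilon> ` ?R \<subseteq> {0}" by simp
  note counit = presented_hopf_counit[OF \<epsilon>, of \<delta> \<sigma>]
  have M: "kalgebra (matrix_algebra :: ('k, Enum.finite_3 \<Rightarrow> Enum.finite_3 \<Rightarrow> 'k) module)"
    by (rule kalgebra_matrix)
  have zero: "free_extension matrix_algebra \<gamma> ` ?R \<subseteq> {\<zero>\<^bsub>matrix_algebra\<^esub>}"
    using O_rep_relations[OF q N] by (subst free_extension_relations[OF M]) (simp_all add: \<gamma>_def)
  define \<pi> where "\<pi> = quotient_lift (free_extension matrix_algebra \<gamma>)"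
  have \<pi>: "\<pi> \<in> alg_hom P matrix_algebra" "\<pi> (gen g) = \<gamma> g" for g
    using presented_lift_alg_hom[OF M _ zero] presented_lift_generator[OF M _ zero] by (simp_all add: \<pi>_def)
  have univ: "UNIV = {O_a, O_b, O_c, O_d}" by (auto intro: O_gen.exhaust)
  have range: "range gen = {?a, ?b, ?c, ?d}" unfolding univ by simp
  interpret B: O_quadruple O.H N q ?a ?b ?c ?d
    using A.relations A.a A.b A.c A.d
    by (intro O_quadruple.intro O_quadruple_axioms.intro O.kalgebra_H N q) (simp_all add: O_relations_hold_def)
  interpret O_hopf O.H N q ?a ?b ?c ?d \<pi>
    using O.comult_generator[of O_a] O.comult_generator[of O_b] O.comult_generator[of O_c]
      O.comult_generator[of O_d] presented_algebra_generated \<pi> counit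
    by (intro O_hopf.intro O.Hopf.hopf_structure_axioms B.O_quadruple_axioms O_hopf_axioms.intro)
       (simp_all add: range \<delta>_def \<gamma>_def \<epsilon>_def del: presented_hopf_algebra_simps(8))
  show ?thesis unfolding H by (rule infinite_orbits_O[OF inf])
qed

theorem proposition6p4:
  fixes N :: nat and q :: "'k :: {alg_closed_field, field_char_0}"
  assumes "N > 1" and "odd N" and "primitive_root_of_unity N q"
  shows "infinite (right_coideal_subalgebra_orbits (U_bar N q)) \<and>
         infinite (right_coideal_subalgebra_orbits (O_bar N q))"
  using infinite_orbits_U_bar[OF assms infinite_UNIV_char_0] infinite_orbits_O_bar[OF assms infinite_UNIV_char_0]
  by blast

end
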